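(* Let $\mathcal H=\bigoplus_{\mathbf n\in\mathbb N^\ell}\mathcal H_{\mathbf n}$ be an $\mathbb N^\ell$-graded connected Hopf algebra over $\mathbb Q$ and let $\mathbf k\in(\mathbb N\cup\{\infty\})^\ell$. (1) If $\phi:\mathcal H\to\mathbb Q$ is a $\mathbf k$-even linear functional with $\phi(1)=1$, then there exists a unique morphism $\Psi:\mathcal H\to\mathrm{QSym}^{(\ell)}$ of $\mathbb N^\ell$-graded coalgebras such that $\zeta_{\mathcal Q}\circ\Psi=\phi$, and the image of $\Psi$ lies in $\mathcal E^{\mathbf k}$. (2) Explicitly, for $h\in\mathcal H_{\mathbf n}$, $\Psi(h)=\sum_{\mathbf I}\phi^{\mathbf I}(h)M_{\mathbf I}$, summed over vector compositions $\mathbf I$ of $\mathbf n$, where for $\mathbf I=(\mathbf i_1,\dots,\mathbf i_m)$, $\phi^{\mathbf I}$ is the composite $\mathcal H\xrightarrow{\Delta^{(m-1)}}\mathcal H^{\otimes m}\xrightarrow{\text{projection}}\mathcal H_{\mathbf i_1}\otimes\cdots\otimes\mathcal H_{\mathbf i_m}\xrightarrow{\phi^{\otimes m}}\mathbb Q^{\otimes m}\xrightarrow{\text{mult.}}\mathbb Q$. (3) If $\phi$ is moreover a character, then $\Psi$ is a homomorphism of $\mathbb N^\ell$-graded Hopf algebras; that is, $(\mathcal E^{\mathbf k},\zeta_{\mathcal Q})$ is the terminal object of the category of multigraded combinatorial Hopf algebras whose characters are $\mathbf k$-even.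
   Context: Fix $\ell\ge1$. $\mathbb N^\ell$ consists of column vectors with weight $|\mathbf n|=\sum n_i$, ordered coordinatewise; extended to $(\mathbb N\cup\{\infty\})^\ell$ with $\infty$ larger than every integer. A vector composition of $\mathbf n$ is a sequence of nonzero elements of $\mathbb N^\ell$ summing to $\mathbf n$. $\mathrm{QSym}^{(\ell)}$ is the $\mathbb Q$-span of $M_{\mathbf I}=\sum_{j_1<\dots<j_m}\mathbf x_{j_1}^{\mathbf i_1}\cdots\mathbf x_{j_m}^{\mathbf i_m}$, $M_{()}=1$, in commuting variables $x_j^{(i)}$ ($j\ge1$, $0\le i<\ell$), $\mathbf x_j^{\mathbf n}=\prod_i(x_j^{(i)})^{n_i}$; it is an $\mathbb N^\ell$-graded connected Hopf algebra with the product of power series and deconcatenation coproduct $\Delta M_{\mathbf I}=\sum_{\mathbf I=\mathbf J\mathbf K}M_{\mathbf J}\otimes M_{\mathbf K}$. $\zeta_{\mathcal Q}$ is the character with $\zeta_{\mathcal Q}(M_{\mathbf I})=1$ if $\mathbf I$ has length $\le1$, else $0$. Convolution of functionals: $\phi\psi=m\circ(\phi\otimes\psi)\circ\Delta$; $\phi$ is invertible iff $\phi(1)\ne0$. $\phi_{\mathbf n}$ is the restriction of $\phi$ to $\mathcal H_{\mathbf n}$; $\bar\phi(h)=(-1)^{|\mathbf n|}\phi(h)$ for $h\in\mathcal H_{\mathbf n}$. An invertible linear functional $\phi$ is $\mathbf k$-even if $(\bar\phi)_{\mathbf n}=\phi_{\mathbf n}$ for all $\mathbf n\in\mathbb N^\ell$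 with $\mathbf n\le\mathbf k$. For functionals $\phi,\psi$, $\mathcal S_{\mathbf k}(\phi,\psi)$ is the largest graded subcoalgebra $C$ with $\phi(h)=\psi(h)$ for all $h\in C\cap\bigoplus_{\mathbf n\le\mathbf k}\mathcal H_{\mathbf n}$. $\mathcal E^{\mathbf k}=\mathcal S_{\mathbf k}(\bar\zeta_{\mathcal Q},\zeta_{\mathcal Q})\subseteq\mathrm{QSym}^{(\ell)}$. A multigraded combinatorial Hopf algebra is a pair $(\mathcal H,\phi)$ with $\phi$ a character; morphisms are graded Hopf maps $\Psi$ with $\phi'\circ\Psi=\phi$. *)

theory Defs
  imports
    "HOL-Analysis.Finite_Cartesian_Product"
    "HOL-Library.Poly_Mapping"
    "HOL-Library.Extended_Nat"
begin

section \<open>Vector spaces over the rationals\<close>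

class rat_vector = ab_group_add +
  fixes scaleQ :: "rat \<Rightarrow> 'a \<Rightarrow> 'a" (infixr \<open>*\<^sub>Q\<close> 75)
  assumes scaleQ_add_right: "a *\<^sub>Q (x + y) = a *\<^sub>Q x + a *\<^sub>Q y"
    and scaleQ_add_left: "(a + b) *\<^sub>Q x = a *\<^sub>Q x + b *\<^sub>Q x"
    and scaleQ_scaleQ: "a *\<^sub>Q b *\<^sub>Q x = (a * b) *\<^sub>Q x"
    and scaleQ_one: "1 *\<^sub>Q x = x"

global_interpretation rat_vector: vector_space "scaleQ :: rat \<Rightarrow> 'a \<Rightarrow> 'a::rat_vector"
  by standard (simp_all add: scaleQ_add_right scaleQ_add_left scaleQ_scaleQ scaleQ_one)

instantiation rat :: rat_vector
begin
definition scaleQ_rat :: "rat \<Rightarrow> rat \<Rightarrow> rat" where "scaleQ_rat = (*)"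
instance by standard (simp_all add: scaleQ_rat_def algebra_simps)
end

instantiation poly_mapping :: (type, rat_vector) rat_vector
begin
lift_definition scaleQ_poly_mapping :: "rat \<Rightarrow> ('a \<Rightarrow>\<^sub>0 'b) \<Rightarrow> ('a \<Rightarrow>\<^sub>0 'b)"
  is "\<lambda>c f i. c *\<^sub>Q f i"
  by (erule finite_subset[rotated]) auto
instance
  by standard (transfer; simp add: fun_eq_iff scaleQ_add_right scaleQ_add_left scaleQ_scaleQ scaleQ_one)+
end

definition linear_on :: "'a::rat_vector set \<Rightarrow> ('a \<Rightarrow> 'b::rat_vector) \<Rightarrow> bool" where
  "linear_on V f \<longleftrightarrow>
     (\<forall>x\<in>V. \<forall>y\<in>V. f (x + y) = f x + f y) \<and> (\<forall>c. \<forall>x\<in>V. f (c *\<^sub>Q x) = c *\<^sub>Q f x)"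

text \<open>
  The linear map sending \<open>b i\<close> to \<open>g i\<close> for all \<open>i \<in> I\<close>. It is only meaningful where such a map
  exists, and only on the span of the \<open>b i\<close>, where it is then unique.
\<close>

definition linear_extension ::
  "'i set \<Rightarrow> ('i \<Rightarrow> 'a::rat_vector) \<Rightarrow> ('i \<Rightarrow> 'b::rat_vector) \<Rightarrow> 'a \<Rightarrow> 'b" where
  "linear_extension I b g =
     (SOME L. Vector_Spaces.linear scaleQ scaleQ L \<and> (\<forall>i\<in>I. L (b i) = g i))"

section \<open>Tensor powers\<close>

text \<open>
  The type \<open>'a tensor\<close> is the whole tensor algebra of \<open>'a\<close>: the free vector space on lists of
  vectors modulo multilinearity in every position. Its \<open>m\<close>-th homogeneous part is the \<open>m\<close>-th
  tensor power, so that all tensor powers live in one type and the identifications of the ground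
  field with the zeroth tensor power and of the space with the first one are built in. As the
  ground ring is a field, the tensor power of a subspace is a subspace of the tensor power.
\<close>

definition free_vec :: "'i \<Rightarrow> 'i \<Rightarrow>\<^sub>0 rat" where
  "free_vec i = Poly_Mapping.single i 1"

definition tensor_relations :: "('a::rat_vector list \<Rightarrow>\<^sub>0 rat) set" where
  "tensor_relations = rat_vector.span
     ({free_vec (xs @ [a + b] @ ys) - free_vec (xs @ [a] @ ys) - free_vec (xs @ [b] @ ys)
        | xs a b ys. True} \<union>
      {free_vec (xs @ [c *\<^sub>Q a] @ ys) - c *\<^sub>Q free_vec (xs @ [a] @ ys) | xs c a ys. True})"

quotient_type (overloaded) 'a tensor = "'a::rat_vector list \<Rightarrow>\<^sub>0 rat" /
  "\<lambda>p q. p - q \<in> tensor_relations"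
proof (rule equivpI)
  show "reflp (\<lambda>p q. p - q \<in> (tensor_relations :: ('a list \<Rightarrow>\<^sub>0 rat) set))"
    by (rule reflpI) (simp add: tensor_relations_def rat_vector.span_zero)
  show "symp (\<lambda>p q. p - q \<in> (tensor_relations :: ('a list \<Rightarrow>\<^sub>0 rat) set))"
  proof (rule sympI)
    fix p q :: "'a list \<Rightarrow>\<^sub>0 rat"
    assume "p - q \<in> tensor_relations"
    then have "- (p - q) \<in> tensor_relations"
      unfolding tensor_relations_def by (rule rat_vector.span_neg)
    then show "q - p \<in> tensor_relations" by simp
  qed
  show "transp (\<lambda>p q. p - q \<in> (tensor_relations :: ('a list \<Rightarrow>\<^sub>0 rat) set))"
  proof (rule transpI)
    fix p q r :: "'a list \<Rightarrow>\<^sub>0 rat"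
    assume "p - q \<in> tensor_relations" "q - r \<in> tensor_relations"
    then have "(p - q) + (q - r) \<in> tensor_relations"
      unfolding tensor_relations_def by (rule rat_vector.span_add)
    then show "p - r \<in> tensor_relations" by simp
  qed
qed

instantiation tensor :: (rat_vector) rat_vector
begin

lift_definition zero_tensor :: "'a tensor" is 0 .

lift_definition plus_tensor :: "'a tensor \<Rightarrow> 'a tensor \<Rightarrow> 'a tensor" is "(+)"
proof -
  fix p p' q q' :: "'a list \<Rightarrow>\<^sub>0 rat"
  assume "p - p' \<in> tensor_relations" "q - q' \<in> tensor_relations"
  then have "(p - p') + (q - q') \<in> tensor_relations"
    unfolding tensor_relations_def by (rule rat_vector.span_add)
  then show "p + q - (p' + q') \<in> tensor_relations"
    by (simp add: add_diff_add)
qed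

lift_definition minus_tensor :: "'a tensor \<Rightarrow> 'a tensor \<Rightarrow> 'a tensor" is "(-)"
proof -
  fix p p' q q' :: "'a list \<Rightarrow>\<^sub>0 rat"
  assume "p - p' \<in> tensor_relations" "q - q' \<in> tensor_relations"
  then have "(p - p') - (q - q') \<in> tensor_relations"
    unfolding tensor_relations_def by (rule rat_vector.span_diff)
  then show "p - q - (p' - q') \<in> tensor_relations"
    by (simp only: diff_diff_eq diff_diff_eq2 diff_add_eq add_diff_eq add.commute add.left_commute)
qed

lift_definition uminus_tensor :: "'a tensor \<Rightarrow> 'a tensor" is "uminus"
proof -
  fix p q :: "'a list \<Rightarrow>\<^sub>0 rat"
  assume "p - q \<in> tensor_relations"
  then have "- (p - q) \<in> tensor_relations"
    unfolding tensor_relations_def by (rule rat_vector.span_neg)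
  then show "- p - - q \<in> tensor_relations"
    by (simp only: minus_diff_minus)
qed

lift_definition scaleQ_tensor :: "rat \<Rightarrow> 'a tensor \<Rightarrow> 'a tensor" is "scaleQ"
proof -
  fix c and p q :: "'a list \<Rightarrow>\<^sub>0 rat"
  assume "p - q \<in> tensor_relations"
  then have "c *\<^sub>Q (p - q) \<in> tensor_relations"
    unfolding tensor_relations_def by (rule rat_vector.span_scale)
  then show "c *\<^sub>Q p - c *\<^sub>Q q \<in> tensor_relations"
    by (simp only: rat_vector.scale_right_diff_distrib)
qed

instance
proof
  fix x y z :: "'a tensor" and a b :: rat
  show "x + y + z = x + (y + z)"
    by transfer (simp add: tensor_relations_def rat_vector.span_zero add.assoc)
  show "x + y = y + x"
    by transfer (simp add: tensor_relations_def rat_vector.span_zero add.commute)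
  show "0 + x = x"
    by transfer (simp add: tensor_relations_def rat_vector.span_zero)
  show "- x + x = 0"
    by transfer (simp add: tensor_relations_def rat_vector.span_zero)
  show "x - y = x + - y"
    by transfer (simp add: tensor_relations_def rat_vector.span_zero)
  show "a *\<^sub>Q (x + y) = a *\<^sub>Q x + a *\<^sub>Q y"
    by transfer (simp add: tensor_relations_def rat_vector.span_zero scaleQ_add_right)
  show "(a + b) *\<^sub>Q x = a *\<^sub>Q x + b *\<^sub>Q x"
    by transfer (simp add: tensor_relations_def rat_vector.span_zero scaleQ_add_left)
  show "a *\<^sub>Q b *\<^sub>Q x = (a * b) *\<^sub>Q x"
    by transfer (simp add: tensor_relations_def rat_vector.span_zero scaleQ_scaleQ)
  show "1 *\<^sub>Q x = x"
    by transfer (simp add: tensor_relations_def rat_vector.span_zero scaleQ_one)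
qed

end

text \<open>The elementary tensor of the entries of a list.\<close>

lift_definition tensor :: "'a::rat_vector list \<Rightarrow> 'a tensor" is free_vec .

definition tensor_power :: "'a::rat_vector set \<Rightarrow> nat \<Rightarrow> 'a tensor set" where
  "tensor_power V m = rat_vector.span (tensor ` {xs \<in> lists V. length xs = m})"

text \<open>
  The linear map on the \<open>m\<close>-th tensor power of \<open>V\<close> induced by a function \<open>F\<close> of lists that is
  multilinear on the lists over \<open>V\<close> of length \<open>m\<close>.
\<close>

definition tensor_lift ::
  "'a::rat_vector set \<Rightarrow> nat \<Rightarrow> ('a list \<Rightarrow> 'b::rat_vector) \<Rightarrow> 'a tensor \<Rightarrow> 'b" where
  "tensor_lift V m F = linear_extension {xs \<in> lists V. length xs = m} tensor F"

definition tensor_mult :: "'a::rat_vector tensor \<Rightarrow> 'a tensor \<Rightarrow> 'a tensor" (infixr \<open>\<otimes>\<^sub>T\<close> 70) where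
  "s \<otimes>\<^sub>T t =
     linear_extension UNIV tensor (\<lambda>xs. linear_extension UNIV tensor (\<lambda>ys. tensor (xs @ ys)) t) s"

section \<open>Degrees\<close>

definition weight :: "nat ^ 'l \<Rightarrow> nat" where
  "weight n = (\<Sum>i\<in>UNIV. n $ i)"

definition below :: "nat ^ 'l \<Rightarrow> enat ^ 'l \<Rightarrow> bool" where
  "below n k \<longleftrightarrow> (\<forall>i. enat (n $ i) \<le> k $ i)"

definition vec_compositions :: "nat ^ 'l \<Rightarrow> (nat ^ 'l) list set" where
  "vec_compositions n = {I. 0 \<notin> set I \<and> sum_list I = n}"

section \<open>Graded coalgebras and Hopf algebras\<close>

text \<open>
  The underlying space of a structure is the sum of its homogeneous components, a subspace of the
  type \<open>'h\<close>; the structure maps are only relevant on that subspace.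
\<close>

record (overloaded) ('h::rat_vector, 'l::finite) coalg =
  component :: "nat ^ 'l \<Rightarrow> 'h set"
  comult :: "'h \<Rightarrow> 'h tensor"
  counit :: "'h \<Rightarrow> rat"

record (overloaded) ('h::rat_vector, 'l::finite) bialg = "('h, 'l) coalg" +
  hmult :: "'h \<Rightarrow> 'h \<Rightarrow> 'h"
  hunit :: 'h

definition total_space :: "('h::rat_vector, 'l::finite, 'z) coalg_scheme \<Rightarrow> 'h set" where
  "total_space H = rat_vector.span (\<Union>n. component H n)"

definition graded_space :: "('h::rat_vector, 'l::finite, 'z) coalg_scheme \<Rightarrow> bool" where
  "graded_space H \<longleftrightarrow>
     (\<forall>n. rat_vector.subspace (component H n)) \<and>
     (\<forall>N x. finite N \<and> (\<forall>n\<in>N. x n \<in> component H n) \<and> (\<Sum>n\<in>N. x n) = 0 \<longrightarrow> (\<forall>n\<in>N. x n = 0))"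

definition homogeneous_parts :: "('h::rat_vector, 'l::finite, 'z) coalg_scheme \<Rightarrow> 'h \<Rightarrow> nat ^ 'l \<Rightarrow>\<^sub>0 'h" where
  "homogeneous_parts H h = (THE d. (\<forall>n. Poly_Mapping.lookup d n \<in> component H n) \<and>
     h = (\<Sum>n\<in>Poly_Mapping.keys d. Poly_Mapping.lookup d n))"

definition homogeneous_part :: "('h::rat_vector, 'l::finite, 'z) coalg_scheme \<Rightarrow> nat ^ 'l \<Rightarrow> 'h \<Rightarrow> 'h" where
  "homogeneous_part H n h = Poly_Mapping.lookup (homogeneous_parts H h) n"

definition graded_coalgebra :: "('h::rat_vector, 'l::finite, 'z) coalg_scheme \<Rightarrow> bool" where
  "graded_coalgebra H \<longleftrightarrow>
     graded_space H \<and>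
     linear_on (total_space H) (comult H) \<and> linear_on (total_space H) (counit H) \<and>
     (\<forall>n. \<forall>h\<in>component H n. comult H h \<in>
        rat_vector.span {tensor [a, b] | a b p q. a \<in> component H p \<and> b \<in> component H q \<and> p + q = n}) \<and>
     (\<forall>n. n \<noteq> 0 \<longrightarrow> (\<forall>h\<in>component H n. counit H h = 0)) \<and>
     (\<forall>h\<in>total_space H.
        tensor_lift (total_space H) 2 (\<lambda>xs. comult H (xs ! 0) \<otimes>\<^sub>T tensor [xs ! 1]) (comult H h) =
        tensor_lift (total_space H) 2 (\<lambda>xs. tensor [xs ! 0] \<otimes>\<^sub>T comult H (xs ! 1)) (comult H h)) \<and>
     (\<forall>h\<in>total_space H.
        tensor_lift (total_space H) 2 (\<lambda>xs. counit H (xs ! 0) *\<^sub>Q xs ! 1) (comult H h) = h \<and>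
        tensor_lift (total_space H) 2 (\<lambda>xs. counit H (xs ! 1) *\<^sub>Q xs ! 0) (comult H h) = h)"

definition graded_algebra :: "('h::rat_vector, 'l::finite) bialg \<Rightarrow> bool" where
  "graded_algebra H \<longleftrightarrow>
     graded_space H \<and>
     (\<forall>a\<in>total_space H. linear_on (total_space H) (hmult H a) \<and> linear_on (total_space H) (\<lambda>b. hmult H b a)) \<and>
     (\<forall>p q. \<forall>a\<in>component H p. \<forall>b\<in>component H q. hmult H a b \<in> component H (p + q)) \<and>
     hunit H \<in> component H 0 \<and>
     (\<forall>a\<in>total_space H. \<forall>b\<in>total_space H. \<forall>c\<in>total_space H. hmult H (hmult H a b) c = hmult H a (hmult H b c)) \<and>
     (\<forall>a\<in>total_space H. hmult H (hunit H) a = a \<and> hmult H a (hunit H) = a)"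

text \<open>
  In the multiplicativity of the coproduct, the product
  \<open>(a \<otimes> b) (c \<otimes> d) = ac \<otimes> bd\<close> on the tensor square is written as a map on the fourth tensor power.
\<close>

definition graded_bialgebra :: "('h::rat_vector, 'l::finite) bialg \<Rightarrow> bool" where
  "graded_bialgebra H \<longleftrightarrow>
     graded_coalgebra H \<and> graded_algebra H \<and>
     (\<forall>a\<in>total_space H. \<forall>b\<in>total_space H.
        comult H (hmult H a b) =
        tensor_lift (total_space H) 4 (\<lambda>xs. tensor [hmult H (xs ! 0) (xs ! 2), hmult H (xs ! 1) (xs ! 3)])
          (comult H a \<otimes>\<^sub>T comult H b)) \<and>
     comult H (hunit H) = tensor [hunit H, hunit H] \<and>
     (\<forall>a\<in>total_space H. \<forall>b\<in>total_space H. counit H (hmult H a b) = counit H a * counit H b) \<and>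
     counit H (hunit H) = 1"

definition is_antipode :: "('h::rat_vector, 'l::finite) bialg \<Rightarrow> ('h \<Rightarrow> 'h) \<Rightarrow> bool" where
  "is_antipode H S \<longleftrightarrow>
     linear_on (total_space H) S \<and> S ` total_space H \<subseteq> total_space H \<and>
     (\<forall>h\<in>total_space H.
        tensor_lift (total_space H) 2 (\<lambda>xs. hmult H (S (xs ! 0)) (xs ! 1)) (comult H h) = counit H h *\<^sub>Q hunit H \<and>
        tensor_lift (total_space H) 2 (\<lambda>xs. hmult H (xs ! 0) (S (xs ! 1))) (comult H h) = counit H h *\<^sub>Q hunit H)"

definition graded_hopf_algebra :: "('h::rat_vector, 'l::finite) bialg \<Rightarrow> bool" where
  "graded_hopf_algebra H \<longleftrightarrow>
     graded_bialgebra H \<and> (\<exists>S. is_antipode H S \<and> (\<forall>n. S ` component H n \<subseteq> component H n))"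

definition connected_graded_hopf_algebra :: "('h::rat_vector, 'l::finite) bialg \<Rightarrow> bool" where
  "connected_graded_hopf_algebra H \<longleftrightarrow>
     graded_hopf_algebra H \<and> component H 0 = rat_vector.span {hunit H}"

section \<open>Morphisms\<close>

definition graded_coalgebra_morphism ::
  "('h::rat_vector, 'l::finite, 'y) coalg_scheme \<Rightarrow> ('g::rat_vector, 'l, 'z) coalg_scheme \<Rightarrow>
   ('h \<Rightarrow> 'g) \<Rightarrow> bool" where
  "graded_coalgebra_morphism H G f \<longleftrightarrow>
     linear_on (total_space H) f \<and>
     (\<forall>n. f ` component H n \<subseteq> component G n) \<and>
     (\<forall>h\<in>total_space H. comult G (f h) = tensor_lift (total_space H) 2 (\<lambda>xs. tensor (map f xs)) (comult H h)) \<and>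
     (\<forall>h\<in>total_space H. counit G (f h) = counit H h)"

definition graded_hopf_morphism ::
  "('h::rat_vector, 'l::finite) bialg \<Rightarrow> ('g::rat_vector, 'l) bialg \<Rightarrow> ('h \<Rightarrow> 'g) \<Rightarrow> bool" where
  "graded_hopf_morphism H G f \<longleftrightarrow>
     graded_coalgebra_morphism H G f \<and>
     (\<forall>a\<in>total_space H. \<forall>b\<in>total_space H. f (hmult H a b) = hmult G (f a) (f b)) \<and>
     f (hunit H) = hunit G \<and>
     (\<forall>S T. is_antipode H S \<and> is_antipode G T \<longrightarrow> (\<forall>h\<in>total_space H. f (S h) = T (f h)))"

section \<open>Linear functionals\<close>

definition convolution_product ::
  "('h::rat_vector, 'l::finite, 'z) coalg_scheme \<Rightarrow> ('h \<Rightarrow> rat) \<Rightarrow> ('h \<Rightarrow> rat) \<Rightarrow> 'h \<Rightarrow> rat" where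
  "convolution_product H \<phi> \<psi> h = tensor_lift (total_space H) 2 (\<lambda>xs. \<phi> (xs ! 0) * \<psi> (xs ! 1)) (comult H h)"

definition invertible_functional ::
  "('h::rat_vector, 'l::finite, 'z) coalg_scheme \<Rightarrow> ('h \<Rightarrow> rat) \<Rightarrow> bool" where
  "invertible_functional H \<phi> \<longleftrightarrow>
     (\<exists>\<psi>. linear_on (total_space H) \<psi> \<and>
        (\<forall>h\<in>total_space H. convolution_product H \<phi> \<psi> h = counit H h \<and> convolution_product H \<psi> \<phi> h = counit H h))"

definition bar ::
  "('h::rat_vector, 'l::finite, 'z) coalg_scheme \<Rightarrow> ('h \<Rightarrow> rat) \<Rightarrow> 'h \<Rightarrow> rat" where
  "bar H \<phi> h = (\<Sum>n\<in>Poly_Mapping.keys (homogeneous_parts H h). (-1) ^ weight n * \<phi> (homogeneous_part H n h))"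

definition even_functional ::
  "('h::rat_vector, 'l::finite, 'z) coalg_scheme \<Rightarrow> enat ^ 'l \<Rightarrow> ('h \<Rightarrow> rat) \<Rightarrow> bool" where
  "even_functional H k \<phi> \<longleftrightarrow>
     linear_on (total_space H) \<phi> \<and> invertible_functional H \<phi> \<and>
     (\<forall>n. below n k \<longrightarrow> (\<forall>h\<in>component H n. bar H \<phi> h = \<phi> h))"

definition hopf_character :: "('h::rat_vector, 'l::finite) bialg \<Rightarrow> ('h \<Rightarrow> rat) \<Rightarrow> bool" where
  "hopf_character H \<phi> \<longleftrightarrow>
     linear_on (total_space H) \<phi> \<and>
     (\<forall>a\<in>total_space H. \<forall>b\<in>total_space H. \<phi> (hmult H a b) = \<phi> a * \<phi> b) \<and> \<phi> (hunit H) = 1"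

text \<open>\<open>iterated_comult H m\<close> maps into the \<open>m\<close>-th tensor power.\<close>

fun iterated_comult ::
  "('h::rat_vector, 'l::finite, 'z) coalg_scheme \<Rightarrow> nat \<Rightarrow> 'h \<Rightarrow> 'h tensor" where
  "iterated_comult H 0 h = counit H h *\<^sub>Q tensor []"
| "iterated_comult H (Suc 0) h = tensor [h]"
| "iterated_comult H (Suc (Suc m)) h =
     tensor_lift (total_space H) (Suc m) (\<lambda>xs. comult H (hd xs) \<otimes>\<^sub>T tensor (tl xs))
       (iterated_comult H (Suc m) h)"

definition functional_component ::
  "('h::rat_vector, 'l::finite, 'z) coalg_scheme \<Rightarrow> ('h \<Rightarrow> rat) \<Rightarrow> (nat ^ 'l) list \<Rightarrow> 'h \<Rightarrow> rat" where
  "functional_component H \<phi> I h =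
     tensor_lift (total_space H) (length I) (\<lambda>xs. prod_list (map \<phi> xs))
       (tensor_lift (total_space H) (length I) (\<lambda>xs. tensor (map2 (homogeneous_part H) I xs))
         (iterated_comult H (length I) h))"

section \<open>The largest subcoalgebra on which two functionals agree\<close>

definition graded_subcoalgebra ::
  "('h::rat_vector, 'l::finite, 'z) coalg_scheme \<Rightarrow> 'h set \<Rightarrow> bool" where
  "graded_subcoalgebra H C \<longleftrightarrow>
     rat_vector.subspace C \<and> C \<subseteq> total_space H \<and>
     C = rat_vector.span (\<Union>n. C \<inter> component H n) \<and>
     comult H ` C \<subseteq> tensor_power C 2"

definition agreement_subcoalgebra ::
  "('h::rat_vector, 'l::finite, 'z) coalg_scheme \<Rightarrow> enat ^ 'l \<Rightarrow> ('h \<Rightarrow> rat) \<Rightarrow> ('h \<Rightarrow> rat) \<Rightarrow> 'h set"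
  where
  "agreement_subcoalgebra H k \<phi> \<psi> =
     (GREATEST C. graded_subcoalgebra H C \<and>
        (\<forall>h \<in> C \<inter> rat_vector.span (\<Union>n\<in>{n. below n k}. component H n). \<phi> h = \<psi> h))"

section \<open>Quasisymmetric functions\<close>

text \<open>Formal power series with rational coefficients in commuting variables indexed by \<open>'v\<close>.\<close>

typedef 'v power_series = "UNIV :: (('v \<Rightarrow>\<^sub>0 nat) \<Rightarrow> rat) set"
  morphisms coefficient Power_series ..

setup_lifting type_definition_power_series

instantiation power_series :: (type) rat_vector
begin
lift_definition zero_power_series :: "'a power_series" is "\<lambda>_. 0" .
lift_definition plus_power_series :: "'a power_series \<Rightarrow> 'a power_series \<Rightarrow> 'a power_series"
  is "\<lambda>f g \<mu>. f \<mu> + g \<mu>" .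
lift_definition minus_power_series :: "'a power_series \<Rightarrow> 'a power_series \<Rightarrow> 'a power_series"
  is "\<lambda>f g \<mu>. f \<mu> - g \<mu>" .
lift_definition uminus_power_series :: "'a power_series \<Rightarrow> 'a power_series" is "\<lambda>f \<mu>. - f \<mu>" .
lift_definition scaleQ_power_series :: "rat \<Rightarrow> 'a power_series \<Rightarrow> 'a power_series"
  is "\<lambda>c f \<mu>. c * f \<mu>" .
instance by standard (transfer; simp add: fun_eq_iff algebra_simps)+
end

instantiation power_series :: (type) "{one, times}"
begin
lift_definition one_power_series :: "'a power_series" is "\<lambda>\<mu>. if \<mu> = 0 then 1 else 0" .
lift_definition times_power_series :: "'a power_series \<Rightarrow> 'a power_series \<Rightarrow> 'a power_series"
  is "\<lambda>f g \<mu>. \<Sum>(\<alpha>, \<beta>)\<in>{(\<alpha>, \<beta>). \<alpha> + \<beta> = \<mu>}. f \<alpha> * g \<beta>" .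
instance ..
end

text \<open>
  The variable \<open>(j, i)\<close> stands for \<open>x_j^(i)\<close>; the index \<open>j\<close> starts from \<open>0\<close>, only its order
  matters. The exponent of the monomial \<open>x_j^n\<close> is \<open>block_monomial j n\<close>.
\<close>

definition block_monomial :: "nat \<Rightarrow> nat ^ 'l \<Rightarrow> nat \<times> 'l::finite \<Rightarrow>\<^sub>0 nat" where
  "block_monomial j n = (\<Sum>i\<in>UNIV. Poly_Mapping.single (j, i) (n $ i))"

text \<open>
  The coefficient of a monomial in the infinite sum defining \<open>M_I\<close> is the number of index
  sequences whose summand is that monomial.
\<close>

definition monomial_qsym :: "(nat ^ 'l) list \<Rightarrow> (nat \<times> 'l::finite) power_series" where
  "monomial_qsym I = Power_series (\<lambda>\<mu>. of_nat (card
     {js. length js = length I \<and> sorted_wrt (<) js \<and> sum_list (map2 block_monomial js I) = \<mu>}))"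

definition all_compositions :: "(nat ^ 'l) list set" where
  "all_compositions = {I. 0 \<notin> set I}"

definition QSym :: "((nat \<times> 'l::finite) power_series, 'l) bialg" where
  "QSym = \<lparr>
     component = (\<lambda>n. rat_vector.span (monomial_qsym ` vec_compositions n)),
     comult = linear_extension all_compositions monomial_qsym
       (\<lambda>I. \<Sum>r\<le>length I. tensor [monomial_qsym (take r I), monomial_qsym (drop r I)]),
     counit = linear_extension all_compositions monomial_qsym (\<lambda>I. if I = [] then 1 else 0),
     hmult = (*),
     hunit = 1\<rparr>"

definition zeta_Q :: "(nat \<times> 'l::finite) power_series \<Rightarrow> rat" where
  "zeta_Q = linear_extension all_compositions monomial_qsym (\<lambda>I. if length I \<le> 1 then 1 else 0)"

definition even_qsym :: "enat ^ 'l \<Rightarrow> (nat \<times> 'l::finite) power_series set" where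
  "even_qsym k = agreement_subcoalgebra QSym k (bar QSym zeta_Q) zeta_Q"

text \<open>\<open>even_qsym k\<close> with the structure restricted from \<open>QSym\<close>.\<close>

definition EvenQSym :: "enat ^ 'l \<Rightarrow> ((nat \<times> 'l::finite) power_series, 'l) bialg" where
  "EvenQSym k = QSym\<lparr>component := \<lambda>n. even_qsym k \<inter> component QSym n\<rparr>"

section \<open>Combinatorial Hopf algebras\<close>

definition combinatorial_hopf_algebra ::
  "('h::rat_vector, 'l::finite) bialg \<Rightarrow> ('h \<Rightarrow> rat) \<Rightarrow> bool" where
  "combinatorial_hopf_algebra H \<phi> \<longleftrightarrow> connected_graded_hopf_algebra H \<and> hopf_character H \<phi>"

definition cha_morphism ::
  "('h::rat_vector, 'l::finite) bialg \<Rightarrow> ('h \<Rightarrow> rat) \<Rightarrow>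
   ('g::rat_vector, 'l) bialg \<Rightarrow> ('g \<Rightarrow> rat) \<Rightarrow> ('h \<Rightarrow> 'g) \<Rightarrow> bool" where
  "cha_morphism H \<phi> G \<psi> f \<longleftrightarrow> graded_hopf_morphism H G f \<and> (\<forall>h\<in>total_space H. \<psi> (f h) = \<phi> h)"

end

theory Submission
  imports Defs
begin

text \<open>
  For a word \<open>I = (i\<^sub>1, \<dots>, i\<^sub>m)\<close> of degrees, \<open>\<phi>\<^sup>I\<close> is the convolution product of the
  restrictions of \<open>\<phi>\<close> to the degrees \<open>i\<^sub>1, \<dots>, i\<^sub>m\<close>. On \<open>QSym\<close> the functional \<open>\<zeta>\<^sup>I\<close> reads off the
  coefficient of \<open>M\<^sub>I\<close>, because deconcatenation is dual to concatenation of words. A coalgebra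
  morphism \<open>\<Psi>\<close> with \<open>\<zeta> \<circ> \<Psi> = \<phi>\<close> pulls \<open>\<zeta>\<^sup>I\<close> back to \<open>\<phi>\<^sup>I\<close>, which leaves only the asserted formula
  for \<open>\<Psi>\<close>; conversely that formula defines a coalgebra morphism, since \<open>\<phi>\<^sup>I\<^sup>J\<close> is the convolution of
  \<open>\<phi>\<^sup>I\<close> and \<open>\<phi>\<^sup>J\<close>. If \<open>\<phi>\<close> is a character, then \<open>\<phi>\<^sup>w(ab)\<close> is the sum of \<open>\<phi>\<^sup>A(a) \<phi>\<^sup>B(b)\<close> over all
  entrywise splittings \<open>w = A + B\<close>. This is the rule for the coefficients of a product of power
  series, so \<open>\<Psi>\<close> is multiplicative.

  The image of \<open>\<Psi>\<close> is a graded subcoalgebra on which \<open>\<zeta>\<close> and its bar agree up to degree \<open>k\<close>, so it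
  lies in the largest one. That one is closed under products, because the product of two graded
  subcoalgebras is a graded subcoalgebra and \<open>p + q \<le> k\<close> forces \<open>p, q \<le> k\<close>. Its antipode is the
  geometric series in the convolution powers of the identity minus the unit-counit map, which is a
  finite sum in each degree.
\<close>

section \<open>Linear maps on subspaces\<close>

text \<open>The structure maps live on a whole type but are controlled only on the total space, and
  \<open>tensor_lift\<close>, \<open>linear_extension\<close> and \<open>homogeneous_parts\<close>
  are choices that say nothing until existence, or uniqueness, is proved. Coproducts are therefore
  handled as lists of pairs over the right subspace, and lifts of bilinear maps are evaluated on
  such lists.

  The formula for \<Psi> involves only compositions, whereas the product rule runs over splittings
  into words with zero letters. The two meet through uniqueness: since \<zeta> \<circ> \<Psi> =
  \<phi>, the coefficient of \<Psi>(h) at every word w, zero letters included, is \<phi>^w(h).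
  Connectedness and \<phi>(1) = 1 enter here, since they make the degree 0 part of \<phi> the
  counit.

  For terminality, a morphism into the even subalgebra is also a coalgebra morphism into
  \<open>QSym\<close>, so uniqueness is inherited, and existence amounts to the location of the
  image.\<close>

global_interpretation rat_vector_pair:
  vector_space_pair "scaleQ :: rat \<Rightarrow> 'a \<Rightarrow> 'a::rat_vector" "scaleQ :: rat \<Rightarrow> 'b \<Rightarrow> 'b::rat_vector" ..

abbreviation linear_map :: "('a::rat_vector \<Rightarrow> 'b::rat_vector) \<Rightarrow> bool" where
  "linear_map \<equiv> Vector_Spaces.linear scaleQ scaleQ"

lemma linear_mapI:
  assumes "\<And>x y. f (x + y) = f x + f y" "\<And>c x. f (c *\<^sub>Q x) = c *\<^sub>Q f x"
  shows "linear_map f"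
  by (rule Vector_Spaces.linear.intro) (unfold_locales, use assms in auto)

lemmas linear_map_add = rat_vector_pair.linear_add
lemmas linear_map_scale = rat_vector_pair.linear_scale
lemmas linear_map_0 = rat_vector_pair.linear_0
lemmas linear_map_sum = rat_vector_pair.linear_sum

lemma linear_map_sum_list:
  assumes "linear_map f"
  shows "f (\<Sum>x\<leftarrow>xs. g x) = (\<Sum>x\<leftarrow>xs. f (g x))"
  by (induction xs) (simp_all add: linear_map_0[OF assms] linear_map_add[OF assms])

lemma linear_map_imp_linear_on: "linear_map f \<Longrightarrow> linear_on V f"
  by (simp add: linear_on_def linear_map_add linear_map_scale)

lemma linear_on_subset: "linear_on V f \<Longrightarrow> W \<subseteq> V \<Longrightarrow> linear_on W f"
  unfolding linear_on_def by blast

lemma linear_on_add: "linear_on V f \<Longrightarrow> x \<in> V \<Longrightarrow> y \<in> V \<Longrightarrow> f (x + y) = f x + f y"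
  by (simp add: linear_on_def)

lemma linear_on_scale: "linear_on V f \<Longrightarrow> x \<in> V \<Longrightarrow> f (c *\<^sub>Q x) = c *\<^sub>Q f x"
  by (simp add: linear_on_def)

lemma linear_onI:
  assumes "\<And>x y. x \<in> V \<Longrightarrow> y \<in> V \<Longrightarrow> f (x + y) = f x + f y"
    and "\<And>c x. x \<in> V \<Longrightarrow> f (c *\<^sub>Q x) = c *\<^sub>Q f x"
  shows "linear_on V f"
  using assms by (simp add: linear_on_def)

lemma linear_on_0:
  assumes "linear_on V f" "rat_vector.subspace V"
  shows "f 0 = 0"
  using linear_on_scale[OF assms(1) rat_vector.subspace_0[OF assms(2)], of 0] by simp

lemma linear_on_sum:
  assumes "linear_on V f" "rat_vector.subspace V" "\<And>i. i \<in> A \<Longrightarrow> g i \<in> V"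
  shows "f (\<Sum>i\<in>A. g i) = (\<Sum>i\<in>A. f (g i))"
  using assms(3)
proof (induction A rule: infinite_finite_induct)
  case (insert i A)
  then show ?case
    by (simp add: linear_on_add[OF assms(1)] rat_vector.subspace_sum[OF assms(2)])
qed (simp_all add: linear_on_0[OF assms(1,2)])

lemma sum_list_in_subspace:
  assumes "rat_vector.subspace V" "\<And>x. x \<in> set xs \<Longrightarrow> g x \<in> V"
  shows "(\<Sum>x\<leftarrow>xs. g x) \<in> V"
  using assms(2)
  by (induction xs) (simp_all add: rat_vector.subspace_0[OF assms(1)] rat_vector.subspace_add[OF assms(1)])

lemma linear_on_sum_list:
  assumes "linear_on V f" "rat_vector.subspace V" "\<And>i. i \<in> set xs \<Longrightarrow> g i \<in> V"
  shows "f (\<Sum>i\<leftarrow>xs. g i) = (\<Sum>i\<leftarrow>xs. f (g i))"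
  using assms(3)
  by (induction xs)
    (simp_all add: linear_on_0[OF assms(1,2)] linear_on_add[OF assms(1)] sum_list_in_subspace[OF assms(2)])

lemma linear_on_id: "linear_on V (\<lambda>x. x)"
  by (simp add: linear_on_def)

lemma linear_on_mult_const: "linear_on V \<phi> \<Longrightarrow> linear_on V (\<lambda>h. c * \<phi> h :: rat)"
  by (simp add: linear_on_def scaleQ_rat_def algebra_simps)

lemma linear_on_compose:
  assumes "linear_on V f" "linear_on W g" "\<And>x. x \<in> V \<Longrightarrow> f x \<in> W"
  shows "linear_on V (\<lambda>x. g (f x))"
  using assms by (simp add: linear_on_def)

lemma linear_on_sum_fun:
  assumes "\<And>i. i \<in> A \<Longrightarrow> linear_on V (f i)"
  shows "linear_on V (\<lambda>x. \<Sum>i\<in>A. f i x)"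
  using assms
  by (auto simp: linear_on_def sum.distrib rat_vector.scale_sum_right)

lemma linear_on_eq_span:
  assumes "linear_on (rat_vector.span B) f" "linear_on (rat_vector.span B) g"
    and "\<And>x. x \<in> B \<Longrightarrow> f x = g x" "x \<in> rat_vector.span B"
  shows "f x = g x"
proof -
  have "rat_vector.span B \<subseteq> {x \<in> rat_vector.span B. f x = g x}"
    using assms(1-3)
    by (intro rat_vector.span_minimal rat_vector.subspaceI)
      (auto simp: linear_on_add linear_on_scale rat_vector.span_base rat_vector.span_scale
        rat_vector.span_add rat_vector.span_zero linear_on_0[OF _ rat_vector.subspace_span])
  then show ?thesis using assms(4) by blast
qed

lemma linear_on_span_image:
  assumes "linear_on (rat_vector.span B) f" "rat_vector.subspace W"
    and "\<And>x. x \<in> B \<Longrightarrow> f x \<in> W" "x \<in> rat_vector.span B"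
  shows "f x \<in> W"
proof -
  have "rat_vector.span B \<subseteq> {x \<in> rat_vector.span B. f x \<in> W}"
    using assms(1-3)
    by (intro rat_vector.span_minimal rat_vector.subspaceI)
      (auto simp: linear_on_add linear_on_scale rat_vector.span_base rat_vector.span_scale
        rat_vector.span_add rat_vector.span_zero linear_on_0[OF _ rat_vector.subspace_span]
        rat_vector.subspace_add rat_vector.subspace_scale rat_vector.subspace_0)
  then show ?thesis using assms(4) by blast
qed

lemma linear_extension_works:
  assumes "\<exists>L. linear_map L \<and> (\<forall>i\<in>I. L (b i) = g i)"
  shows "linear_map (linear_extension I b g)" "\<And>i. i \<in> I \<Longrightarrow> linear_extension I b g (b i) = g i"
  using someI_ex[OF assms] unfolding linear_extension_def by blast+

section \<open>The universal property of tensor powers\<close>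

definition free_extension :: "('i \<Rightarrow> 'b::rat_vector) \<Rightarrow> ('i \<Rightarrow>\<^sub>0 rat) \<Rightarrow> 'b" where
  "free_extension F p = (\<Sum>i\<in>Poly_Mapping.keys p. Poly_Mapping.lookup p i *\<^sub>Q F i)"

lemma free_extension_superset:
  assumes "finite A" "Poly_Mapping.keys p \<subseteq> A"
  shows "free_extension F p = (\<Sum>i\<in>A. Poly_Mapping.lookup p i *\<^sub>Q F i)"
  unfolding free_extension_def
  by (rule sum.mono_neutral_left) (use assms in \<open>auto simp: in_keys_iff\<close>)

lemma lookup_scaleQ: "Poly_Mapping.lookup (c *\<^sub>Q p) i = c *\<^sub>Q Poly_Mapping.lookup p i"
  by transfer simp

lemma linear_map_free_extension: "linear_map (free_extension F)"
proof (rule linear_mapI)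
  fix p q :: "'a \<Rightarrow>\<^sub>0 rat"
  let ?A = "Poly_Mapping.keys p \<union> Poly_Mapping.keys q"
  have A: "finite ?A" by simp
  show "free_extension F (p + q) = free_extension F p + free_extension F q"
    using free_extension_superset[OF A, of p F] free_extension_superset[OF A, of q F]
      free_extension_superset[OF A keys_add, of F]
    by (simp add: lookup_add scaleQ_add_left sum.distrib)
next
  fix c and p :: "'a \<Rightarrow>\<^sub>0 rat"
  have "Poly_Mapping.keys (c *\<^sub>Q p) \<subseteq> Poly_Mapping.keys p"
    by (auto simp: in_keys_iff lookup_scaleQ)
  from free_extension_superset[OF finite_keys this, of F]
  show "free_extension F (c *\<^sub>Q p) = c *\<^sub>Q free_extension F p"
    by (simp add: free_extension_def lookup_scaleQ scaleQ_rat_def rat_vector.scale_sum_right scaleQ_scaleQ)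
qed

lemma free_extension_free_vec: "free_extension F (free_vec i) = F i"
  by (simp add: free_extension_def free_vec_def scaleQ_one)

lemma free_vec_span: "p \<in> rat_vector.span (range free_vec)"
proof -
  have "p = (\<Sum>i\<in>Poly_Mapping.keys p. Poly_Mapping.lookup p i *\<^sub>Q free_vec i)"
  proof (rule poly_mapping_eqI)
    fix j
    have "Poly_Mapping.lookup (\<Sum>i\<in>Poly_Mapping.keys p. Poly_Mapping.lookup p i *\<^sub>Q free_vec i) j =
      (\<Sum>i\<in>Poly_Mapping.keys p. if i = j then Poly_Mapping.lookup p i else 0)"
      unfolding lookup_sum
      by (rule sum.cong) (auto simp: lookup_scaleQ free_vec_def lookup_single scaleQ_rat_def when_def)
    then show "Poly_Mapping.lookup p j =
      Poly_Mapping.lookup (\<Sum>i\<in>Poly_Mapping.keys p. Poly_Mapping.lookup p i *\<^sub>Q free_vec i) j"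
      by (simp add: sum.delta in_keys_iff)
  qed
  also have "\<dots> \<in> rat_vector.span (range free_vec)"
    by (intro rat_vector.span_sum rat_vector.span_scale rat_vector.span_base) simp
  finally show ?thesis .
qed

lemma tensor_span: "t \<in> rat_vector.span (range tensor)"
proof -
  obtain p where t: "t = abs_tensor p" using Quotient_abs_rep[OF Quotient_tensor] by metis
  have lin: "linear_on (rat_vector.span (range free_vec)) (abs_tensor :: _ \<Rightarrow> 'a tensor)"
    by (rule linear_onI) (simp_all add: plus_tensor.abs_eq scaleQ_tensor.abs_eq)
  show ?thesis unfolding t
    by (rule linear_on_span_image[OF lin rat_vector.subspace_span _ free_vec_span])
      (auto simp flip: tensor.abs_eq intro: rat_vector.span_base)
qed

lemma linear_map_tensor_eqI:
  assumes "linear_map f" "linear_map g" "\<And>xs. f (tensor xs) = g (tensor xs)"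
  shows "f t = g t"
  by (rule linear_on_eq_span[OF linear_map_imp_linear_on linear_map_imp_linear_on _ tensor_span])
    (use assms in auto)

lemma tensor_add: "tensor (xs @ (a + b) # ys) = tensor (xs @ a # ys) + tensor (xs @ b # ys)"
proof -
  have "free_vec (xs @ (a + b) # ys) - free_vec (xs @ a # ys) - free_vec (xs @ b # ys) \<in> tensor_relations"
    unfolding tensor_relations_def by (rule rat_vector.span_base) force
  then show ?thesis by transfer (simp add: diff_diff_eq)
qed

lemma tensor_scale: "tensor (xs @ (c *\<^sub>Q a) # ys) = c *\<^sub>Q tensor (xs @ a # ys)"
proof -
  have "free_vec (xs @ (c *\<^sub>Q a) # ys) - c *\<^sub>Q free_vec (xs @ a # ys) \<in> tensor_relations"
    unfolding tensor_relations_def by (rule rat_vector.span_base) force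
  then show ?thesis by transfer
qed

text \<open>Multilinearity in every slot says precisely that the free extension of \<open>F\<close>
  kills the generators of \<open>tensor_relations\<close>, so it descends to the quotient.\<close>

lemma tensor_universal:
  assumes add: "\<And>xs a b ys. F (xs @ (a + b) # ys) = F (xs @ a # ys) + F (xs @ b # ys)"
    and scale: "\<And>xs c a ys. F (xs @ (c *\<^sub>Q a) # ys) = c *\<^sub>Q F (xs @ a # ys)"
  shows "\<exists>L. linear_map L \<and> (\<forall>xs. L (tensor xs) = F xs)"
proof -
  have "free_extension F p = 0" if "p \<in> tensor_relations" for p
    using that unfolding tensor_relations_def
    by (rule rat_vector_pair.linear_eq_0_on_span[OF linear_map_free_extension, rotated])
      (auto simp: rat_vector_pair.linear_diff[OF linear_map_free_extension]
        linear_map_scale[OF linear_map_free_extension] free_extension_free_vec add scale)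
  then have *: "free_extension F p = free_extension F q" if "p - q \<in> tensor_relations" for p q
    using that by (metis rat_vector_pair.linear_diff[OF linear_map_free_extension] eq_iff_diff_eq_0)
  define L where "L t = free_extension F (rep_tensor t)" for t
  have L: "L (abs_tensor p) = free_extension F p" for p
    unfolding L_def
    by (rule *, rule Quotient_rep_abs[OF Quotient_tensor]) (simp add: tensor_relations_def rat_vector.span_zero)
  have abs: "abs_tensor (rep_tensor t) = t" for t :: "'a tensor"
    by (rule Quotient_abs_rep[OF Quotient_tensor])
  have "linear_map L"
  proof (rule linear_mapI)
    show "L (s + t) = L s + L t" for s t
      using L[of "rep_tensor s + rep_tensor t"] L[of "rep_tensor s"] L[of "rep_tensor t"]
      by (simp add: linear_map_add[OF linear_map_free_extension] abs flip: plus_tensor.abs_eq)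
    show "L (c *\<^sub>Q t) = c *\<^sub>Q L t" for c t
      using L[of "c *\<^sub>Q rep_tensor t"] L[of "rep_tensor t"]
      by (simp add: linear_map_scale[OF linear_map_free_extension] abs flip: scaleQ_tensor.abs_eq)
  qed
  moreover have "L (tensor xs) = F xs" for xs
    by (simp add: tensor.abs_eq L free_extension_free_vec)
  ultimately show ?thesis by blast
qed

definition multilinear_on :: "'a::rat_vector set \<Rightarrow> nat \<Rightarrow> ('a list \<Rightarrow> 'b::rat_vector) \<Rightarrow> bool" where
  "multilinear_on V m F \<longleftrightarrow>
    (\<forall>xs\<in>lists V. \<forall>ys\<in>lists V. Suc (length xs + length ys) = m \<longrightarrow> linear_on V (\<lambda>a. F (xs @ a # ys)))"

text \<open>\<open>tensor_universal\<close> demands multilinearity on all lists, but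
  \<open>F\<close> is controlled only on lists of length \<open>m\<close> over \<open>V\<close>. A
  linear projection onto \<open>V\<close>, obtained as a left inverse of the identity and applied
  entrywise, turns \<open>F\<close> into a globally multilinear function with the same values on
  those lists.\<close>

lemma tensor_lift_exists:
  assumes V: "rat_vector.subspace V" and F: "multilinear_on V m F"
  shows "\<exists>L. linear_map L \<and> (\<forall>xs\<in>{xs \<in> lists V. length xs = m}. L (tensor xs) = F xs)"
proof -
  obtain p where p: "range p \<subseteq> V" "linear_map p" "\<forall>v\<in>V. p v = v"
    using rat_vector_pair.linear_exists_left_inverse_on[OF rat_vector.linear_id V] by auto
  \<comment> \<open>The default 0 at other lengths respects multilinearity: changing one entry keeps
    the length, so each identity is tested within a single length.\<close>
  define F' where "F' xs = (if length xs = m then F (map p xs) else 0)" for xs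
  have pV: "map p xs \<in> lists V" for xs using p(1) by (auto simp: image_subset_iff)
  have lin: "linear_on V (\<lambda>a. F (map p xs @ a # map p ys))" if "Suc (length xs + length ys) = m" for xs ys
    using F pV that unfolding multilinear_on_def by fastforce
  have "\<exists>L. linear_map L \<and> (\<forall>xs. L (tensor xs) = F' xs)"
  proof (rule tensor_universal)
    show "F' (xs @ (a + b) # ys) = F' (xs @ a # ys) + F' (xs @ b # ys)" for xs a b ys
      using lin[of xs ys] p(1) by (auto simp: image_subset_iff F'_def linear_map_add[OF p(2)] linear_on_def)
    show "F' (xs @ (c *\<^sub>Q a) # ys) = c *\<^sub>Q F' (xs @ a # ys)" for xs c a ys
      using lin[of xs ys] p(1) by (auto simp: image_subset_iff F'_def linear_map_scale[OF p(2)] linear_on_def)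
  qed
  then obtain L where L: "linear_map L" "\<forall>xs. L (tensor xs) = F' xs" by blast
  moreover have "F' xs = F xs" if "xs \<in> lists V" "length xs = m" for xs
  proof -
    have "map p xs = xs" using that p(3) by (intro map_idI) auto
    then show ?thesis using that by (simp add: F'_def)
  qed
  ultimately show ?thesis by (intro exI[of _ L]) auto
qed

lemma linear_map_tensor_lift:
  assumes "rat_vector.subspace V" "multilinear_on V m F"
  shows "linear_map (tensor_lift V m F)"
  unfolding tensor_lift_def by (rule linear_extension_works[OF tensor_lift_exists[OF assms]])

lemma tensor_lift_tensor:
  assumes "rat_vector.subspace V" "multilinear_on V m F" "xs \<in> lists V" "length xs = m"
  shows "tensor_lift V m F (tensor xs) = F xs"
  unfolding tensor_lift_def
  by (rule linear_extension_works(2)[OF tensor_lift_exists[OF assms(1,2)]]) (use assms in auto)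

text \<open>The two maps agree even outside the tensor power: each is a choice from a predicate that
  sees only the values on lists of length \<open>m\<close> over \<open>V\<close>, and the two
  predicates coincide.\<close>

lemma tensor_lift_cong:
  assumes "\<And>xs. xs \<in> lists V \<Longrightarrow> length xs = m \<Longrightarrow> F xs = G xs"
  shows "tensor_lift V m F = tensor_lift V m G"
proof -
  have "(\<forall>xs\<in>{xs \<in> lists V. length xs = m}. L (tensor xs) = F xs) \<longleftrightarrow>
    (\<forall>xs\<in>{xs \<in> lists V. length xs = m}. L (tensor xs) = G xs)" for L
    using assms by simp
  then show ?thesis unfolding tensor_lift_def linear_extension_def by simp
qed

text \<open>\<open>tensor_mult\<close> nests two extensions, and both must be shown to exist. The
  inner one, \<open>R xs\<close>, prepends \<open>xs\<close>; for a fixed right factor it is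
  multilinear in \<open>xs\<close>, which is what the outer one requires.\<close>

lemma tensor_mult_works:
  fixes s t :: "'a::rat_vector tensor" and xs ys :: "'a list"
  shows linear_map_tensor_mult_left: "linear_map (\<lambda>s. s \<otimes>\<^sub>T t)"
    and linear_map_tensor_mult_right: "linear_map (\<lambda>t. s \<otimes>\<^sub>T t)"
    and tensor_mult_tensor: "tensor xs \<otimes>\<^sub>T tensor ys = tensor (xs @ ys)"
proof -
  define R :: "'a list \<Rightarrow> 'a tensor \<Rightarrow> 'a tensor"
    where "R xs = linear_extension UNIV tensor (\<lambda>ys. tensor (xs @ ys))" for xs
  have "\<exists>L. linear_map L \<and> (\<forall>ys\<in>UNIV. L (tensor ys) = tensor (xs @ ys))" for xs :: "'a list"
    using tensor_universal[of "\<lambda>ys. tensor (xs @ ys)"] tensor_add[of "xs @ _"] tensor_scale[of "xs @ _"] by simp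
  note R = linear_extension_works[OF this, folded R_def]
  have "\<exists>L. linear_map L \<and> (\<forall>xs\<in>UNIV. L (tensor xs) = R xs t)" for t
  proof -
    have "R (xs @ (a + b) # ys) t = R (xs @ a # ys) t + R (xs @ b # ys) t" for xs a b ys
      by (rule linear_map_tensor_eqI[of "R _" "\<lambda>t. R _ t + R _ t"])
        (auto simp: R tensor_add intro: rat_vector_pair.linear_compose_add)
    moreover have "R (xs @ (c *\<^sub>Q a) # ys) t = c *\<^sub>Q R (xs @ a # ys) t" for xs c a ys
      by (rule linear_map_tensor_eqI[of "R _" "\<lambda>t. _ *\<^sub>Q R _ t"])
        (auto simp: R tensor_scale intro: rat_vector_pair.linear_compose_scale_right)
    ultimately show ?thesis using tensor_universal[of "\<lambda>xs. R xs t"] by simp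
  qed
  note L = linear_extension_works[OF this]
  have mult: "s \<otimes>\<^sub>T t = linear_extension UNIV tensor (\<lambda>xs. R xs t) s" for s t :: "'a tensor"
    unfolding tensor_mult_def R_def ..
  show left: "linear_map (\<lambda>s. s \<otimes>\<^sub>T t)" for t :: "'a tensor"
    unfolding mult by (rule L)
  have tm: "tensor xs \<otimes>\<^sub>T t = R xs t" for xs and t :: "'a tensor"
    unfolding mult by (rule L) simp
  show "tensor xs \<otimes>\<^sub>T tensor ys = tensor (xs @ ys)"
    by (simp add: tm R)
  show "linear_map (\<lambda>t. s \<otimes>\<^sub>T t)"
  proof (rule linear_mapI)
    show "s \<otimes>\<^sub>T (t + u) = s \<otimes>\<^sub>T t + s \<otimes>\<^sub>T u" for t u
      by (rule linear_map_tensor_eqI[of "\<lambda>s. s \<otimes>\<^sub>T (t + u)" "\<lambda>s. s \<otimes>\<^sub>T t + s \<otimes>\<^sub>T u"])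
        (auto simp: tm linear_map_add[OF R(1)] intro: left rat_vector_pair.linear_compose_add)
    show "s \<otimes>\<^sub>T (c *\<^sub>Q t) = c *\<^sub>Q (s \<otimes>\<^sub>T t)" for c t
      by (rule linear_map_tensor_eqI[of "\<lambda>s. s \<otimes>\<^sub>T (c *\<^sub>Q t)" "\<lambda>s. c *\<^sub>Q (s \<otimes>\<^sub>T t)"])
        (auto simp: tm linear_map_scale[OF R(1)] intro: left rat_vector_pair.linear_compose_scale_right)
  qed
qed

section \<open>Tensor squares\<close>

definition bilinear_on :: "'a::rat_vector set \<Rightarrow> ('a \<Rightarrow> 'a \<Rightarrow> 'b::rat_vector) \<Rightarrow> bool" where
  "bilinear_on V B \<longleftrightarrow> (\<forall>a\<in>V. linear_on V (B a) \<and> linear_on V (\<lambda>b. B b a))"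

lemma bilinear_on_subset: "bilinear_on V B \<Longrightarrow> W \<subseteq> V \<Longrightarrow> bilinear_on W B"
  unfolding bilinear_on_def by (meson linear_on_subset subsetD)

lemma bilinear_onI:
  assumes "\<And>a. a \<in> V \<Longrightarrow> linear_on V (B a)" "\<And>a. a \<in> V \<Longrightarrow> linear_on V (\<lambda>b. B b a)"
  shows "bilinear_on V B"
  using assms by (simp add: bilinear_on_def)

lemma multilinear_on_2: "bilinear_on V B \<Longrightarrow> multilinear_on V 2 (\<lambda>xs. B (xs ! 0) (xs ! 1))"
  by (auto simp: multilinear_on_def bilinear_on_def length_Suc_conv numeral_2_eq_2 add_is_1)

lemma tensor1_add: "tensor [a + b] = tensor [a] + tensor [b]"
  using tensor_add[of "[]" a b "[]"] by simp

lemma tensor1_scale: "tensor [c *\<^sub>Q a] = c *\<^sub>Q tensor [a]"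
  using tensor_scale[of "[]" c a "[]"] by simp

lemma tensor2_add_left: "tensor [a + b, c] = tensor [a, c] + tensor [b, c]"
  using tensor_add[of "[]" a b "[c]"] by simp

lemma tensor2_add_right: "tensor [c, a + b] = tensor [c, a] + tensor [c, b]"
  using tensor_add[of "[c]" a b "[]"] by simp

lemma tensor2_scale_left: "tensor [r *\<^sub>Q a, c] = r *\<^sub>Q tensor [a, c]"
  using tensor_scale[of "[]" r a "[c]"] by simp

lemma tensor2_scale_right: "tensor [c, r *\<^sub>Q a] = r *\<^sub>Q tensor [c, a]"
  using tensor_scale[of "[c]" r a "[]"] by simp

lemmas tensor2_simps = tensor2_add_left tensor2_add_right tensor2_scale_left tensor2_scale_right

lemma bilinear_on_tensor2: "bilinear_on V (\<lambda>a b. tensor [a, b])"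
  by (auto intro!: bilinear_onI linear_onI simp: tensor2_simps)

text \<open>Scalars of a linear combination are absorbed into the left factors, so a plain list of
  pairs suffices as a representation.\<close>

lemma span_tensor2_repr:
  assumes "t \<in> rat_vector.span ((\<lambda>(a, b). tensor [a, b]) ` R)" "\<And>a b c. (a, b) \<in> R \<Longrightarrow> (c *\<^sub>Q a, b) \<in> R"
  shows "\<exists>ps. set ps \<subseteq> R \<and> t = (\<Sum>(a, b)\<leftarrow>ps. tensor [a, b])"
  using assms(1)
proof (induction rule: rat_vector.span_induct_alt)
  case base
  show ?case by (rule exI[of _ "[]"]) simp
next
  case (step c x y)
  then obtain ps a b where "set ps \<subseteq> R" "y = (\<Sum>(a, b)\<leftarrow>ps. tensor [a, b])" "(a, b) \<in> R" "x = tensor [a, b]"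
    by auto
  then show ?case
    by (intro exI[of _ "(c *\<^sub>Q a, b) # ps"]) (simp add: assms(2) tensor2_scale_left)
qed

lemma tensor_power_2: "tensor_power V 2 = rat_vector.span ((\<lambda>(a, b). tensor [a, b]) ` (V \<times> V))"
proof -
  have "tensor ` {xs \<in> lists V. length xs = 2} = (\<lambda>(a, b). tensor [a, b]) ` (V \<times> V)"
    by (auto simp: numeral_2_eq_2 length_Suc_conv image_iff)
  then show ?thesis by (simp add: tensor_power_def)
qed

text \<open>Any representation by pairs over \<open>V\<close> may be used to evaluate a lift;
  independence of the representation is already contained in
  \<open>tensor_lift_exists\<close>.\<close>

lemma tensor_lift_2_sum_list:
  assumes "rat_vector.subspace V" "bilinear_on V B" "set ps \<subseteq> V \<times> V"
  shows "tensor_lift V 2 (\<lambda>xs. B (xs ! 0) (xs ! 1)) (\<Sum>(a, b)\<leftarrow>ps. tensor [a, b]) = (\<Sum>(a, b)\<leftarrow>ps. B a b)"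
  using assms(3)
proof (induction ps)
  case Nil
  show ?case
    using linear_map_0[OF linear_map_tensor_lift[OF assms(1) multilinear_on_2[OF assms(2)]]] by simp
next
  case (Cons p ps)
  obtain a b where p: "p = (a, b)" by (cases p)
  have "tensor_lift V 2 (\<lambda>xs. B (xs ! 0) (xs ! 1)) (tensor [a, b]) = B a b"
    by (subst tensor_lift_tensor[OF assms(1) multilinear_on_2[OF assms(2)]]) (use Cons.prems p in auto)
  then show ?case
    using Cons linear_map_add[OF linear_map_tensor_lift[OF assms(1) multilinear_on_2[OF assms(2)]]]
    by (simp add: p)
qed

section \<open>Graded spaces\<close>

lemma subspace_total_space: "rat_vector.subspace (total_space H)"
  by (simp add: total_space_def)

lemma component_subset_total_space: "component H n \<subseteq> total_space H"
  by (auto simp: total_space_def intro: rat_vector.span_base)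

lemma total_space_eqI:
  assumes "linear_on (total_space H) f" "linear_on (total_space H) g"
    and "\<And>n x. x \<in> component H n \<Longrightarrow> f x = g x" "x \<in> total_space H"
  shows "f x = g x"
  by (rule linear_on_eq_span[OF assms(1,2)[unfolded total_space_def] _ assms(4)[unfolded total_space_def]])
    (use assms(3) in blast)

lemma total_space_imageI:
  assumes "linear_on (total_space H) f" "rat_vector.subspace W"
    and "\<And>n x. x \<in> component H n \<Longrightarrow> f x \<in> W" "x \<in> total_space H"
  shows "f x \<in> W"
  by (rule linear_on_span_image[OF assms(1)[unfolded total_space_def] assms(2) _ assms(4)[unfolded total_space_def]])
    (use assms(3) in blast)

locale gspace =
  fixes H :: "('h::rat_vector, 'l::finite, 'z) coalg_scheme"
  assumes graded_space: "graded_space H"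
begin

lemma subspace_component: "rat_vector.subspace (component H n)"
  using graded_space by (simp add: graded_space_def)

lemma components_independent:
  assumes "finite N" "\<And>n. n \<in> N \<Longrightarrow> x n \<in> component H n" "(\<Sum>n\<in>N. x n) = 0" "n \<in> N"
  shows "x n = 0"
proof -
  have "\<forall>N x. finite N \<and> (\<forall>n\<in>N. x n \<in> component H n) \<and> (\<Sum>n\<in>N. x n) = 0 \<longrightarrow> (\<forall>n\<in>N. x n = 0)"
    using graded_space by (simp add: graded_space_def)
  from this[THEN spec, THEN spec, of N x] assms show ?thesis by blast
qed

lemma homogeneous_part_sum:
  assumes N: "finite N" and x: "\<And>n. n \<in> N \<Longrightarrow> x n \<in> component H n"
  shows "homogeneous_part H m (\<Sum>n\<in>N. x n) = (if m \<in> N then x m else 0)"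
proof -
  let ?P = "\<lambda>d. (\<forall>n. Poly_Mapping.lookup d n \<in> component H n) \<and>
    (\<Sum>n\<in>N. x n) = (\<Sum>n\<in>Poly_Mapping.keys d. Poly_Mapping.lookup d n)"
  define d where "d = Abs_poly_mapping (\<lambda>n. if n \<in> N then x n else 0)"
  have "finite {n. (if n \<in> N then x n else 0) \<noteq> 0}"
    by (rule finite_subset[OF _ N]) auto
  then have d: "Poly_Mapping.lookup d n = (if n \<in> N then x n else 0)" for n
    by (simp add: d_def)
  have "(\<Sum>n\<in>Poly_Mapping.keys d. Poly_Mapping.lookup d n) = (\<Sum>n\<in>N. Poly_Mapping.lookup d n)"
    by (rule sum.mono_neutral_left) (auto simp: N in_keys_iff d split: if_splits)
  also have "\<dots> = (\<Sum>n\<in>N. x n)" by (rule sum.cong) (auto simp: d)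
  finally have Pd: "?P d"
    using x by (auto simp: d rat_vector.subspace_0[OF subspace_component])
  \<comment> \<open>Without uniqueness the \<open>THE\<close> in \<open>homogeneous_parts\<close> is
    void. The difference of two decompositions sums to 0 over the union of their supports, so
    independence of the components applies.\<close>
  have "d' = d" if d': "?P d'" for d'
  proof (rule poly_mapping_eqI)
    fix n
    let ?A = "Poly_Mapping.keys d \<union> Poly_Mapping.keys d'"
    let ?y = "\<lambda>n. Poly_Mapping.lookup d' n - Poly_Mapping.lookup d n"
    have "(\<Sum>n\<in>?A. Poly_Mapping.lookup e n) = (\<Sum>n\<in>Poly_Mapping.keys e. Poly_Mapping.lookup e n)"
      if "e \<in> {d, d'}" for e
      by (rule sum.mono_neutral_right) (use that in \<open>auto simp: in_keys_iff\<close>)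
    then have sum0: "(\<Sum>n\<in>?A. ?y n) = 0"
      using Pd d' by (simp add: sum_subtractf)
    have "?y n = 0" if "n \<in> ?A" for n
      by (rule components_independent[OF _ _ sum0 that])
        (use Pd d' in \<open>auto intro: rat_vector.subspace_diff[OF subspace_component]\<close>)
    then show "Poly_Mapping.lookup d' n = Poly_Mapping.lookup d n"
      by (cases "n \<in> ?A") (auto simp: in_keys_iff)
  qed
  then have "homogeneous_parts H (\<Sum>n\<in>N. x n) = d"
    unfolding homogeneous_parts_def by (intro the_equality Pd)
  then show ?thesis by (simp add: homogeneous_part_def d)
qed

lemma homogeneous_part_component:
  assumes "x \<in> component H n"
  shows "homogeneous_part H m x = (if m = n then x else 0)"
  using homogeneous_part_sum[of "{n}" "\<lambda>_. x" m] assms by simp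

lemma total_space_decomposition:
  assumes "h \<in> total_space H"
  obtains N x where "finite N" "\<And>n. n \<in> N \<Longrightarrow> x n \<in> component H n" "h = (\<Sum>n\<in>N. x n)"
proof -
  \<comment> \<open>The induction needs a family that lies in the right component at every index and
    is 0 outside \<open>N\<close>; then a vector of degree \<open>m\<close> can be added at
    \<open>m\<close> whether or not \<open>m\<close> already belongs to \<open>N\<close>.\<close>
  have "\<exists>N x. finite N \<and> (\<forall>n. x n \<in> component H n) \<and> (\<forall>n. n \<notin> N \<longrightarrow> x n = 0) \<and> h = (\<Sum>n\<in>N. x n)"
    using assms unfolding total_space_def
  proof (induction rule: rat_vector.span_induct_alt)
    case base
    show ?case
      by (rule exI[of _ "{}"], rule exI[of _ "\<lambda>_. 0"])
        (simp add: rat_vector.subspace_0[OF subspace_component])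
  next
    case (step c a y)
    then obtain N x m where x: "finite N" "\<forall>n. x n \<in> component H n" "\<forall>n. n \<notin> N \<longrightarrow> x n = 0"
      "y = (\<Sum>n\<in>N. x n)" and a: "a \<in> component H m" by blast
    have "(\<Sum>n\<in>N. x n) = (\<Sum>n\<in>insert m N. x n)"
      by (rule sum.mono_neutral_left) (use x in auto)
    moreover have "(\<Sum>n\<in>insert m N. if n = m then c *\<^sub>Q a else 0) = c *\<^sub>Q a"
      using x(1) by (subst sum.delta) auto
    ultimately have "c *\<^sub>Q a + y = (\<Sum>n\<in>insert m N. x n + (if n = m then c *\<^sub>Q a else 0))"
      by (simp add: x(4) sum.distrib del: sum.insert sum.delta)
    then show ?case using x a
      by (intro exI[of _ "insert m N"] exI[of _ "\<lambda>n. x n + (if n = m then c *\<^sub>Q a else 0)"])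
        (auto intro: rat_vector.subspace_add[OF subspace_component]
          rat_vector.subspace_scale[OF subspace_component])
  qed
  then show ?thesis using that by blast
qed

lemma homogeneous_part_in_component:
  assumes "h \<in> total_space H"
  shows "homogeneous_part H n h \<in> component H n"
proof -
  obtain N x where x: "finite N" "\<And>n. n \<in> N \<Longrightarrow> x n \<in> component H n" "h = (\<Sum>n\<in>N. x n)"
    by (rule total_space_decomposition[OF assms]) blast
  show ?thesis using x(2)
    by (simp add: x(3) homogeneous_part_sum[OF x(1,2)] rat_vector.subspace_0[OF subspace_component])
qed

lemma homogeneous_part_in_total_space: "h \<in> total_space H \<Longrightarrow> homogeneous_part H n h \<in> total_space H"
  using homogeneous_part_in_component component_subset_total_space by blast

lemma finite_homogeneous_support: "finite {n. homogeneous_part H n h \<noteq> 0}"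
  unfolding homogeneous_part_def by (rule finite_subset[OF _ finite_keys]) (auto simp: in_keys_iff)

lemma sum_homogeneous_part:
  assumes "h \<in> total_space H" "finite N" "\<And>n. n \<notin> N \<Longrightarrow> homogeneous_part H n h = 0"
  shows "(\<Sum>n\<in>N. homogeneous_part H n h) = h"
proof -
  obtain M x where x: "finite M" "\<And>n. n \<in> M \<Longrightarrow> x n \<in> component H n" "h = (\<Sum>n\<in>M. x n)"
    by (rule total_space_decomposition[OF assms(1)]) blast
  have p: "homogeneous_part H n h = (if n \<in> M then x n else 0)" for n
    unfolding x(3) by (rule homogeneous_part_sum) (use x in auto)
  have "(\<Sum>n\<in>N. homogeneous_part H n h) = (\<Sum>n\<in>N \<union> M. homogeneous_part H n h)"
    by (rule sum.mono_neutral_left) (use assms x(1) in auto)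
  also have "\<dots> = (\<Sum>n\<in>M. homogeneous_part H n h)"
    by (rule sum.mono_neutral_right) (use assms(2) x(1) in \<open>auto simp: p\<close>)
  also have "\<dots> = h" unfolding x(3) by (rule sum.cong) (auto simp: p[unfolded x(3)])
  finally show ?thesis .
qed

lemma linear_on_homogeneous_part: "linear_on (total_space H) (homogeneous_part H n)"
proof (rule linear_onI)
  fix g h assume gh: "g \<in> total_space H" "h \<in> total_space H"
  let ?N = "{n. homogeneous_part H n g \<noteq> 0} \<union> {n. homogeneous_part H n h \<noteq> 0}"
  have N: "finite ?N" by (simp add: finite_homogeneous_support)
  moreover have "g + h = (\<Sum>n\<in>?N. homogeneous_part H n g + homogeneous_part H n h)"
    unfolding sum.distrib using sum_homogeneous_part[OF gh(1) N] sum_homogeneous_part[OF gh(2) N] by simp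
  ultimately show "homogeneous_part H n (g + h) = homogeneous_part H n g + homogeneous_part H n h"
    using homogeneous_part_sum[of ?N "\<lambda>n. homogeneous_part H n g + homogeneous_part H n h" n] gh
    by (simp add: homogeneous_part_in_component rat_vector.subspace_add[OF subspace_component])
next
  fix c h assume h: "h \<in> total_space H"
  let ?N = "{n. homogeneous_part H n h \<noteq> 0}"
  have "c *\<^sub>Q h = (\<Sum>n\<in>?N. c *\<^sub>Q homogeneous_part H n h)"
    using sum_homogeneous_part[OF h finite_homogeneous_support[of h]]
    by (simp flip: rat_vector.scale_sum_right)
  then show "homogeneous_part H n (c *\<^sub>Q h) = c *\<^sub>Q homogeneous_part H n h"
    using homogeneous_part_sum[of ?N "\<lambda>n. c *\<^sub>Q homogeneous_part H n h" n] h
    by (simp add: homogeneous_part_in_component rat_vector.subspace_scale[OF subspace_component]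
        finite_homogeneous_support)
qed

text \<open>The index set on the left is the support of \<open>h\<close> and changes with
  \<open>h\<close>. Over a fixed finite superset \<open>N\<close> the same sum is visibly additive,
  since a linear map contributes 0 where the homogeneous part vanishes.\<close>

lemma linear_on_component_sum:
  assumes "\<And>n. linear_on (total_space H) (f n)" "h \<in> total_space H"
    and "finite N" "\<And>n. n \<notin> N \<Longrightarrow> homogeneous_part H n h = 0"
  shows "(\<Sum>n\<in>Poly_Mapping.keys (homogeneous_parts H h). f n (homogeneous_part H n h)) =
    (\<Sum>n\<in>N. f n (homogeneous_part H n h))"
proof -
  have "f n (homogeneous_part H n h) = 0" if "homogeneous_part H n h = 0" for n
    using that linear_on_0[OF assms(1) subspace_total_space] by simp
  then show ?thesis
    by (intro sum.mono_neutral_left)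
      (use assms(3,4) in \<open>auto simp: in_keys_iff homogeneous_part_def\<close>)
qed

text \<open>Glues one linear map per degree into a single one; \<open>bar\<close>, the antipode and
  the universal morphism all have this shape.\<close>

lemma linear_on_componentwise:
  assumes "\<And>n. linear_on (total_space H) (f n)"
  shows "linear_on (total_space H)
    (\<lambda>h. \<Sum>n\<in>Poly_Mapping.keys (homogeneous_parts H h). f n (homogeneous_part H n h))" (is "linear_on _ ?F")
proof (rule linear_onI)
  fix g h assume gh: "g \<in> total_space H" "h \<in> total_space H"
  then have gh': "g + h \<in> total_space H" by (simp add: rat_vector.subspace_add[OF subspace_total_space])
  let ?N = "{n. homogeneous_part H n g \<noteq> 0} \<union> {n. homogeneous_part H n h \<noteq> 0}"
  have N: "finite ?N" by (simp add: finite_homogeneous_support)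
  have "?F (g + h) = (\<Sum>n\<in>?N. f n (homogeneous_part H n (g + h)))"
    by (rule linear_on_component_sum[OF assms gh' N])
      (use gh in \<open>auto simp: linear_on_add[OF linear_on_homogeneous_part]\<close>)
  also have "\<dots> = (\<Sum>n\<in>?N. f n (homogeneous_part H n g) + f n (homogeneous_part H n h))"
    using gh by (intro sum.cong refl) (simp add: linear_on_add[OF linear_on_homogeneous_part]
      linear_on_add[OF assms] homogeneous_part_in_total_space)
  also have "\<dots> = ?F g + ?F h"
    using linear_on_component_sum[OF assms gh(1) N] linear_on_component_sum[OF assms gh(2) N]
    by (simp add: sum.distrib)
  finally show "?F (g + h) = ?F g + ?F h" .
next
  fix c h assume h: "h \<in> total_space H"
  then have h': "c *\<^sub>Q h \<in> total_space H" by (simp add: rat_vector.subspace_scale[OF subspace_total_space])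
  let ?N = "{n. homogeneous_part H n h \<noteq> 0}"
  have N: "finite ?N" by (simp add: finite_homogeneous_support)
  have "?F (c *\<^sub>Q h) = (\<Sum>n\<in>?N. f n (homogeneous_part H n (c *\<^sub>Q h)))"
    by (rule linear_on_component_sum[OF assms h' N])
      (use h in \<open>auto simp: linear_on_scale[OF linear_on_homogeneous_part]\<close>)
  also have "\<dots> = (\<Sum>n\<in>?N. c *\<^sub>Q f n (homogeneous_part H n h))"
    using h by (intro sum.cong refl) (simp add: linear_on_scale[OF linear_on_homogeneous_part]
      linear_on_scale[OF assms] homogeneous_part_in_total_space)
  also have "\<dots> = c *\<^sub>Q ?F h"
    using linear_on_component_sum[OF assms h N] by (simp add: rat_vector.scale_sum_right)
  finally show "?F (c *\<^sub>Q h) = c *\<^sub>Q ?F h" .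
qed

lemma componentwise_component:
  assumes "\<And>n. linear_on (total_space H) (f n)" "h \<in> component H m"
  shows "(\<Sum>n\<in>Poly_Mapping.keys (homogeneous_parts H h). f n (homogeneous_part H n h)) = f m h"
  using linear_on_component_sum[OF assms(1) subsetD[OF component_subset_total_space assms(2)], of "{m}"]
  by (simp add: homogeneous_part_component[OF assms(2)])

lemma linear_on_bar:
  assumes "linear_on (total_space H) \<phi>"
  shows "linear_on (total_space H) (bar H \<phi>)"
  unfolding bar_def by (rule linear_on_componentwise) (rule linear_on_mult_const[OF assms])

lemma bar_component:
  assumes "linear_on (total_space H) \<phi>" "h \<in> component H n"
  shows "bar H \<phi> h = (-1) ^ weight n * \<phi> h"
  unfolding bar_def
  by (rule componentwise_component[where f = "\<lambda>n h. (-1) ^ weight n * \<phi> h"])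
    (use linear_on_mult_const[OF assms(1)] assms(2) in auto)

end


section \<open>Sweedler calculus\<close>

text \<open>
  \<^term>\<open>sweedler H B h\<close> is the sum of \<^term>\<open>B h1 h2\<close> over the two tensor factors of the
  coproduct of \<^term>\<open>h\<close>.
\<close>

definition sweedler ::
  "('h::rat_vector, 'l::finite, 'z) coalg_scheme \<Rightarrow> ('h \<Rightarrow> 'h \<Rightarrow> 'b::rat_vector) \<Rightarrow> 'h \<Rightarrow> 'b" where
  "sweedler H B h = tensor_lift (total_space H) 2 (\<lambda>xs. B (xs ! 0) (xs ! 1)) (comult H h)"

definition trilinear_on :: "'a::rat_vector set \<Rightarrow> ('a \<Rightarrow> 'a \<Rightarrow> 'a \<Rightarrow> 'b::rat_vector) \<Rightarrow> bool" where
  "trilinear_on V T \<longleftrightarrow> (\<forall>a\<in>V. \<forall>b\<in>V. linear_on V (T a b) \<and> linear_on V (\<lambda>c. T a c b) \<and> linear_on V (\<lambda>c. T c a b))"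

definition linear_into :: "'a::rat_vector set \<Rightarrow> 'b::rat_vector set \<Rightarrow> ('a \<Rightarrow> 'b) \<Rightarrow> bool" where
  "linear_into V W f \<longleftrightarrow> linear_on V f \<and> f ` V \<subseteq> W"

lemma multilinear_on_3:
  assumes "trilinear_on V T"
  shows "multilinear_on V 3 (\<lambda>xs. T (xs ! 0) (xs ! 1) (xs ! 2))"
  unfolding multilinear_on_def
proof (intro ballI impI)
  fix xs ys assume xs: "xs \<in> lists V" "ys \<in> lists V" "Suc (length xs + length ys) = 3"
  then consider "length xs = 0" "length ys = Suc (Suc 0)" | "length xs = Suc 0" "length ys = Suc 0"
    | "length xs = Suc (Suc 0)" "length ys = 0" by linarith
  then show "linear_on V (\<lambda>a. T ((xs @ a # ys) ! 0) ((xs @ a # ys) ! 1) ((xs @ a # ys) ! 2))"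
    using xs(1,2) assms by cases (auto simp: length_Suc_conv trilinear_on_def)
qed

lemma bilinear_on_compose:
  assumes "bilinear_on W M" "linear_into V W f" "linear_into V W g"
  shows "bilinear_on V (\<lambda>a b. M (f a) (g b))"
  using assms by (auto simp: bilinear_on_def linear_into_def linear_on_def image_subset_iff)

lemma linear_into_id: "linear_into V V (\<lambda>x. x)"
  by (simp add: linear_into_def linear_on_def)

lemma linear_into_UNIV: "linear_into V UNIV f \<longleftrightarrow> linear_on V f"
  by (simp add: linear_into_def)

lemma bilinear_on_times: "bilinear_on V ((*) :: rat \<Rightarrow> rat \<Rightarrow> rat)"
  by (auto simp: bilinear_on_def linear_on_def scaleQ_rat_def algebra_simps)

lemma bilinear_on_mult:
  assumes "linear_on V \<phi>" "linear_on V \<psi>"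
  shows "bilinear_on V (\<lambda>a b. \<phi> a * \<psi> b :: rat)"
  using assms by (auto simp: bilinear_on_def linear_on_def scaleQ_rat_def algebra_simps)

lemma bilinear_on_scaleQ_left:
  assumes "linear_on V \<phi>" "linear_on V f"
  shows "bilinear_on V (\<lambda>a b. \<phi> a *\<^sub>Q f b)"
  using assms by (auto simp: bilinear_on_def linear_on_def scaleQ_rat_def scaleQ_scaleQ scaleQ_add_left
      scaleQ_add_right mult.commute)

lemma bilinear_on_scaleQ_right:
  assumes "linear_on V \<phi>" "linear_on V f"
  shows "bilinear_on V (\<lambda>a b. \<phi> b *\<^sub>Q f a)"
  using assms by (auto simp: bilinear_on_def linear_on_def scaleQ_rat_def scaleQ_scaleQ scaleQ_add_left
      scaleQ_add_right mult.commute)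

lemma bilinear_on_linear:
  assumes "bilinear_on V B" "linear_on W L" "\<And>a b. a \<in> V \<Longrightarrow> b \<in> V \<Longrightarrow> B a b \<in> W"
  shows "bilinear_on V (\<lambda>a b. L (B a b))"
  using assms by (auto simp: bilinear_on_def linear_on_def)

lemma bilinear_on_sum:
  assumes "\<And>i. i \<in> A \<Longrightarrow> bilinear_on V (B i)"
  shows "bilinear_on V (\<lambda>a b. \<Sum>i\<in>A. B i a b)"
  using assms by (auto simp: bilinear_on_def intro!: linear_on_sum_fun)

locale gcoalg =
  fixes H :: "('h::rat_vector, 'l::finite, 'z) coalg_scheme"
  assumes graded_coalgebra: "graded_coalgebra H"

sublocale gcoalg \<subseteq> gspace
  by standard (use graded_coalgebra in \<open>simp add: graded_coalgebra_def\<close>)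

context gcoalg
begin

lemma linear_on_comult: "linear_on (total_space H) (comult H)"
  and linear_on_counit: "linear_on (total_space H) (counit H)"
  using graded_coalgebra by (simp_all add: graded_coalgebra_def)

lemma counit_component: "h \<in> component H n \<Longrightarrow> n \<noteq> 0 \<Longrightarrow> counit H h = 0"
  using graded_coalgebra by (simp add: graded_coalgebra_def)

lemma comult_repr_graded:
  assumes "h \<in> component H n"
  obtains ps where "comult H h = (\<Sum>(a, b)\<leftarrow>ps. tensor [a, b])"
    "\<And>a b. (a, b) \<in> set ps \<Longrightarrow> \<exists>p q. a \<in> component H p \<and> b \<in> component H q \<and> p + q = n"
proof -
  let ?R = "{(a, b). \<exists>p q. a \<in> component H p \<and> b \<in> component H q \<and> p + q = n}"
  have "{tensor [a, b] | a b p q. a \<in> component H p \<and> b \<in> component H q \<and> p + q = n} =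
    (\<lambda>(a, b). tensor [a, b]) ` ?R" (is "?T = _") by (auto simp: image_iff) blast
  moreover have "comult H h \<in> rat_vector.span ?T"
    using graded_coalgebra assms unfolding graded_coalgebra_def by blast
  ultimately have "comult H h \<in> rat_vector.span ((\<lambda>(a, b). tensor [a, b]) ` ?R)"
    by (simp only:)
  then have "\<exists>ps. set ps \<subseteq> ?R \<and> comult H h = (\<Sum>(a, b)\<leftarrow>ps. tensor [a, b])"
    by (rule span_tensor2_repr) (use rat_vector.subspace_scale[OF subspace_component] in blast)
  then show ?thesis using that by blast
qed

lemma comult_in_tensor_power:
  assumes "h \<in> total_space H"
  shows "comult H h \<in> tensor_power (total_space H) 2"
proof (rule total_space_imageI[OF linear_on_comult _ _ assms])
  show "rat_vector.subspace (tensor_power (total_space H) 2)"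
    by (simp add: tensor_power_def)
  fix n x assume "x \<in> component H n"
  from comult_repr_graded[OF this] obtain ps where ps: "comult H x = (\<Sum>(a, b)\<leftarrow>ps. tensor [a, b])"
    "\<And>a b. (a, b) \<in> set ps \<Longrightarrow> \<exists>p q. a \<in> component H p \<and> b \<in> component H q \<and> p + q = n" by metis
  then have sub: "set ps \<subseteq> total_space H \<times> total_space H"
    using component_subset_total_space[of H] by fast
  show "comult H x \<in> tensor_power (total_space H) 2"
    unfolding ps(1) tensor_power_2
    by (rule sum_list_in_subspace) (use sub in \<open>auto intro!: rat_vector.span_base\<close>)
qed

lemma comult_repr:
  assumes "h \<in> total_space H"
  obtains ps where "comult H h = (\<Sum>(a, b)\<leftarrow>ps. tensor [a, b])" "set ps \<subseteq> total_space H \<times> total_space H"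
  using span_tensor2_repr[OF comult_in_tensor_power[OF assms, unfolded tensor_power_2]] that
    rat_vector.subspace_scale[OF subspace_total_space[of H]] by blast

lemma sweedler_repr:
  assumes "bilinear_on (total_space H) B" "comult H h = (\<Sum>(a, b)\<leftarrow>ps. tensor [a, b])"
    "set ps \<subseteq> total_space H \<times> total_space H"
  shows "sweedler H B h = (\<Sum>(a, b)\<leftarrow>ps. B a b)"
  unfolding sweedler_def assms(2) by (rule tensor_lift_2_sum_list) (use assms subspace_total_space in auto)

lemma linear_on_sweedler:
  assumes "bilinear_on (total_space H) B"
  shows "linear_on (total_space H) (sweedler H B)"
  unfolding sweedler_def
  by (rule linear_on_compose[OF linear_on_comult linear_map_imp_linear_on])
    (use linear_map_tensor_lift[OF subspace_total_space multilinear_on_2[OF assms]] in auto)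

lemma sweedler_cong:
  assumes "\<And>a b. a \<in> total_space H \<Longrightarrow> b \<in> total_space H \<Longrightarrow> B a b = B' a b"
  shows "sweedler H B h = sweedler H B' h"
proof -
  have "tensor_lift (total_space H) 2 (\<lambda>xs. B (xs ! 0) (xs ! 1)) =
    tensor_lift (total_space H) 2 (\<lambda>xs. B' (xs ! 0) (xs ! 1))"
    by (rule tensor_lift_cong) (auto simp: assms length_Suc_conv numeral_2_eq_2)
  then show ?thesis by (simp only: sweedler_def)
qed

text \<open>Only pairs of degrees adding up to \<open>n\<close> occur in the coproduct of an element
  of degree \<open>n\<close>. This is what allows a map defined degree by degree to be replaced,
  inside a convolution, by one truncated series.\<close>

lemma sweedler_cong_graded:
  assumes "bilinear_on (total_space H) B" "bilinear_on (total_space H) B'" "h \<in> component H n"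
    and "\<And>a b p q. a \<in> component H p \<Longrightarrow> b \<in> component H q \<Longrightarrow> p + q = n \<Longrightarrow> B a b = B' a b"
  shows "sweedler H B h = sweedler H B' h"
proof -
  obtain ps where ps: "comult H h = (\<Sum>(a, b)\<leftarrow>ps. tensor [a, b])"
    "\<And>a b. (a, b) \<in> set ps \<Longrightarrow> \<exists>p q. a \<in> component H p \<and> b \<in> component H q \<and> p + q = n"
    by (rule comult_repr_graded[OF assms(3)]) blast
  then have sub: "set ps \<subseteq> total_space H \<times> total_space H"
    using component_subset_total_space[of H] by fast
  have "(\<Sum>(a, b)\<leftarrow>ps. B a b) = (\<Sum>(a, b)\<leftarrow>ps. B' a b)"
    by (rule arg_cong[where f = sum_list], rule map_cong) (use ps(2) assms(4) in fastforce)+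
  then show ?thesis by (simp add: sweedler_repr[OF _ ps(1) sub] assms(1,2))
qed

lemma sweedler_linear:
  assumes "bilinear_on (total_space H) B" "linear_on W L" "rat_vector.subspace W"
    and "\<And>a b. a \<in> total_space H \<Longrightarrow> b \<in> total_space H \<Longrightarrow> B a b \<in> W" "h \<in> total_space H"
  shows "L (sweedler H B h) = sweedler H (\<lambda>a b. L (B a b)) h"
proof -
  obtain ps where ps: "comult H h = (\<Sum>(a, b)\<leftarrow>ps. tensor [a, b])" "set ps \<subseteq> total_space H \<times> total_space H"
    by (rule comult_repr[OF assms(5)]) blast
  have "L (\<Sum>(a, b)\<leftarrow>ps. B a b) = (\<Sum>p\<leftarrow>ps. L (case p of (a, b) \<Rightarrow> B a b))"
    by (rule linear_on_sum_list[OF assms(2,3)]) (use ps(2) assms(4) in auto)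
  then show ?thesis
    by (simp add: sweedler_repr[OF _ ps] assms(1) bilinear_on_linear[OF assms(1,2,4)] split_def)
qed

lemma sweedler_in:
  assumes "bilinear_on (total_space H) B" "rat_vector.subspace W"
    and "\<And>a b. a \<in> total_space H \<Longrightarrow> b \<in> total_space H \<Longrightarrow> B a b \<in> W" "h \<in> total_space H"
  shows "sweedler H B h \<in> W"
proof -
  obtain ps where ps: "comult H h = (\<Sum>(a, b)\<leftarrow>ps. tensor [a, b])" "set ps \<subseteq> total_space H \<times> total_space H"
    by (rule comult_repr[OF assms(4)]) blast
  show ?thesis unfolding sweedler_repr[OF assms(1) ps]
    by (rule sum_list_in_subspace[OF assms(2)]) (use ps(2) assms(3) in auto)
qed

lemma sweedler_in_graded:
  assumes "bilinear_on (total_space H) B" "rat_vector.subspace W" "h \<in> component H n"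
    and "\<And>a b p q. a \<in> component H p \<Longrightarrow> b \<in> component H q \<Longrightarrow> p + q = n \<Longrightarrow> B a b \<in> W"
  shows "sweedler H B h \<in> W"
proof -
  obtain ps where ps: "comult H h = (\<Sum>(a, b)\<leftarrow>ps. tensor [a, b])"
    "\<And>a b. (a, b) \<in> set ps \<Longrightarrow> \<exists>p q. a \<in> component H p \<and> b \<in> component H q \<and> p + q = n"
    by (rule comult_repr_graded[OF assms(3)]) blast
  then have sub: "set ps \<subseteq> total_space H \<times> total_space H"
    using component_subset_total_space[of H] by fast
  show ?thesis unfolding sweedler_repr[OF assms(1) ps(1) sub]
    by (rule sum_list_in_subspace[OF assms(2)]) (use ps(2) assms(4) in fast)
qed

lemma sweedler_sum:
  assumes "\<And>i. i \<in> A \<Longrightarrow> bilinear_on (total_space H) (B i)" "h \<in> total_space H"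
  shows "sweedler H (\<lambda>a b. \<Sum>i\<in>A. B i a b) h = (\<Sum>i\<in>A. sweedler H (B i) h)"
proof -
  obtain ps where ps: "comult H h = (\<Sum>(a, b)\<leftarrow>ps. tensor [a, b])" "set ps \<subseteq> total_space H \<times> total_space H"
    by (rule comult_repr[OF assms(2)]) blast
  have "(\<Sum>(a, b)\<leftarrow>ps. \<Sum>i\<in>A. B i a b) = (\<Sum>i\<in>A. \<Sum>(a, b)\<leftarrow>ps. B i a b)"
    by (induction ps) (auto simp: sum.distrib)
  moreover have "(\<Sum>i\<in>A. sweedler H (B i) h) = (\<Sum>i\<in>A. \<Sum>(a, b)\<leftarrow>ps. B i a b)"
    by (rule sum.cong) (simp_all add: sweedler_repr[OF _ ps] assms(1))
  ultimately show ?thesis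
    using sweedler_repr[OF bilinear_on_sum ps, of A B] assms(1) by simp
qed

lemma sweedler_add:
  assumes "bilinear_on (total_space H) B" "bilinear_on (total_space H) B'" "h \<in> total_space H"
  shows "sweedler H (\<lambda>a b. B a b + B' a b) h = sweedler H B h + sweedler H B' h"
proof -
  obtain ps where ps: "comult H h = (\<Sum>(a, b)\<leftarrow>ps. tensor [a, b])" "set ps \<subseteq> total_space H \<times> total_space H"
    by (rule comult_repr[OF assms(3)]) blast
  have "bilinear_on (total_space H) (\<lambda>a b. B a b + B' a b)"
    using assms(1,2) by (simp add: bilinear_on_def linear_on_def scaleQ_add_right algebra_simps)
  then show ?thesis
    by (simp add: sweedler_repr[OF _ ps] assms(1,2) split_def sum_list_addf)
qed

text \<open>With its mirror image below, this translates the two sides of coassociativity, which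
  live in the third tensor power, into nested Sweedler sums.\<close>

lemma sweedler_comult_left:
  assumes "trilinear_on (total_space H) T" "a \<in> total_space H" "b \<in> total_space H"
  shows "tensor_lift (total_space H) 3 (\<lambda>xs. T (xs ! 0) (xs ! 1) (xs ! 2)) (comult H a \<otimes>\<^sub>T tensor [b]) =
    sweedler H (\<lambda>c d. T c d b) a"
proof -
  let ?L = "tensor_lift (total_space H) 3 (\<lambda>xs. T (xs ! 0) (xs ! 1) (xs ! 2))"
  obtain ps where ps: "comult H a = (\<Sum>(a, b)\<leftarrow>ps. tensor [a, b])" "set ps \<subseteq> total_space H \<times> total_space H"
    by (rule comult_repr[OF assms(2)]) blast
  have lin: "linear_map (\<lambda>t. ?L (t \<otimes>\<^sub>T tensor [b]))"
    using Vector_Spaces.linear_compose[OF linear_map_tensor_mult_left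
        linear_map_tensor_lift[OF subspace_total_space multilinear_on_3[OF assms(1)]]]
    by (simp add: o_def)
  have "?L (comult H a \<otimes>\<^sub>T tensor [b]) = (\<Sum>p\<leftarrow>ps. ?L ((case p of (c, d) \<Rightarrow> tensor [c, d]) \<otimes>\<^sub>T tensor [b]))"
    unfolding ps(1) by (rule linear_map_sum_list[OF lin])
  also have "\<dots> = (\<Sum>(c, d)\<leftarrow>ps. T c d b)"
    by (rule arg_cong[where f = sum_list], rule map_cong)
      (use ps(2) assms(3) in \<open>auto simp: tensor_mult_tensor
        tensor_lift_tensor[OF subspace_total_space multilinear_on_3[OF assms(1)], simplified]\<close>)
  also have "\<dots> = sweedler H (\<lambda>c d. T c d b) a"
    by (rule sweedler_repr[OF _ ps, symmetric])
      (use assms in \<open>auto simp: trilinear_on_def bilinear_on_def\<close>)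
  finally show ?thesis .
qed

lemma sweedler_comult_right:
  assumes "trilinear_on (total_space H) T" "a \<in> total_space H" "b \<in> total_space H"
  shows "tensor_lift (total_space H) 3 (\<lambda>xs. T (xs ! 0) (xs ! 1) (xs ! 2)) (tensor [a] \<otimes>\<^sub>T comult H b) =
    sweedler H (\<lambda>c d. T a c d) b"
proof -
  let ?L = "tensor_lift (total_space H) 3 (\<lambda>xs. T (xs ! 0) (xs ! 1) (xs ! 2))"
  obtain ps where ps: "comult H b = (\<Sum>(a, b)\<leftarrow>ps. tensor [a, b])" "set ps \<subseteq> total_space H \<times> total_space H"
    by (rule comult_repr[OF assms(3)]) blast
  have lin: "linear_map (\<lambda>t. ?L (tensor [a] \<otimes>\<^sub>T t))"
    using Vector_Spaces.linear_compose[OF linear_map_tensor_mult_right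
        linear_map_tensor_lift[OF subspace_total_space multilinear_on_3[OF assms(1)]]]
    by (simp add: o_def)
  have "?L (tensor [a] \<otimes>\<^sub>T comult H b) = (\<Sum>p\<leftarrow>ps. ?L (tensor [a] \<otimes>\<^sub>T (case p of (c, d) \<Rightarrow> tensor [c, d])))"
    unfolding ps(1) by (rule linear_map_sum_list[OF lin])
  also have "\<dots> = (\<Sum>(c, d)\<leftarrow>ps. T a c d)"
    by (rule arg_cong[where f = sum_list], rule map_cong)
      (use ps(2) assms(2) in \<open>auto simp: tensor_mult_tensor
        tensor_lift_tensor[OF subspace_total_space multilinear_on_3[OF assms(1)], simplified]\<close>)
  also have "\<dots> = sweedler H (\<lambda>c d. T a c d) b"
    by (rule sweedler_repr[OF _ ps, symmetric])
      (use assms in \<open>auto simp: trilinear_on_def bilinear_on_def\<close>)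
  finally show ?thesis .
qed

lemma bilinear_on_comult_left: "bilinear_on (total_space H) (\<lambda>a b. comult H a \<otimes>\<^sub>T tensor [b])"
  and bilinear_on_comult_right: "bilinear_on (total_space H) (\<lambda>a b. tensor [a] \<otimes>\<^sub>T comult H b)"
  by (auto simp: tensor1_add tensor1_scale bilinear_on_def linear_on_def linear_on_add[OF linear_on_comult]
      linear_on_scale[OF linear_on_comult] linear_map_add[OF linear_map_tensor_mult_left]
      linear_map_add[OF linear_map_tensor_mult_right] linear_map_scale[OF linear_map_tensor_mult_left]
      linear_map_scale[OF linear_map_tensor_mult_right])

text \<open>Both nested sums are the lift of \<open>T\<close> to the third tensor power, evaluated
  on the two sides of the coassociativity axiom.\<close>

lemma sweedler_coassoc:
  assumes "trilinear_on (total_space H) T" "h \<in> total_space H"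
  shows "sweedler H (\<lambda>a b. sweedler H (\<lambda>c d. T c d b) a) h = sweedler H (\<lambda>a b. sweedler H (\<lambda>c d. T a c d) b) h"
proof -
  let ?L = "tensor_lift (total_space H) 3 (\<lambda>xs. T (xs ! 0) (xs ! 1) (xs ! 2))"
  have L: "linear_on UNIV ?L"
    using linear_map_tensor_lift[OF subspace_total_space multilinear_on_3[OF assms(1)]]
    by (rule linear_map_imp_linear_on)
  have "sweedler H (\<lambda>a b. sweedler H (\<lambda>c d. T c d b) a) h = sweedler H (\<lambda>a b. ?L (comult H a \<otimes>\<^sub>T tensor [b])) h"
    by (rule sweedler_cong) (rule sweedler_comult_left[OF assms(1), symmetric])
  also have "\<dots> = ?L (sweedler H (\<lambda>a b. comult H a \<otimes>\<^sub>T tensor [b]) h)"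
    by (rule sweedler_linear[OF bilinear_on_comult_left L, symmetric]) (use assms(2) in auto)
  also have "sweedler H (\<lambda>a b. comult H a \<otimes>\<^sub>T tensor [b]) h = sweedler H (\<lambda>a b. tensor [a] \<otimes>\<^sub>T comult H b) h"
    using graded_coalgebra assms(2) unfolding graded_coalgebra_def sweedler_def by blast
  also have "?L \<dots> = sweedler H (\<lambda>a b. ?L (tensor [a] \<otimes>\<^sub>T comult H b)) h"
    by (rule sweedler_linear[OF bilinear_on_comult_right L]) (use assms(2) in auto)
  also have "\<dots> = sweedler H (\<lambda>a b. sweedler H (\<lambda>c d. T a c d) b) h"
    by (rule sweedler_cong) (rule sweedler_comult_right[OF assms(1)])
  finally show ?thesis .
qed

lemma sweedler_counit_left:
  assumes "linear_on (total_space H) f" "h \<in> total_space H"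
  shows "sweedler H (\<lambda>a b. counit H a *\<^sub>Q f b) h = f h"
proof -
  have "sweedler H (\<lambda>a b. counit H a *\<^sub>Q f b) h = sweedler H (\<lambda>a b. f (counit H a *\<^sub>Q b)) h"
    by (rule sweedler_cong) (simp add: linear_on_scale[OF assms(1)])
  also have "\<dots> = f (sweedler H (\<lambda>a b. counit H a *\<^sub>Q b) h)"
    by (rule sweedler_linear[symmetric, OF _ assms(1) subspace_total_space])
      (use assms(2) in \<open>auto intro: bilinear_on_scaleQ_left linear_on_counit linear_on_id
        rat_vector.subspace_scale subspace_total_space\<close>)
  also have "sweedler H (\<lambda>a b. counit H a *\<^sub>Q b) h = h"
    using graded_coalgebra assms(2) by (simp add: graded_coalgebra_def sweedler_def)
  finally show ?thesis .
qed

lemma sweedler_counit_right: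
  assumes "linear_on (total_space H) f" "h \<in> total_space H"
  shows "sweedler H (\<lambda>a b. counit H b *\<^sub>Q f a) h = f h"
proof -
  have "sweedler H (\<lambda>a b. counit H b *\<^sub>Q f a) h = sweedler H (\<lambda>a b. f (counit H b *\<^sub>Q a)) h"
    by (rule sweedler_cong) (simp add: linear_on_scale[OF assms(1)])
  also have "\<dots> = f (sweedler H (\<lambda>a b. counit H b *\<^sub>Q a) h)"
    by (rule sweedler_linear[symmetric, OF _ assms(1) subspace_total_space])
      (use assms(2) in \<open>auto intro: bilinear_on_scaleQ_right linear_on_counit linear_on_id
        rat_vector.subspace_scale subspace_total_space\<close>)
  also have "sweedler H (\<lambda>a b. counit H b *\<^sub>Q a) h = h"
    using graded_coalgebra assms(2) by (simp add: graded_coalgebra_def sweedler_def)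
  finally show ?thesis .
qed

end

section \<open>Convolution\<close>

text \<open>The target product \<open>M\<close> is a parameter so that one calculus serves
  functionals, endomorphisms of a bialgebra (for the antipode) and maps between two bialgebras (for
  the preservation of antipodes).\<close>

definition convolve ::
  "('h::rat_vector, 'l::finite, 'z) coalg_scheme \<Rightarrow> ('b::rat_vector \<Rightarrow> 'b \<Rightarrow> 'b) \<Rightarrow> ('h \<Rightarrow> 'b) \<Rightarrow> ('h \<Rightarrow> 'b) \<Rightarrow> 'h \<Rightarrow> 'b" where
  "convolve H M f g = sweedler H (\<lambda>a b. M (f a) (g b))"

text \<open>Relative to a subspace \<open>W\<close>, since the product of a bialgebra is controlled
  only on its total space. The unit is kept apart and enters only in
  \<open>convolve_unit_left\<close> and \<open>convolve_unit_right\<close>.\<close>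

definition algebra_on :: "'b::rat_vector set \<Rightarrow> ('b \<Rightarrow> 'b \<Rightarrow> 'b) \<Rightarrow> bool" where
  "algebra_on W M \<longleftrightarrow> rat_vector.subspace W \<and> bilinear_on W M \<and> (\<forall>a\<in>W. \<forall>b\<in>W. M a b \<in> W) \<and>
    (\<forall>a\<in>W. \<forall>b\<in>W. \<forall>c\<in>W. M (M a b) c = M a (M b c))"

lemma algebra_on_rat: "algebra_on UNIV ((*) :: rat \<Rightarrow> rat \<Rightarrow> rat)"
  by (simp add: algebra_on_def bilinear_on_times)

lemma convolution_product_eq: "convolution_product H \<phi> \<psi> = convolve H (*) \<phi> \<psi>"
  by (simp add: fun_eq_iff convolution_product_def convolve_def sweedler_def)

context gcoalg
begin

lemma convolve_cong:
  assumes "\<And>a. a \<in> total_space H \<Longrightarrow> f a = f' a" "\<And>a. a \<in> total_space H \<Longrightarrow> g a = g' a"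
  shows "convolve H M f g h = convolve H M f' g' h"
  unfolding convolve_def by (rule sweedler_cong) (simp add: assms)

lemma linear_into_convolve:
  assumes M: "algebra_on W M" and f: "linear_into (total_space H) W f" and g: "linear_into (total_space H) W g"
  shows "linear_into (total_space H) W (convolve H M f g)"
proof -
  have bil: "bilinear_on (total_space H) (\<lambda>a b. M (f a) (g b))"
    by (rule bilinear_on_compose[OF _ f g]) (use M in \<open>simp add: algebra_on_def\<close>)
  show ?thesis
    unfolding linear_into_def convolve_def
    using linear_on_sweedler[OF bil] sweedler_in[OF bil, of W] M f g
    by (auto simp: algebra_on_def linear_into_def image_subset_iff)
qed

text \<open>Coassociativity exchanges the nesting of the Sweedler sums, and associativity of
  \<open>M\<close> moves the brackets.\<close>

lemma convolve_assoc:
  assumes M: "algebra_on W M" and f: "linear_into (total_space H) W f" and g: "linear_into (total_space H) W g"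
    and k: "linear_into (total_space H) W k" and h: "h \<in> total_space H"
  shows "convolve H M (convolve H M f g) k h = convolve H M f (convolve H M g k) h"
proof -
  let ?V = "total_space H"
  have W: "rat_vector.subspace W" "bilinear_on W M" "\<And>a b. a \<in> W \<Longrightarrow> b \<in> W \<Longrightarrow> M a b \<in> W"
    "\<And>a b c. a \<in> W \<Longrightarrow> b \<in> W \<Longrightarrow> c \<in> W \<Longrightarrow> M (M a b) c = M a (M b c)"
    using M by (auto simp: algebra_on_def)
  have into: "f a \<in> W" "g a \<in> W" "k a \<in> W" if "a \<in> ?V" for a
    using f g k that by (auto simp: linear_into_def)
  have "convolve H M (convolve H M f g) k h = sweedler H (\<lambda>a b. sweedler H (\<lambda>c d. M (M (f c) (g d)) (k b)) a) h"
    unfolding convolve_def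
  proof (rule sweedler_cong)
    fix a b assume ab: "a \<in> ?V" "b \<in> ?V"
    show "M (sweedler H (\<lambda>a b. M (f a) (g b)) a) (k b) = sweedler H (\<lambda>c d. M (M (f c) (g d)) (k b)) a"
      by (rule sweedler_linear[OF bilinear_on_compose[OF W(2) f g] _ W(1)])
        (use ab into W in \<open>auto simp: bilinear_on_def\<close>)
  qed
  also have "\<dots> = sweedler H (\<lambda>a b. sweedler H (\<lambda>c d. M (M (f a) (g c)) (k d)) b) h"
  proof (rule sweedler_coassoc[OF _ h])
    show "trilinear_on ?V (\<lambda>c d b. M (M (f c) (g d)) (k b))"
      using W f g k into unfolding trilinear_on_def bilinear_on_def linear_into_def linear_on_def
      by (simp add: W(3))
  qed
  also have "\<dots> = convolve H M f (convolve H M g k) h"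
    unfolding convolve_def
  proof (rule sweedler_cong)
    fix a b assume ab: "a \<in> ?V" "b \<in> ?V"
    have "M (f a) (sweedler H (\<lambda>a b. M (g a) (k b)) b) = sweedler H (\<lambda>c d. M (f a) (M (g c) (k d))) b"
      by (rule sweedler_linear[OF bilinear_on_compose[OF W(2) g k] _ W(1)])
        (use ab into W in \<open>auto simp: bilinear_on_def\<close>)
    also have "\<dots> = sweedler H (\<lambda>c d. M (M (f a) (g c)) (k d)) b"
      by (rule sweedler_cong) (use ab into W in auto)
    finally show "sweedler H (\<lambda>c d. M (M (f a) (g c)) (k d)) b = M (f a) (sweedler H (\<lambda>a b. M (g a) (k b)) b)" ..
  qed
  finally show ?thesis .
qed

lemma convolve_unit_left:
  assumes M: "algebra_on W M" and f: "linear_into (total_space H) W f" and u: "u \<in> W" "\<And>x. x \<in> W \<Longrightarrow> M u x = x"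
    and h: "h \<in> total_space H"
  shows "convolve H M (\<lambda>h. counit H h *\<^sub>Q u) f h = f h"
proof -
  have "convolve H M (\<lambda>h. counit H h *\<^sub>Q u) f h = sweedler H (\<lambda>a b. counit H a *\<^sub>Q f b) h"
    unfolding convolve_def
    by (rule sweedler_cong) (use M f u in \<open>auto simp: algebra_on_def bilinear_on_def linear_on_def linear_into_def\<close>)
  also have "\<dots> = f h" by (rule sweedler_counit_left[OF _ h]) (use f in \<open>simp add: linear_into_def\<close>)
  finally show ?thesis .
qed

lemma convolve_unit_right:
  assumes M: "algebra_on W M" and f: "linear_into (total_space H) W f" and u: "u \<in> W" "\<And>x. x \<in> W \<Longrightarrow> M x u = x"
    and h: "h \<in> total_space H"
  shows "convolve H M f (\<lambda>h. counit H h *\<^sub>Q u) h = f h"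
proof -
  have "convolve H M f (\<lambda>h. counit H h *\<^sub>Q u) h = sweedler H (\<lambda>a b. counit H b *\<^sub>Q f a) h"
    unfolding convolve_def
    by (rule sweedler_cong) (use M f u in \<open>auto simp: algebra_on_def bilinear_on_def linear_on_def linear_into_def\<close>)
  also have "\<dots> = f h" by (rule sweedler_counit_right[OF _ h]) (use f in \<open>simp add: linear_into_def\<close>)
  finally show ?thesis .
qed

lemma linear_on_convolve:
  fixes \<phi> \<psi> :: "'h \<Rightarrow> rat"
  assumes "linear_on (total_space H) \<phi>" "linear_on (total_space H) \<psi>"
  shows "linear_on (total_space H) (convolve H (*) \<phi> \<psi>)"
  using linear_into_convolve[OF algebra_on_rat] assms by (simp add: linear_into_UNIV)

lemma convolve_counit_left:
  assumes "linear_on (total_space H) \<phi>" "h \<in> total_space H"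
  shows "convolve H (*) (counit H) \<phi> h = \<phi> h"
  using convolve_unit_left[OF algebra_on_rat, of \<phi> 1 h] assms by (simp add: linear_into_UNIV scaleQ_rat_def)

lemma convolve_counit_right:
  assumes "linear_on (total_space H) \<phi>" "h \<in> total_space H"
  shows "convolve H (*) \<phi> (counit H) h = \<phi> h"
  using convolve_unit_right[OF algebra_on_rat, of \<phi> 1 h] assms by (simp add: linear_into_UNIV scaleQ_rat_def)

end

section \<open>Iterated convolution and the functionals attached to words\<close>

fun convolve_list ::
  "('h::rat_vector, 'l::finite, 'z) coalg_scheme \<Rightarrow> ('h \<Rightarrow> rat) list \<Rightarrow> 'h \<Rightarrow> rat" where
  "convolve_list H [] = counit H"
| "convolve_list H (\<phi> # \<Phi>) = convolve H (*) \<phi> (convolve_list H \<Phi>)"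

text \<open>Agrees with \<open>functional_component\<close> on the total space for linear \<phi>, by
  \<open>functional_component_eq_word_functional\<close>, but is recursive in the word, which is the
  form that the inductions need.\<close>

definition word_functional ::
  "('h::rat_vector, 'l::finite, 'z) coalg_scheme \<Rightarrow> ('h \<Rightarrow> rat) \<Rightarrow> (nat ^ 'l) list \<Rightarrow> 'h \<Rightarrow> rat" where
  "word_functional H \<phi> I = convolve_list H (map (\<lambda>n h. \<phi> (homogeneous_part H n h)) I)"

lemma word_functional_simps:
  "word_functional H \<phi> [] = counit H"
  "word_functional H \<phi> (n # I) = convolve H (*) (\<lambda>h. \<phi> (homogeneous_part H n h)) (word_functional H \<phi> I)"
  by (simp_all add: word_functional_def)

abbreviation apply_list :: "('a \<Rightarrow> 'b) list \<Rightarrow> 'a list \<Rightarrow> 'b list" where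
  "apply_list \<equiv> map2 (\<lambda>f. f)"

lemma apply_list_split:
  assumes "length \<Phi> = Suc (length xs + length ys)"
  obtains \<Phi>1 \<phi> \<Phi>2 where "\<Phi> = \<Phi>1 @ \<phi> # \<Phi>2"
    "\<And>a. apply_list \<Phi> (xs @ a # ys) = apply_list \<Phi>1 xs @ \<phi> a # apply_list \<Phi>2 ys"
proof
  let ?n = "length xs"
  show eq: "\<Phi> = take ?n \<Phi> @ \<Phi> ! ?n # drop (Suc ?n) \<Phi>"
    by (rule id_take_nth_drop) (use assms in simp)
  show "apply_list \<Phi> (xs @ a # ys) = apply_list (take ?n \<Phi>) xs @ (\<Phi> ! ?n) a # apply_list (drop (Suc ?n) \<Phi>) ys" for a
    by (subst (1) eq, subst zip_append) (use assms in auto)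
qed

lemma multilinear_on_prod_list:
  assumes "\<And>\<phi>. \<phi> \<in> set \<Phi> \<Longrightarrow> linear_on V \<phi>" "length \<Phi> = m"
  shows "multilinear_on V m (\<lambda>xs. prod_list (apply_list \<Phi> xs) :: rat)"
  unfolding multilinear_on_def
proof (intro ballI impI)
  fix xs ys :: "'a list" assume m: "Suc (length xs + length ys) = m"
  obtain \<Phi>1 \<phi> \<Phi>2 where *: "\<Phi> = \<Phi>1 @ \<phi> # \<Phi>2"
    "\<And>a. apply_list \<Phi> (xs @ a # ys) = apply_list \<Phi>1 xs @ \<phi> a # apply_list \<Phi>2 ys"
    by (rule apply_list_split[of \<Phi> xs ys]) (use assms(2) m in auto)
  then have "linear_on V \<phi>" using assms(1) by simp
  then show "linear_on V (\<lambda>a. prod_list (apply_list \<Phi> (xs @ a # ys)))"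
    unfolding *(2) by (auto simp: linear_on_def scaleQ_rat_def algebra_simps)
qed

lemma multilinear_on_tensor_apply_list:
  assumes "\<And>f. f \<in> set \<Phi> \<Longrightarrow> linear_on V f" "length \<Phi> = m"
  shows "multilinear_on V m (\<lambda>xs. tensor (apply_list \<Phi> xs))"
  unfolding multilinear_on_def
proof (intro ballI impI)
  fix xs ys :: "'a list" assume m: "Suc (length xs + length ys) = m"
  obtain \<Phi>1 \<phi> \<Phi>2 where *: "\<Phi> = \<Phi>1 @ \<phi> # \<Phi>2"
    "\<And>a. apply_list \<Phi> (xs @ a # ys) = apply_list \<Phi>1 xs @ \<phi> a # apply_list \<Phi>2 ys"
    by (rule apply_list_split[of \<Phi> xs ys]) (use assms(2) m in auto)
  then have "linear_on V \<phi>" using assms(1) by simp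
  then show "linear_on V (\<lambda>a. tensor (apply_list \<Phi> (xs @ a # ys)))"
    unfolding *(2) by (auto simp: linear_on_def tensor_add tensor_scale)
qed

lemma tensor_power_eqI:
  assumes "linear_map f" "linear_map g" "\<And>xs. xs \<in> lists V \<Longrightarrow> length xs = m \<Longrightarrow> f (tensor xs) = g (tensor xs)"
    and "t \<in> tensor_power V m"
  shows "f t = g t"
  by (rule linear_on_eq_span[OF linear_map_imp_linear_on linear_map_imp_linear_on _ assms(4)[unfolded tensor_power_def]])
    (use assms(1-3) in auto)

context gcoalg
begin

lemma multilinear_on_comult_hd:
  "multilinear_on (total_space H) (Suc m) (\<lambda>xs. comult H (hd xs) \<otimes>\<^sub>T tensor (tl xs))"
  unfolding multilinear_on_def
proof (intro ballI impI)
  fix xs ys assume "xs \<in> lists (total_space H)" "ys \<in> lists (total_space H)"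
  show "linear_on (total_space H) (\<lambda>a. comult H (hd (xs @ a # ys)) \<otimes>\<^sub>T tensor (tl (xs @ a # ys)))"
    by (cases xs)
      (auto simp: linear_on_def linear_on_add[OF linear_on_comult] tensor_add tensor_scale
        linear_on_scale[OF linear_on_comult] linear_map_add[OF linear_map_tensor_mult_left]
        linear_map_add[OF linear_map_tensor_mult_right] linear_map_scale[OF linear_map_tensor_mult_left]
        linear_map_scale[OF linear_map_tensor_mult_right])
qed

lemma iterated_comult_in_tensor_power:
  assumes "h \<in> total_space H"
  shows "iterated_comult H m h \<in> tensor_power (total_space H) m"
proof (cases m)
  case 0
  then show ?thesis
    by (simp add: tensor_power_def) (rule rat_vector.span_scale, rule rat_vector.span_base, auto)
next
  case (Suc m')
  have "iterated_comult H (Suc k) h \<in> tensor_power (total_space H) (Suc k)" for k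
  proof (induction k)
    case 0
    then show ?case using assms by (auto simp: tensor_power_def intro!: rat_vector.span_base)
  next
    case (Suc k)
    let ?L = "tensor_lift (total_space H) (Suc k) (\<lambda>xs. comult H (hd xs) \<otimes>\<^sub>T tensor (tl xs))"
    have L: "linear_map ?L"
      by (rule linear_map_tensor_lift[OF subspace_total_space multilinear_on_comult_hd])
    have "?L t \<in> tensor_power (total_space H) (Suc (Suc k))" if "t \<in> tensor_power (total_space H) (Suc k)" for t
      using that[unfolded tensor_power_def]
    proof (rule linear_on_span_image[OF linear_map_imp_linear_on[OF L], rotated 2])
      fix t assume "t \<in> tensor ` {xs \<in> lists (total_space H). length xs = Suc k}"
      then obtain ys where ys: "t = tensor ys" "ys \<in> lists (total_space H)" "length ys = Suc k" by blast
      then obtain x xs where xs: "t = tensor (x # xs)" "x \<in> total_space H" "xs \<in> lists (total_space H)" "length xs = k"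
        by (cases ys) auto
      have "?L t = comult H x \<otimes>\<^sub>T tensor xs"
        using xs tensor_lift_tensor[OF subspace_total_space multilinear_on_comult_hd, of "x # xs"] by simp
      also obtain ps where ps: "comult H x = (\<Sum>(a, b)\<leftarrow>ps. tensor [a, b])" "set ps \<subseteq> total_space H \<times> total_space H"
        by (rule comult_repr[OF xs(2)]) blast
      have "comult H x \<otimes>\<^sub>T tensor xs = (\<Sum>p\<leftarrow>ps. (case p of (a, b) \<Rightarrow> tensor [a, b]) \<otimes>\<^sub>T tensor xs)"
        unfolding ps(1) by (rule linear_map_sum_list[OF linear_map_tensor_mult_left])
      also have "\<dots> \<in> tensor_power (total_space H) (Suc (Suc k))"
        unfolding tensor_power_def
        by (rule sum_list_in_subspace)
          (use xs in \<open>auto simp: tensor_mult_tensor intro!: rat_vector.span_base imageI dest!: subsetD[OF ps(2)]\<close>)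
      finally show "?L t \<in> tensor_power (total_space H) (Suc (Suc k))" .
    qed (simp add: tensor_power_def)
    with Suc show ?case by simp
  qed
  with Suc show ?thesis by simp
qed

lemma linear_on_convolve_list:
  assumes "\<And>\<phi>. \<phi> \<in> set \<Phi> \<Longrightarrow> linear_on (total_space H) \<phi>"
  shows "linear_on (total_space H) (convolve_list H \<Phi>)"
  using assms by (induction \<Phi>) (auto intro: linear_on_convolve linear_on_counit)

text \<open>\<open>iterated_comult\<close> always splits the first tensor factor. Evaluating \<phi>
  and \<psi> on the two halves amounts to evaluating their convolution before the split, so the list
  of functionals shortens by one, and associativity of convolution restores the original
  bracketing.\<close>

lemma iterated_comult_functionals:
  assumes "\<And>\<phi>. \<phi> \<in> set \<Phi> \<Longrightarrow> linear_on (total_space H) \<phi>" "h \<in> total_space H" "length \<Phi> = m"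
  shows "tensor_lift (total_space H) m (\<lambda>xs. prod_list (apply_list \<Phi> xs)) (iterated_comult H m h) =
    convolve_list H \<Phi> h"
  using assms
proof (induction m arbitrary: \<Phi> rule: less_induct)
  case (less m)
  let ?V = "total_space H"
  have ml: "multilinear_on ?V (length \<Phi>) (\<lambda>xs. prod_list (apply_list \<Phi> xs) :: rat)"
    if "\<And>\<phi>. \<phi> \<in> set \<Phi> \<Longrightarrow> linear_on ?V \<phi>" for \<Phi>
    by (rule multilinear_on_prod_list) (use that in auto)
  note L = linear_map_tensor_lift[OF subspace_total_space ml]
    and Lt = tensor_lift_tensor[OF subspace_total_space ml]
  consider "\<Phi> = []" | \<phi> where "\<Phi> = [\<phi>]" | \<phi> \<psi> \<Phi>' where "\<Phi> = \<phi> # \<psi> # \<Phi>'"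
    by (metis neq_Nil_conv)
  then show ?case
  proof cases
    case 1
    then show ?thesis using less.prems L[of \<Phi>] Lt[of \<Phi> "[]"]
      by (simp add: linear_map_scale scaleQ_rat_def)
  next
    case (2 \<phi>)
    then show ?thesis using less.prems Lt[of \<Phi> "[h]"]
      by (auto simp: convolve_counit_right)
  next
    case (3 \<phi> \<psi> \<Phi>')
    let ?\<Phi> = "convolve H (*) \<phi> \<psi> # \<Phi>'"
    let ?L = "tensor_lift ?V m (\<lambda>xs. prod_list (apply_list \<Phi> xs) :: rat)"
    let ?D = "tensor_lift ?V (length ?\<Phi>) (\<lambda>xs. comult H (hd xs) \<otimes>\<^sub>T tensor (tl xs))"
    have lin: "linear_on ?V \<phi>" "linear_on ?V \<psi>" "\<And>f. f \<in> set ?\<Phi> \<Longrightarrow> linear_on ?V f"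
      using less.prems(1) 3 by (auto intro: linear_on_convolve)
    have m: "m = Suc (length ?\<Phi>)" using less.prems(3) 3 by simp
    have D: "linear_map ?D"
      using linear_map_tensor_lift[OF subspace_total_space multilinear_on_comult_hd] by simp
    have LL: "linear_map ?L" using L[of \<Phi>] less.prems by simp
    have "?L (?D t) = tensor_lift ?V (length ?\<Phi>) (\<lambda>xs. prod_list (apply_list ?\<Phi> xs)) t"
      if t: "t \<in> tensor_power ?V (length ?\<Phi>)" for t
    proof (rule tensor_power_eqI[OF _ L[of ?\<Phi>] _ t])
      show "linear_map (\<lambda>t. ?L (?D t))"
        using Vector_Spaces.linear_compose[OF D LL] by (simp add: o_def)
      fix ys assume ys: "ys \<in> lists ?V" "length ys = length ?\<Phi>"
      then obtain x xs where xs: "ys = x # xs" "x \<in> ?V" "xs \<in> lists ?V" "length xs = length \<Phi>'"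
        by (cases ys) auto
      have "?D (tensor ys) = comult H x \<otimes>\<^sub>T tensor xs"
        using xs tensor_lift_tensor[OF subspace_total_space multilinear_on_comult_hd, of "x # xs"] by simp
      also obtain ps where ps: "comult H x = (\<Sum>(a, b)\<leftarrow>ps. tensor [a, b])" "set ps \<subseteq> total_space H \<times> total_space H"
        by (rule comult_repr[OF xs(2)]) blast
      have "comult H x \<otimes>\<^sub>T tensor xs = (\<Sum>p\<leftarrow>ps. (case p of (a, b) \<Rightarrow> tensor [a, b]) \<otimes>\<^sub>T tensor xs)"
        unfolding ps(1) by (rule linear_map_sum_list[OF linear_map_tensor_mult_left])
      finally have "?L (?D (tensor ys)) = (\<Sum>p\<leftarrow>ps. ?L ((case p of (a, b) \<Rightarrow> tensor [a, b]) \<otimes>\<^sub>T tensor xs))"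
        by (simp only: linear_map_sum_list[OF LL])
      also have "\<dots> = (\<Sum>(a, b)\<leftarrow>ps. \<phi> a * \<psi> b * prod_list (apply_list \<Phi>' xs))"
      proof (rule arg_cong[where f = sum_list], rule map_cong[OF refl])
        fix p assume "p \<in> set ps"
        then obtain a b where ab: "p = (a, b)" "a \<in> ?V" "b \<in> ?V" using ps(2) by auto
        have "?L (tensor (a # b # xs)) = \<phi> a * \<psi> b * prod_list (apply_list \<Phi>' xs)"
          using Lt[of \<Phi> "a # b # xs"] less.prems xs ab 3 m by simp
        then show "?L ((case p of (a, b) \<Rightarrow> tensor [a, b]) \<otimes>\<^sub>T tensor xs) =
          (case p of (a, b) \<Rightarrow> \<phi> a * \<psi> b * prod_list (apply_list \<Phi>' xs))"
          by (simp add: ab tensor_mult_tensor)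
      qed
      also have "\<dots> = convolve H (*) \<phi> \<psi> x * prod_list (apply_list \<Phi>' xs)"
        unfolding convolve_def sweedler_repr[OF bilinear_on_mult[OF lin(1,2)] ps]
        by (induction ps) (auto simp: algebra_simps)
      also have "\<dots> = tensor_lift ?V (length ?\<Phi>) (\<lambda>xs. prod_list (apply_list ?\<Phi> xs)) (tensor ys)"
        using Lt[of ?\<Phi> ys] lin(3) ys by (simp add: xs(1))
      finally show "?L (?D (tensor ys)) =
        tensor_lift ?V (length ?\<Phi>) (\<lambda>xs. prod_list (apply_list ?\<Phi> xs)) (tensor ys)" .
    qed (use lin(3) in auto)
    from this[OF iterated_comult_in_tensor_power[OF less.prems(2)]]
    have "?L (iterated_comult H m h) =
      tensor_lift ?V (length ?\<Phi>) (\<lambda>xs. prod_list (apply_list ?\<Phi> xs)) (iterated_comult H (length ?\<Phi>) h)"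
      by (simp add: m)
    also have "\<dots> = convolve_list H ?\<Phi> h"
      by (rule less.IH) (use m lin(3) less.prems(2) in auto)
    also have "\<dots> = convolve_list H \<Phi> h"
      using convolve_assoc[OF algebra_on_rat, of \<phi> \<psi> "convolve_list H \<Phi>'" h] lin less.prems(2)
      by (simp add: 3 linear_into_UNIV linear_on_convolve_list)
    finally show ?thesis .
  qed
qed

lemma linear_on_functional_part:
  assumes "linear_on (total_space H) \<phi>"
  shows "linear_on (total_space H) (\<lambda>h. \<phi> (homogeneous_part H n h))"
  by (rule linear_on_compose[OF linear_on_homogeneous_part assms homogeneous_part_in_total_space])

lemma linear_on_word_functional:
  assumes "linear_on (total_space H) \<phi>"
  shows "linear_on (total_space H) (word_functional H \<phi> I)"
  unfolding word_functional_def
  by (rule linear_on_convolve_list) (use linear_on_functional_part[OF assms] in auto)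

text \<open>Projecting every tensor factor to its degree and then applying \<phi> is a single
  multilinear operation, so the two lifts compose to the lift of the functionals \<phi> \<circ>
  \<open>homogeneous_part H n\<close>, to which \<open>iterated_comult_functionals\<close>
  applies.\<close>

lemma functional_component_eq_word_functional:
  assumes \<phi>: "linear_on (total_space H) \<phi>" and h: "h \<in> total_space H"
  shows "functional_component H \<phi> I h = word_functional H \<phi> I h"
proof -
  let ?V = "total_space H" and ?m = "length I"
  let ?\<Phi> = "map (\<lambda>n h. \<phi> (homogeneous_part H n h)) I" and ?\<Pi> = "map (homogeneous_part H) I"
  have 1: "multilinear_on ?V ?m (\<lambda>xs. prod_list (map \<phi> xs))"
    by (auto simp: multilinear_on_def linear_on_def linear_on_add[OF \<phi>] linear_on_scale[OF \<phi>]
        scaleQ_rat_def algebra_simps)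
  have map2: "map2 (homogeneous_part H) I xs = apply_list ?\<Pi> xs" for xs
    by (simp add: zip_map1 split_def)
  have 2: "multilinear_on ?V ?m (\<lambda>xs. tensor (map2 (homogeneous_part H) I xs))"
    unfolding map2
    by (rule multilinear_on_tensor_apply_list) (use linear_on_homogeneous_part in auto)
  have 3: "multilinear_on ?V ?m (\<lambda>xs. prod_list (apply_list ?\<Phi> xs))"
    by (rule multilinear_on_prod_list) (use linear_on_functional_part[OF \<phi>] in auto)
  let ?L1 = "tensor_lift ?V ?m (\<lambda>xs. prod_list (map \<phi> xs))"
  let ?L2 = "tensor_lift ?V ?m (\<lambda>xs. tensor (map2 (homogeneous_part H) I xs))"
  let ?L3 = "tensor_lift ?V ?m (\<lambda>xs. prod_list (apply_list ?\<Phi> xs))"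
  have "?L1 (?L2 t) = ?L3 t" if t: "t \<in> tensor_power ?V ?m" for t
  proof (rule tensor_power_eqI[OF _ linear_map_tensor_lift[OF subspace_total_space 3] _ t])
    show "linear_map (\<lambda>t. ?L1 (?L2 t))"
      using Vector_Spaces.linear_compose[OF linear_map_tensor_lift[OF subspace_total_space 2]
          linear_map_tensor_lift[OF subspace_total_space 1]] by (simp add: o_def)
    fix xs assume xs: "xs \<in> lists ?V" "length xs = ?m"
    have "map2 (homogeneous_part H) I xs \<in> lists ?V"
      using xs(1) by (auto simp: in_lists_conv_set dest!: set_zip_rightD intro!: homogeneous_part_in_total_space)
    then have "?L1 (?L2 (tensor xs)) = prod_list (map \<phi> (map2 (homogeneous_part H) I xs))"
      using tensor_lift_tensor[OF subspace_total_space 1] tensor_lift_tensor[OF subspace_total_space 2] xs by simp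
    also have "map \<phi> (map2 (homogeneous_part H) I xs) = apply_list ?\<Phi> xs"
      by (simp add: zip_map1 split_def)
    also have "prod_list \<dots> = ?L3 (tensor xs)"
      using tensor_lift_tensor[OF subspace_total_space 3] xs by simp
    finally show "?L1 (?L2 (tensor xs)) = ?L3 (tensor xs)" .
  qed
  from this[OF iterated_comult_in_tensor_power[OF h]] show ?thesis
    unfolding functional_component_def word_functional_def
    using iterated_comult_functionals[of ?\<Phi> h ?m] h linear_on_functional_part[OF \<phi>] by auto
qed

end

section \<open>Bialgebras and antipodes\<close>

lemma multilinear_on_4:
  assumes M: "bilinear_on V M"
  shows "multilinear_on V 4 (\<lambda>xs. tensor [M (xs ! 0) (xs ! 2), M (xs ! 1) (xs ! 3)])"
  unfolding multilinear_on_def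
proof (intro ballI impI)
  fix xs ys assume xs: "xs \<in> lists V" "ys \<in> lists V" "Suc (length xs + length ys) = 4"
  then consider "length xs = 0" "length ys = Suc (Suc (Suc 0))" | "length xs = Suc 0" "length ys = Suc (Suc 0)"
    | "length xs = Suc (Suc 0)" "length ys = Suc 0" | "length xs = Suc (Suc (Suc 0))" "length ys = 0" by linarith
  then show "linear_on V (\<lambda>a. tensor [M ((xs @ a # ys) ! 0) ((xs @ a # ys) ! 2),
    M ((xs @ a # ys) ! 1) ((xs @ a # ys) ! 3)])"
    using xs(1,2) M
    by cases (auto simp: length_Suc_conv bilinear_on_def linear_on_def tensor2_simps numeral_3_eq_3)
qed

lemma sum_list_concat_map: "(\<Sum>x\<leftarrow>concat (map f ps). g x) = (\<Sum>p\<leftarrow>ps. \<Sum>x\<leftarrow>f p. g x)"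
  for g :: "'a \<Rightarrow> 'b::comm_monoid_add"
  by (induction ps) auto

text \<open>Translates the product of the tensor square, encoded on the fourth tensor power, into a
  list of products of pairs. The coproduct of a product thereby gets a list representation as
  well.\<close>

lemma tensor_lift_4_sum_list:
  assumes V: "rat_vector.subspace V" and M: "bilinear_on V M" and ps: "set ps \<subseteq> V \<times> V" and qs: "set qs \<subseteq> V \<times> V"
  shows "tensor_lift V 4 (\<lambda>xs. tensor [M (xs ! 0) (xs ! 2), M (xs ! 1) (xs ! 3)])
      ((\<Sum>(a, b)\<leftarrow>ps. tensor [a, b]) \<otimes>\<^sub>T (\<Sum>(a, b)\<leftarrow>qs. tensor [a, b])) =
    (\<Sum>(a, b)\<leftarrow>concat (map (\<lambda>(a1, a2). map (\<lambda>(b1, b2). (M a1 b1, M a2 b2)) qs) ps). tensor [a, b])"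
proof -
  let ?L = "tensor_lift V 4 (\<lambda>xs. tensor [M (xs ! 0) (xs ! 2), M (xs ! 1) (xs ! 3)])"
  note ml = multilinear_on_4[OF M]
  have L: "linear_map ?L" by (rule linear_map_tensor_lift[OF V ml])
  have Lt: "?L (tensor [a1, a2] \<otimes>\<^sub>T tensor [b1, b2]) = tensor [M a1 b1, M a2 b2]"
    if "a1 \<in> V" "a2 \<in> V" "b1 \<in> V" "b2 \<in> V" for a1 a2 b1 b2
    unfolding tensor_mult_tensor
    by (subst tensor_lift_tensor[OF V ml]) (use that in \<open>auto simp: numeral_3_eq_3\<close>)
  have "(\<Sum>(a, b)\<leftarrow>ps. tensor [a, b]) \<otimes>\<^sub>T (\<Sum>(a, b)\<leftarrow>qs. tensor [a, b]) =
    (\<Sum>p\<leftarrow>ps. (case p of (a1, a2) \<Rightarrow> tensor [a1, a2]) \<otimes>\<^sub>T (\<Sum>(a, b)\<leftarrow>qs. tensor [a, b]))"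
    by (rule linear_map_sum_list[OF linear_map_tensor_mult_left])
  also have "\<dots> = (\<Sum>p\<leftarrow>ps. \<Sum>q\<leftarrow>qs. (case p of (a1, a2) \<Rightarrow> tensor [a1, a2]) \<otimes>\<^sub>T (case q of (b1, b2) \<Rightarrow> tensor [b1, b2]))"
    by (simp only: linear_map_sum_list[OF linear_map_tensor_mult_right])
  also have "?L \<dots> = (\<Sum>p\<leftarrow>ps. \<Sum>q\<leftarrow>qs. ?L ((case p of (a1, a2) \<Rightarrow> tensor [a1, a2]) \<otimes>\<^sub>T (case q of (b1, b2) \<Rightarrow> tensor [b1, b2])))"
    by (simp only: linear_map_sum_list[OF L])
  also have "\<dots> = (\<Sum>p\<leftarrow>ps. \<Sum>q\<leftarrow>qs. tensor [M (fst p) (fst q), M (snd p) (snd q)])"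
    by (intro arg_cong[where f = sum_list] map_cong refl)
      (use ps qs in \<open>auto simp: split_def intro!: Lt[simplified] dest!: subsetD\<close>)
  finally show ?thesis
    by (simp add: sum_list_concat_map split_def comp_def)
qed

locale gbialg =
  fixes H :: "('h::rat_vector, 'l::finite) bialg"
  assumes graded_bialgebra: "graded_bialgebra H"

sublocale gbialg \<subseteq> gcoalg
  by standard (use graded_bialgebra in \<open>simp add: graded_bialgebra_def\<close>)

context gbialg
begin

lemma graded_algebra: "graded_algebra H"
  using graded_bialgebra by (simp add: graded_bialgebra_def)

lemma bilinear_on_hmult: "bilinear_on (total_space H) (hmult H)"
  using graded_algebra by (simp add: graded_algebra_def bilinear_on_def)

lemma hmult_component: "a \<in> component H p \<Longrightarrow> b \<in> component H q \<Longrightarrow> hmult H a b \<in> component H (p + q)"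
  using graded_algebra by (simp add: graded_algebra_def)

lemma hunit_component: "hunit H \<in> component H 0"
  using graded_algebra by (simp add: graded_algebra_def)

lemma hunit_in: "hunit H \<in> total_space H"
  using hunit_component component_subset_total_space by blast

lemma hmult_hunit:
  assumes "a \<in> total_space H"
  shows "hmult H (hunit H) a = a" "hmult H a (hunit H) = a"
  using graded_algebra assms by (simp_all add: graded_algebra_def)

lemma hmult_in:
  assumes "a \<in> total_space H" "b \<in> total_space H"
  shows "hmult H a b \<in> total_space H"
proof (rule total_space_imageI[OF _ subspace_total_space _ assms(1)])
  show "linear_on (total_space H) (\<lambda>a. hmult H a b)"
    using bilinear_on_hmult assms(2) by (simp add: bilinear_on_def)
  fix p x assume x: "x \<in> component H p"
  show "hmult H x b \<in> total_space H"
  proof (rule total_space_imageI[OF _ subspace_total_space _ assms(2)])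
    show "linear_on (total_space H) (hmult H x)"
      using bilinear_on_hmult x component_subset_total_space[of H p] by (auto simp: bilinear_on_def)
    fix q y assume "y \<in> component H q"
    then show "hmult H x y \<in> total_space H"
      using hmult_component[OF x] component_subset_total_space by blast
  qed
qed

lemma algebra_on_hmult: "algebra_on (total_space H) (hmult H)"
  using graded_algebra hmult_in bilinear_on_hmult
  by (auto simp: algebra_on_def graded_algebra_def subspace_total_space)

lemma counit_hmult: "a \<in> total_space H \<Longrightarrow> b \<in> total_space H \<Longrightarrow> counit H (hmult H a b) = counit H a * counit H b"
  and counit_hunit: "counit H (hunit H) = 1"
  and comult_hunit: "comult H (hunit H) = tensor [hunit H, hunit H]"
  using graded_bialgebra by (simp_all add: graded_bialgebra_def)

lemma comult_hmult_repr:
  assumes a: "comult H a = (\<Sum>(a, b)\<leftarrow>ps. tensor [a, b])" "set ps \<subseteq> total_space H \<times> total_space H" "a \<in> total_space H"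
    and b: "comult H b = (\<Sum>(a, b)\<leftarrow>qs. tensor [a, b])" "set qs \<subseteq> total_space H \<times> total_space H" "b \<in> total_space H"
  shows "comult H (hmult H a b) =
    (\<Sum>(a, b)\<leftarrow>concat (map (\<lambda>(a1, a2). map (\<lambda>(b1, b2). (hmult H a1 b1, hmult H a2 b2)) qs) ps). tensor [a, b])"
proof -
  have "comult H (hmult H a b) =
    tensor_lift (total_space H) 4 (\<lambda>xs. tensor [hmult H (xs ! 0) (xs ! 2), hmult H (xs ! 1) (xs ! 3)])
      (comult H a \<otimes>\<^sub>T comult H b)"
    using graded_bialgebra a(3) b(3) unfolding graded_bialgebra_def by blast
  then show ?thesis
    unfolding a(1) b(1) by (simp only: tensor_lift_4_sum_list[OF subspace_total_space bilinear_on_hmult a(2) b(2)])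
qed

lemma is_antipode_iff:
  "is_antipode H S \<longleftrightarrow> linear_into (total_space H) (total_space H) S \<and>
    (\<forall>h\<in>total_space H. convolve H (hmult H) S (\<lambda>x. x) h = counit H h *\<^sub>Q hunit H \<and>
      convolve H (hmult H) (\<lambda>x. x) S h = counit H h *\<^sub>Q hunit H)"
  unfolding is_antipode_def convolve_def sweedler_def linear_into_def by simp

lemma linear_into_unit: "linear_into (total_space H) (total_space H) (\<lambda>h. counit H h *\<^sub>Q hunit H)"
  by (auto simp: linear_into_def linear_on_def linear_on_add[OF linear_on_counit] scaleQ_add_left
      linear_on_scale[OF linear_on_counit] scaleQ_rat_def scaleQ_scaleQ
      intro: rat_vector.subspace_scale[OF subspace_total_space] hunit_in)

end

lemma weight_add: "weight (p + q) = weight p + weight q"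
  by (simp add: weight_def sum.distrib)

lemma weight_eq_0_iff: "weight p = 0 \<longleftrightarrow> p = 0"
  by (auto simp: weight_def vec_eq_iff)

section \<open>The antipode of a connected graded bialgebra\<close>

locale gbialg_connected = gbialg H for H :: "('h::rat_vector, 'l::finite) bialg" +
  assumes connected: "component H 0 = rat_vector.span {hunit H}"
begin

text \<open>The projection onto the augmentation ideal along the unit. By connectedness it is 0 in
  degree 0, and it is the identity in all other degrees. The identity map is the convolution unit
  plus \<open>aug\<close>, hence its inverse is a geometric series.\<close>

definition aug :: "'h \<Rightarrow> 'h" where "aug h = h - counit H h *\<^sub>Q hunit H"

fun aug_power :: "nat \<Rightarrow> 'h \<Rightarrow> 'h" where
  "aug_power 0 = (\<lambda>h. counit H h *\<^sub>Q hunit H)"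
| "aug_power (Suc k) = convolve H (hmult H) aug (aug_power k)"

lemma linear_into_aug: "linear_into (total_space H) (total_space H) aug"
  by (auto simp: aug_def linear_into_def linear_on_def linear_on_add[OF linear_on_counit] scaleQ_add_left
      linear_on_scale[OF linear_on_counit] scaleQ_rat_def scaleQ_scaleQ rat_vector.scale_right_diff_distrib
      intro!: rat_vector.subspace_diff rat_vector.subspace_scale[OF subspace_total_space] hunit_in subspace_total_space)

lemma linear_into_aug_power: "linear_into (total_space H) (total_space H) (aug_power k)"
  by (induction k) (auto intro: linear_into_unit linear_into_convolve[OF algebra_on_hmult linear_into_aug])

text \<open>The powers are built by convolving on the left; the left antipode identity produces the
  new factor on the right.\<close>

lemma aug_power_Suc_right:
  "h \<in> total_space H \<Longrightarrow> aug_power (Suc k) h = convolve H (hmult H) (aug_power k) aug h"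
proof (induction k arbitrary: h)
  case 0
  then show ?case
    using convolve_unit_left[OF algebra_on_hmult linear_into_aug hunit_in hmult_hunit(1)]
      convolve_unit_right[OF algebra_on_hmult linear_into_aug hunit_in hmult_hunit(2)] by simp
next
  case (Suc k)
  have "aug_power (Suc (Suc k)) h = convolve H (hmult H) aug (convolve H (hmult H) (aug_power k) aug) h"
    unfolding aug_power.simps(2)[of "Suc k"] by (rule convolve_cong[OF refl Suc.IH])
  also have "\<dots> = convolve H (hmult H) (aug_power (Suc k)) aug h"
    using convolve_assoc[OF algebra_on_hmult linear_into_aug linear_into_aug_power linear_into_aug Suc.prems] by simp
  finally show ?case .
qed

lemma aug_component_0: "h \<in> component H 0 \<Longrightarrow> aug h = 0"
  using connected
  by (auto simp: aug_def rat_vector.span_singleton linear_on_scale[OF linear_on_counit hunit_in]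
      counit_hunit scaleQ_rat_def)

lemma aug_component: "h \<in> component H n \<Longrightarrow> aug h \<in> component H n"
  by (cases "n = 0")
    (simp_all add: aug_component_0 rat_vector.subspace_0[OF subspace_component], simp add: aug_def counit_component)

lemma bilinear_on_hmult_compose:
  assumes "linear_into (total_space H) (total_space H) f" "linear_into (total_space H) (total_space H) g"
  shows "bilinear_on (total_space H) (\<lambda>a b. hmult H (f a) (g b))"
  by (rule bilinear_on_compose[OF bilinear_on_hmult assms])

lemma aug_power_component: "h \<in> component H n \<Longrightarrow> aug_power k h \<in> component H n"
proof (induction k arbitrary: h n)
  case 0
  then show ?case
    by (cases "n = 0")
      (auto simp: counit_component rat_vector.subspace_0[OF subspace_component]
        intro: rat_vector.subspace_scale[OF subspace_component] hunit_component)
next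
  case (Suc k)
  show ?case unfolding aug_power.simps convolve_def
    by (rule sweedler_in_graded[OF bilinear_on_hmult_compose[OF linear_into_aug linear_into_aug_power]
          subspace_component Suc.prems])
      (use Suc.IH aug_component hmult_component in fastforce)
qed

text \<open>Each factor \<open>aug\<close> kills degree 0 and so consumes weight at least 1 of the
  argument; more than \<open>weight n\<close> factors cannot all be fed.\<close>

lemma aug_power_vanish: "h \<in> component H n \<Longrightarrow> weight n < k \<Longrightarrow> aug_power k h = 0"
proof (induction k arbitrary: h n)
  case (Suc k)
  have "aug_power (Suc k) h \<in> {0}" unfolding aug_power.simps convolve_def
  proof (rule sweedler_in_graded[OF bilinear_on_hmult_compose[OF linear_into_aug linear_into_aug_power]
          _ Suc.prems(1)])
    fix a b p q assume ab: "a \<in> component H p" "b \<in> component H q" "p + q = n"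
    then have V: "a \<in> total_space H" "b \<in> total_space H" using component_subset_total_space by blast+
    show "hmult H (aug a) (aug_power k b) \<in> {0}"
    proof (cases "p = 0")
      case True
      then have "aug a = 0" using ab aug_component_0 by simp
      moreover have "linear_on (total_space H) (\<lambda>x. hmult H x (aug_power k b))"
        using bilinear_on_hmult linear_into_aug_power[of k] V by (auto simp: bilinear_on_def linear_into_def)
      ultimately show ?thesis using linear_on_0[OF _ subspace_total_space] by auto
    next
      case False
      then have "weight q < weight n" using ab(3) weight_add[of p q] weight_eq_0_iff[of p] by auto
      then have "aug_power k b = 0" using Suc ab by simp
      moreover have "linear_on (total_space H) (hmult H (aug a))"
        using bilinear_on_hmult linear_into_aug V by (auto simp: bilinear_on_def linear_into_def)
      ultimately show ?thesis using linear_on_0[OF _ subspace_total_space] by auto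
    qed
  qed simp
  then show ?case by simp
qed simp

definition geometric :: "nat \<Rightarrow> 'h \<Rightarrow> 'h" where
  "geometric N h = (\<Sum>k\<le>N. (-1) ^ k *\<^sub>Q aug_power k h)"

lemma linear_into_geometric: "linear_into (total_space H) (total_space H) (geometric N)"
proof -
  have "linear_on (total_space H) (\<lambda>h. (-1) ^ k *\<^sub>Q aug_power k h)" for k
    using linear_into_aug_power[of k]
    by (auto simp: linear_into_def linear_on_def scaleQ_add_right scaleQ_scaleQ mult.commute)
  then show ?thesis unfolding geometric_def linear_into_def using linear_into_aug_power
    by (auto simp: linear_into_def intro!: linear_on_sum_fun rat_vector.subspace_sum[OF subspace_total_space]
        rat_vector.subspace_scale[OF subspace_total_space])
qed

text \<open>One truncation at \<open>N\<close> therefore serves all tensor factors of weight at most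
  \<open>N\<close> in a coproduct, whatever their individual degrees.\<close>

lemma geometric_stable:
  assumes "h \<in> component H n" "weight n \<le> N"
  shows "geometric N h = geometric (weight n) h"
  unfolding geometric_def
  by (rule sum.mono_neutral_right) (use assms in \<open>auto simp: aug_power_vanish[OF assms(1)]\<close>)

text \<open>This is (1 + x)(1 - x + ... ) = 1 for x = \<open>aug\<close> in the convolution algebra,
  where the telescoping remainder, plus or minus the power \<open>N + 1\<close> of x, vanishes in
  the degree considered.\<close>

lemma geometric_telescope:
  assumes "h \<in> component H n" "weight n \<le> N"
  shows "(\<Sum>k\<le>N. (-1) ^ k *\<^sub>Q aug_power (Suc k) h) + geometric N h = aug_power 0 h"
proof -
  have "(\<Sum>k\<le>N. (-1) ^ k *\<^sub>Q aug_power (Suc k) h) + geometric N h =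
    aug_power 0 h + (-1) ^ N *\<^sub>Q aug_power (Suc N) h"
    unfolding geometric_def by (induction N) (simp_all add: algebra_simps del: aug_power.simps)
  then show ?thesis using aug_power_vanish[OF assms(1), of "Suc N"] assms(2) by (simp del: aug_power.simps)
qed

definition antipode :: "'h \<Rightarrow> 'h" where
  "antipode h = (\<Sum>n\<in>Poly_Mapping.keys (homogeneous_parts H h). geometric (weight n) (homogeneous_part H n h))"

lemma antipode_component: "h \<in> component H n \<Longrightarrow> antipode h = geometric (weight n) h"
  unfolding antipode_def
  by (rule componentwise_component) (use linear_into_geometric in \<open>auto simp: linear_into_def\<close>)

lemma antipode_graded: "h \<in> component H n \<Longrightarrow> antipode h \<in> component H n"
  by (simp add: antipode_component geometric_def aug_power_component
      rat_vector.subspace_sum[OF subspace_component] rat_vector.subspace_scale[OF subspace_component])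

lemma linear_into_antipode: "linear_into (total_space H) (total_space H) antipode"
proof -
  have "linear_on (total_space H) antipode"
    unfolding antipode_def
    by (rule linear_on_componentwise) (use linear_into_geometric in \<open>auto simp: linear_into_def\<close>)
  moreover from this have "antipode h \<in> total_space H" if "h \<in> total_space H" for h
    by (rule total_space_imageI[OF _ subspace_total_space _ that])
      (use antipode_graded component_subset_total_space in blast)
  ultimately show ?thesis by (auto simp: linear_into_def)
qed

text \<open>Write the second tensor factor as \<open>aug b\<close> plus its counit part. The first
  piece raises every power in the series by one, the second reproduces the series by the counit
  axiom, and the sum telescopes.\<close>

lemma convolve_antipode_left:
  assumes h: "h \<in> component H n"
  shows "convolve H (hmult H) antipode (\<lambda>x. x) h = aug_power 0 h"
proof -
  let ?V = "total_space H" and ?N = "weight n"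
  have hV: "h \<in> ?V" using h component_subset_total_space by blast
  have lin: "linear_on ?V (\<lambda>y. hmult H y x)" "linear_on ?V (hmult H x)" if "x \<in> ?V" for x
    using bilinear_on_hmult that by (auto simp: bilinear_on_def)
  have into: "aug x \<in> ?V" "aug_power k x \<in> ?V" "geometric N x \<in> ?V" if "x \<in> ?V" for x k N
    using linear_into_aug linear_into_aug_power[of k] linear_into_geometric[of N] that by (auto simp: linear_into_def)
  have bil: "bilinear_on ?V (\<lambda>a b. (-1) ^ k *\<^sub>Q hmult H (aug_power k a) (aug b))" for k
    using bilinear_on_linear[OF bilinear_on_hmult_compose[OF linear_into_aug_power linear_into_aug],
        of UNIV "\<lambda>x. (-1) ^ k *\<^sub>Q x"] by (simp add: linear_on_def scaleQ_add_right scaleQ_scaleQ mult.commute)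
  \<comment> \<open>Every left tensor factor weighs at most as much as \<open>h\<close>, so
    truncation at \<open>weight n\<close> computes the antipode on all of them at once.\<close>
  have "convolve H (hmult H) antipode (\<lambda>x. x) h = convolve H (hmult H) (geometric ?N) (\<lambda>x. x) h"
    unfolding convolve_def
    by (rule sweedler_cong_graded[OF bilinear_on_hmult_compose[OF linear_into_antipode linear_into_id]
          bilinear_on_hmult_compose[OF linear_into_geometric linear_into_id] h])
      (metis antipode_component geometric_stable weight_add le_add1)
  also have "\<dots> = sweedler H (\<lambda>a b. (\<Sum>k\<le>?N. (-1) ^ k *\<^sub>Q hmult H (aug_power k a) (aug b)) + counit H b *\<^sub>Q geometric ?N a) h"
    unfolding convolve_def
  proof (rule sweedler_cong)
    fix a b assume ab: "a \<in> ?V" "b \<in> ?V"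
    have "hmult H (geometric ?N a) (aug b + counit H b *\<^sub>Q hunit H) =
      hmult H (geometric ?N a) (aug b) + counit H b *\<^sub>Q geometric ?N a"
      using ab into hunit_in rat_vector.subspace_scale[OF subspace_total_space hunit_in]
      by (simp add: linear_on_add[OF lin(2)] linear_on_scale[OF lin(2)] hmult_hunit(2))
    then have "hmult H (geometric ?N a) b = hmult H (geometric ?N a) (aug b) + counit H b *\<^sub>Q geometric ?N a"
      by (simp add: aug_def)
    also have "hmult H (geometric ?N a) (aug b) = (\<Sum>k\<le>?N. hmult H ((-1) ^ k *\<^sub>Q aug_power k a) (aug b))"
      unfolding geometric_def
      by (rule linear_on_sum[OF lin(1) subspace_total_space])
        (use ab into in \<open>auto intro: rat_vector.subspace_scale[OF subspace_total_space]\<close>)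
    also have "\<dots> = (\<Sum>k\<le>?N. (-1) ^ k *\<^sub>Q hmult H (aug_power k a) (aug b))"
      by (rule sum.cong) (use ab into linear_on_scale[OF lin(1)] in auto)
    finally show "hmult H (geometric ?N a) b = 
      (\<Sum>k\<le>?N. (-1) ^ k *\<^sub>Q hmult H (aug_power k a) (aug b)) + counit H b *\<^sub>Q geometric ?N a" by simp
  qed
  also have "\<dots> = sweedler H (\<lambda>a b. \<Sum>k\<le>?N. (-1) ^ k *\<^sub>Q hmult H (aug_power k a) (aug b)) h +
      sweedler H (\<lambda>a b. counit H b *\<^sub>Q geometric ?N a) h"
    by (rule sweedler_add[OF _ _ hV])
      (use bil linear_into_geometric[of ?N] in
        \<open>auto intro!: bilinear_on_sum bilinear_on_scaleQ_right linear_on_counit simp: linear_into_def\<close>)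
  also have "\<dots> = (\<Sum>k\<le>?N. sweedler H (\<lambda>a b. (-1) ^ k *\<^sub>Q hmult H (aug_power k a) (aug b)) h) + geometric ?N h"
    using sweedler_sum[of "{..?N}" "\<lambda>k a b. (-1) ^ k *\<^sub>Q hmult H (aug_power k a) (aug b)" h] bil hV
      sweedler_counit_right[of "geometric ?N" h] linear_into_geometric[of ?N] by (simp add: linear_into_def)
  also have "(\<Sum>k\<le>?N. sweedler H (\<lambda>a b. (-1) ^ k *\<^sub>Q hmult H (aug_power k a) (aug b)) h) =
    (\<Sum>k\<le>?N. (-1) ^ k *\<^sub>Q aug_power (Suc k) h)"
    unfolding aug_power_Suc_right[OF hV] convolve_def
    by (intro sum.cong refl sweedler_linear[OF bilinear_on_hmult_compose[OF linear_into_aug_power linear_into_aug],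
          where W = UNIV, symmetric]) (auto simp: linear_on_def scaleQ_add_right scaleQ_scaleQ mult.commute hV)
  finally show ?thesis using geometric_telescope[OF h, of ?N] by (simp del: aug_power.simps)
qed

text \<open>Mirror image of the left identity: now the first tensor factor is decomposed, and the
  powers grow on the left as in their definition.\<close>

lemma convolve_antipode_right:
  assumes h: "h \<in> component H n"
  shows "convolve H (hmult H) (\<lambda>x. x) antipode h = aug_power 0 h"
proof -
  let ?V = "total_space H" and ?N = "weight n"
  have hV: "h \<in> ?V" using h component_subset_total_space by blast
  have lin: "linear_on ?V (\<lambda>y. hmult H y x)" "linear_on ?V (hmult H x)" if "x \<in> ?V" for x
    using bilinear_on_hmult that by (auto simp: bilinear_on_def)
  have into: "aug x \<in> ?V" "aug_power k x \<in> ?V" "geometric N x \<in> ?V" if "x \<in> ?V" for x k N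
    using linear_into_aug linear_into_aug_power[of k] linear_into_geometric[of N] that by (auto simp: linear_into_def)
  have bil: "bilinear_on ?V (\<lambda>a b. (-1) ^ k *\<^sub>Q hmult H (aug a) (aug_power k b))" for k
    using bilinear_on_linear[OF bilinear_on_hmult_compose[OF linear_into_aug linear_into_aug_power],
        of UNIV "\<lambda>x. (-1) ^ k *\<^sub>Q x"] by (simp add: linear_on_def scaleQ_add_right scaleQ_scaleQ mult.commute)
  have "convolve H (hmult H) (\<lambda>x. x) antipode h = convolve H (hmult H) (\<lambda>x. x) (geometric ?N) h"
    unfolding convolve_def
    by (rule sweedler_cong_graded[OF bilinear_on_hmult_compose[OF linear_into_id linear_into_antipode]
          bilinear_on_hmult_compose[OF linear_into_id linear_into_geometric] h])
      (metis antipode_component geometric_stable weight_add le_add2)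
  also have "\<dots> = sweedler H (\<lambda>a b. (\<Sum>k\<le>?N. (-1) ^ k *\<^sub>Q hmult H (aug a) (aug_power k b)) + counit H a *\<^sub>Q geometric ?N b) h"
    unfolding convolve_def
  proof (rule sweedler_cong)
    fix a b assume ab: "a \<in> ?V" "b \<in> ?V"
    have "hmult H (aug a + counit H a *\<^sub>Q hunit H) (geometric ?N b) =
      hmult H (aug a) (geometric ?N b) + counit H a *\<^sub>Q geometric ?N b"
      using ab into hunit_in rat_vector.subspace_scale[OF subspace_total_space hunit_in]
      by (simp add: linear_on_add[OF lin(1)] linear_on_scale[OF lin(1)] hmult_hunit(1))
    then have "hmult H a (geometric ?N b) = hmult H (aug a) (geometric ?N b) + counit H a *\<^sub>Q geometric ?N b"
      by (simp add: aug_def)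
    also have "hmult H (aug a) (geometric ?N b) = (\<Sum>k\<le>?N. hmult H (aug a) ((-1) ^ k *\<^sub>Q aug_power k b))"
      unfolding geometric_def
      by (rule linear_on_sum[OF lin(2) subspace_total_space])
        (use ab into in \<open>auto intro: rat_vector.subspace_scale[OF subspace_total_space]\<close>)
    also have "\<dots> = (\<Sum>k\<le>?N. (-1) ^ k *\<^sub>Q hmult H (aug a) (aug_power k b))"
      by (rule sum.cong) (use ab into linear_on_scale[OF lin(2)] in auto)
    finally show "hmult H a (geometric ?N b) = 
      (\<Sum>k\<le>?N. (-1) ^ k *\<^sub>Q hmult H (aug a) (aug_power k b)) + counit H a *\<^sub>Q geometric ?N b" by simp
  qed
  also have "\<dots> = sweedler H (\<lambda>a b. \<Sum>k\<le>?N. (-1) ^ k *\<^sub>Q hmult H (aug a) (aug_power k b)) h +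
      sweedler H (\<lambda>a b. counit H a *\<^sub>Q geometric ?N b) h"
    by (rule sweedler_add[OF _ _ hV])
      (use bil linear_into_geometric[of ?N] in
        \<open>auto intro!: bilinear_on_sum bilinear_on_scaleQ_left linear_on_counit simp: linear_into_def\<close>)
  also have "\<dots> = (\<Sum>k\<le>?N. sweedler H (\<lambda>a b. (-1) ^ k *\<^sub>Q hmult H (aug a) (aug_power k b)) h) + geometric ?N h"
    using sweedler_sum[of "{..?N}" "\<lambda>k a b. (-1) ^ k *\<^sub>Q hmult H (aug a) (aug_power k b)" h] bil hV
      sweedler_counit_left[of "geometric ?N" h] linear_into_geometric[of ?N] by (simp add: linear_into_def)
  also have "(\<Sum>k\<le>?N. sweedler H (\<lambda>a b. (-1) ^ k *\<^sub>Q hmult H (aug a) (aug_power k b)) h) =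
    (\<Sum>k\<le>?N. (-1) ^ k *\<^sub>Q aug_power (Suc k) h)"
    unfolding aug_power.simps convolve_def
    by (intro sum.cong refl sweedler_linear[OF bilinear_on_hmult_compose[OF linear_into_aug linear_into_aug_power],
          where W = UNIV, symmetric]) (auto simp: linear_on_def scaleQ_add_right scaleQ_scaleQ mult.commute hV)
  finally show ?thesis using geometric_telescope[OF h, of ?N] by (simp del: aug_power.simps)
qed

lemma is_antipode_antipode: "is_antipode H antipode"
proof -
  have unit: "linear_on (total_space H) (aug_power 0)"
    and conv: "linear_on (total_space H) (convolve H (hmult H) antipode (\<lambda>x. x))"
      "linear_on (total_space H) (convolve H (hmult H) (\<lambda>x. x) antipode)"
    using linear_into_aug_power[of 0] linear_into_convolve[OF algebra_on_hmult linear_into_antipode linear_into_id]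
      linear_into_convolve[OF algebra_on_hmult linear_into_id linear_into_antipode]
    by (auto simp: linear_into_def)
  have "convolve H (hmult H) antipode (\<lambda>x. x) h = aug_power 0 h"
    "convolve H (hmult H) (\<lambda>x. x) antipode h = aug_power 0 h" if "h \<in> total_space H" for h
    using total_space_eqI[OF conv(1) unit convolve_antipode_left that]
      total_space_eqI[OF conv(2) unit convolve_antipode_right that] by auto
  then show ?thesis by (simp add: is_antipode_iff linear_into_antipode)
qed

lemma connected_graded_hopf_algebra: "connected_graded_hopf_algebra H"
  using graded_bialgebra connected is_antipode_antipode antipode_graded
  unfolding connected_graded_hopf_algebra_def graded_hopf_algebra_def by blast

end

text \<open>The convolution inverse of a character is \<phi> \<circ> S: applying the multiplicative
  \<phi> to the two antipode identities turns products in \<open>H\<close> into products of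
  rationals and the unit into 1.\<close>

lemma (in gbialg) hopf_character_invertible:
  assumes S: "is_antipode H S" and \<phi>: "hopf_character H \<phi>"
  shows "invertible_functional H \<phi>"
proof -
  let ?V = "total_space H"
  have lin: "linear_on ?V \<phi>" and mult: "\<And>a b. a \<in> ?V \<Longrightarrow> b \<in> ?V \<Longrightarrow> \<phi> (hmult H a b) = \<phi> a * \<phi> b"
    and one: "\<phi> (hunit H) = 1" using \<phi> by (auto simp: hopf_character_def)
  have S': "linear_into ?V ?V S" "\<And>h. h \<in> ?V \<Longrightarrow> convolve H (hmult H) S (\<lambda>x. x) h = counit H h *\<^sub>Q hunit H"
    "\<And>h. h \<in> ?V \<Longrightarrow> convolve H (hmult H) (\<lambda>x. x) S h = counit H h *\<^sub>Q hunit H"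
    using S by (auto simp: is_antipode_iff)
  have SV: "S a \<in> ?V" if "a \<in> ?V" for a using S'(1) that by (auto simp: linear_into_def)
  have *: "convolve H (*) (\<lambda>a. \<phi> (f a)) (\<lambda>a. \<phi> (g a)) h = counit H h"
    if fg: "linear_into ?V ?V f" "linear_into ?V ?V g" and h: "h \<in> ?V"
      and eq: "convolve H (hmult H) f g h = counit H h *\<^sub>Q hunit H" for f g h
  proof -
    have fgV: "f a \<in> ?V" "g a \<in> ?V" if "a \<in> ?V" for a using fg that by (auto simp: linear_into_def)
    have "convolve H (*) (\<lambda>a. \<phi> (f a)) (\<lambda>a. \<phi> (g a)) h = sweedler H (\<lambda>a b. \<phi> (hmult H (f a) (g b))) h"
      unfolding convolve_def by (rule sweedler_cong) (simp add: mult fgV)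
    also have "\<dots> = \<phi> (convolve H (hmult H) f g h)"
      unfolding convolve_def
      by (rule sweedler_linear[symmetric, OF bilinear_on_compose[OF bilinear_on_hmult fg] lin subspace_total_space])
        (use hmult_in fgV h in auto)
    also have "\<dots> = counit H h" by (simp add: eq linear_on_scale[OF lin hunit_in] one scaleQ_rat_def)
    finally show ?thesis .
  qed
  have "linear_on ?V (\<lambda>a. \<phi> (S a))"
    by (rule linear_on_compose[OF _ lin SV]) (use S'(1) in \<open>simp_all add: linear_into_def\<close>)
  then show ?thesis
    unfolding invertible_functional_def convolution_product_eq
    using *[OF S'(1) linear_into_id _ S'(2)] *[OF linear_into_id S'(1) _ S'(3)]
    by (intro exI[of _ "\<lambda>a. \<phi> (S a)"]) auto
qed

section \<open>Morphisms\<close>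

lemma comult_morphism_repr:
  assumes f: "graded_coalgebra_morphism H G f" and h: "h \<in> total_space H"
    and ps: "comult H h = (\<Sum>(a, b)\<leftarrow>ps. tensor [a, b])" "set ps \<subseteq> total_space H \<times> total_space H"
  shows "comult G (f h) = (\<Sum>(a, b)\<leftarrow>map (\<lambda>(a, b). (f a, f b)) ps. tensor [a, b])"
proof -
  have lin: "linear_on (total_space H) f" using f by (simp add: graded_coalgebra_morphism_def)
  have "comult G (f h) = tensor_lift (total_space H) 2 (\<lambda>xs. tensor (map f xs)) (comult H h)"
    using f h by (simp add: graded_coalgebra_morphism_def)
  also have "tensor_lift (total_space H) 2 (\<lambda>xs. tensor (map f xs)) =
    tensor_lift (total_space H) 2 (\<lambda>xs. tensor [f (xs ! 0), f (xs ! 1)])"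
    by (rule tensor_lift_cong) (auto simp: length_Suc_conv numeral_2_eq_2)
  also have "\<dots> (comult H h) = (\<Sum>(a, b)\<leftarrow>ps. tensor [f a, f b])"
    unfolding ps(1)
    by (rule tensor_lift_2_sum_list[OF subspace_total_space _ ps(2)])
      (use lin in \<open>auto simp: bilinear_on_def linear_on_def tensor2_simps\<close>)
  finally show ?thesis by (simp add: split_def comp_def)
qed

lemma morphism_in:
  assumes "graded_coalgebra_morphism H G f" "h \<in> total_space H"
  shows "f h \<in> total_space G"
proof (rule total_space_imageI[OF _ subspace_total_space _ assms(2)])
  show "linear_on (total_space H) f" using assms(1) by (simp add: graded_coalgebra_morphism_def)
  have "f ` component H n \<subseteq> component G n" for n using assms(1) by (simp add: graded_coalgebra_morphism_def)
  then show "f x \<in> total_space G" if "x \<in> component H n" for n x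
    using that component_subset_total_space[of G n] by blast
qed

lemma linear_into_morphism:
  "graded_coalgebra_morphism H G f \<Longrightarrow> linear_into (total_space H) (total_space G) f"
  using morphism_in by (auto simp: linear_into_def graded_coalgebra_morphism_def)

lemma (in gcoalg) sweedler_morphism:
  assumes G: "gcoalg G" and f: "graded_coalgebra_morphism H G f"
    and B: "bilinear_on (total_space G) B" and h: "h \<in> total_space H"
  shows "sweedler G B (f h) = sweedler H (\<lambda>a b. B (f a) (f b)) h"
proof -
  obtain ps where ps: "comult H h = (\<Sum>(a, b)\<leftarrow>ps. tensor [a, b])" "set ps \<subseteq> total_space H \<times> total_space H"
    by (rule comult_repr[OF h]) blast
  have sub: "set (map (\<lambda>(a, b). (f a, f b)) ps) \<subseteq> total_space G \<times> total_space G"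
    using ps(2) morphism_in[OF f] by auto
  show ?thesis
    unfolding gcoalg.sweedler_repr[OF G B comult_morphism_repr[OF f h ps] sub]
      sweedler_repr[OF bilinear_on_compose[OF B linear_into_morphism[OF f] linear_into_morphism[OF f]] ps]
    by (simp add: split_def comp_def)
qed

text \<open>In the convolution algebra of maps from \<open>H\<close> to \<open>G\<close>, f \<circ>
  S is a left inverse and T \<circ> f a right inverse of \<open>f\<close>, so the two
  coincide.\<close>

lemma (in gbialg) morphism_antipode:
  assumes G: "gbialg G" and f: "graded_coalgebra_morphism H G f"
    and mult: "\<And>a b. a \<in> total_space H \<Longrightarrow> b \<in> total_space H \<Longrightarrow> f (hmult H a b) = hmult G (f a) (f b)"
    and one: "f (hunit H) = hunit G"
    and S: "is_antipode H S" and T: "is_antipode G T" and h: "h \<in> total_space H"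
  shows "f (S h) = T (f h)"
proof -
  interpret G: gbialg G by (rule G)
  let ?V = "total_space H" and ?W = "total_space G"
  let ?conv = "convolve H (hmult G)"
  note fW = linear_into_morphism[OF f]
  have lin: "linear_on ?V f" using fW by (simp add: linear_into_def)
  have S': "linear_into ?V ?V S" "\<And>h. h \<in> ?V \<Longrightarrow> convolve H (hmult H) S (\<lambda>x. x) h = counit H h *\<^sub>Q hunit H"
    using S by (auto simp: is_antipode_iff)
  have T': "linear_into ?W ?W T" "\<And>h. h \<in> ?W \<Longrightarrow> convolve G (hmult G) (\<lambda>x. x) T h = counit G h *\<^sub>Q hunit G"
    using T by (auto simp: G.is_antipode_iff)
  have SV: "S a \<in> ?V" if "a \<in> ?V" for a using S'(1) that by (auto simp: linear_into_def)
  have fS: "linear_into ?V ?W (\<lambda>h. f (S h))"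
    using fW S'(1) SV by (auto simp: linear_into_def intro: linear_on_compose)
  have Tf: "linear_into ?V ?W (\<lambda>h. T (f h))"
    using fW T'(1) morphism_in[OF f] by (auto simp: linear_into_def intro: linear_on_compose)
  have counit: "counit G (f h) = counit H h" if "h \<in> ?V" for h
    using f that by (simp add: graded_coalgebra_morphism_def)
  have left: "?conv (\<lambda>h. f (S h)) f h = counit H h *\<^sub>Q hunit G" if "h \<in> ?V" for h
  proof -
    have "?conv (\<lambda>h. f (S h)) f h = sweedler H (\<lambda>a b. f (hmult H (S a) b)) h"
      unfolding convolve_def by (rule sweedler_cong) (simp add: mult SV)
    also have "\<dots> = f (convolve H (hmult H) S (\<lambda>x. x) h)"
      unfolding convolve_def
      by (rule sweedler_linear[symmetric, OF bilinear_on_compose[OF bilinear_on_hmult S'(1) linear_into_id] lin subspace_total_space])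
        (use hmult_in SV that in auto)
    finally show ?thesis using that by (simp add: S'(2) linear_on_scale[OF lin hunit_in] one)
  qed
  have right: "?conv f (\<lambda>h. T (f h)) h = counit H h *\<^sub>Q hunit G" if "h \<in> ?V" for h
    using sweedler_morphism[OF G.gcoalg_axioms f bilinear_on_compose[OF G.bilinear_on_hmult linear_into_id T'(1)] that]
      T'(2)[OF morphism_in[OF f that]] counit[OF that]
    by (simp add: convolve_def)
  have "f (S h) = ?conv (\<lambda>h. f (S h)) (\<lambda>h. counit H h *\<^sub>Q hunit G) h"
    using convolve_unit_right[OF G.algebra_on_hmult fS G.hunit_in G.hmult_hunit(2) h] by simp
  also have "\<dots> = ?conv (\<lambda>h. f (S h)) (?conv f (\<lambda>h. T (f h))) h"
    by (rule convolve_cong) (simp_all add: right)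
  also have "\<dots> = ?conv (?conv (\<lambda>h. f (S h)) f) (\<lambda>h. T (f h)) h"
    using convolve_assoc[OF G.algebra_on_hmult fS fW Tf h] by simp
  also have "\<dots> = ?conv (\<lambda>h. counit H h *\<^sub>Q hunit G) (\<lambda>h. T (f h)) h"
    by (rule convolve_cong) (simp_all add: left)
  also have "\<dots> = T (f h)"
    by (rule convolve_unit_left[OF G.algebra_on_hmult Tf G.hunit_in G.hmult_hunit(1) h])
  finally show ?thesis .
qed

section \<open>Power series and words of exponent vectors\<close>

definition block :: "(nat \<times> 'l::finite \<Rightarrow>\<^sub>0 nat) \<Rightarrow> nat \<Rightarrow> nat ^ 'l" where
  "block \<mu> j = (\<chi> i. Poly_Mapping.lookup \<mu> (j, i))"

text \<open>
  Words of exponent vectors may contain zeros. A factorisation of the monomial of a composition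
  splits every letter into two summands, either of which can vanish, so that zeros appear even when
  only compositions are multiplied. Quasisymmetry says that the coefficient at a word does not
  change when its zeros are dropped.
\<close>

definition word_monomial :: "(nat ^ 'l::finite) list \<Rightarrow> (nat \<times> 'l \<Rightarrow>\<^sub>0 nat)" where
  "word_monomial w = (\<Sum>j<length w. block_monomial j (w ! j))"

definition flatten :: "(nat \<times> 'l::finite \<Rightarrow>\<^sub>0 nat) \<Rightarrow> (nat ^ 'l) list" where
  "flatten \<mu> = map (block \<mu>) (sorted_list_of_set {j. block \<mu> j \<noteq> 0})"

abbreviation nonzeros :: "(nat ^ 'l::finite) list \<Rightarrow> (nat ^ 'l) list" where
  "nonzeros \<equiv> filter (\<lambda>n. n \<noteq> 0)"

lemma block_eqI: "(\<And>j. block \<mu> j = block \<nu> j) \<Longrightarrow> \<mu> = \<nu>"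
  by (rule poly_mapping_eqI) (auto simp: block_def vec_eq_iff)

lemma block_add: "block (\<mu> + \<nu>) j = block \<mu> j + block \<nu> j"
  by (simp add: block_def vec_eq_iff lookup_add)

lemma block_0: "block 0 j = 0"
  by (simp add: block_def vec_eq_iff)

lemma block_sum: "block (\<Sum>i\<in>A. f i) j = (\<Sum>i\<in>A. block (f i) j)"
  by (induction A rule: infinite_finite_induct) (auto simp: block_0 block_add)

lemma block_block_monomial: "block (block_monomial j n) j' = (if j' = j then n else 0)"
  by (auto simp: block_def block_monomial_def vec_eq_iff lookup_sum lookup_single when_def sum.delta)

lemma block_word_monomial: "block (word_monomial w) j = (if j < length w then w ! j else 0)"
  by (simp add: word_monomial_def block_sum block_block_monomial sum.delta)

lemma finite_block_support: "finite {j. block \<mu> j \<noteq> 0}"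
proof -
  have "{j. block \<mu> j \<noteq> 0} \<subseteq> fst ` Poly_Mapping.keys \<mu>"
    by (force simp: block_def vec_eq_iff in_keys_iff image_iff)
  then show ?thesis by (rule finite_subset) simp
qed

text \<open>Only finitely many blocks are nonzero, so listing the blocks up to a bound beyond the
  support gives a word. As a consequence, coefficients at words determine a power series.\<close>

lemma word_monomial_surj: "\<exists>w. \<mu> = word_monomial w"
proof -
  obtain N where N: "\<forall>j\<in>{j. block \<mu> j \<noteq> 0}. j < N"
    using finite_block_support[of \<mu>] finite_nat_set_iff_bounded by blast
  have "\<mu> = word_monomial (map (block \<mu>) [0..<N])"
    by (rule block_eqI) (use N in \<open>auto simp: block_word_monomial\<close>)
  then show ?thesis by blast
qed

lemma flatten_word_monomial: "flatten (word_monomial w) = nonzeros w"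
proof -
  let ?P = "\<lambda>j. w ! j \<noteq> 0"
  have "{j. block (word_monomial w) j \<noteq> 0} = set (filter ?P [0..<length w])"
    by (auto simp: block_word_monomial split: if_splits)
  then have "sorted_list_of_set {j. block (word_monomial w) j \<noteq> 0} = filter ?P [0..<length w]"
    by (simp only:) (rule sorted_list_of_set.idem_if_sorted_distinct; simp add: sorted_wrt_filter)
  then have "flatten (word_monomial w) = map (\<lambda>j. w ! j) (filter ?P [0..<length w])"
    unfolding flatten_def by (simp only:) (auto simp: block_word_monomial)
  also have "\<dots> = nonzeros (map (\<lambda>j. w ! j) [0..<length w])"
    by (simp add: filter_map comp_def)
  finally show ?thesis by (simp add: map_nth)
qed

lemma block_sum_list_block_monomial:
  assumes "length js = length I" "distinct js"
  shows "map (block (sum_list (map2 block_monomial js I))) js = I \<and>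
    (\<forall>j. j \<notin> set js \<longrightarrow> block (sum_list (map2 block_monomial js I)) j = 0)"
  using assms
proof (induction js I rule: list_induct2)
  case (Cons j js n I)
  then have IH: "map (block (sum_list (map2 block_monomial js I))) js = I"
    "\<And>j. j \<notin> set js \<Longrightarrow> block (sum_list (map2 block_monomial js I)) j = 0" by auto
  let ?\<mu> = "sum_list (map2 block_monomial (j # js) (n # I))"
  have "map (block ?\<mu>) js = map (block (sum_list (map2 block_monomial js I))) js"
    by (rule map_cong) (use Cons.prems in \<open>auto simp: block_add block_block_monomial\<close>)
  moreover have "block ?\<mu> j = n" "\<forall>i. i \<notin> set (j # js) \<longrightarrow> block ?\<mu> i = 0"
    using Cons.prems IH by (auto simp: block_add block_block_monomial)
  ultimately show ?case using IH(1) by (simp del: sum_list.Cons)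
qed (simp add: block_0)

text \<open>Since \<open>I\<close> has no zero letters, the index sequence of an occurrence must
  enumerate the nonzero blocks of \<mu> in increasing order. So the set counted in
  \<open>monomial_qsym\<close> has at most one element.\<close>

lemma coefficient_monomial_qsym:
  assumes "0 \<notin> set I"
  shows "coefficient (monomial_qsym I) \<mu> = (if flatten \<mu> = I then 1 else 0)"
proof -
  let ?S = "{js. length js = length I \<and> sorted_wrt (<) js \<and> sum_list (map2 block_monomial js I) = \<mu>}"
  let ?js = "sorted_list_of_set {j. block \<mu> j \<noteq> 0}"
  have unique: "js = ?js \<and> flatten \<mu> = I" if "js \<in> ?S" for js
  proof -
    have js: "length js = length I" "distinct js" "sorted js" "\<mu> = sum_list (map2 block_monomial js I)"
      using that by (auto simp: strict_sorted_iff)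
    have bl: "map (block \<mu>) js = I" "\<And>j. j \<notin> set js \<Longrightarrow> block \<mu> j = 0"
      using block_sum_list_block_monomial[OF js(1,2)] unfolding js(4) by auto
    have "block \<mu> j \<noteq> 0" if "j \<in> set js" for j
      using assms that unfolding bl(1)[symmetric] by auto
    with bl(2) have "{j. block \<mu> j \<noteq> 0} = set js" by blast
    then have "?js = js" using js by (simp add: sorted_list_of_set.idem_if_sorted_distinct)
    with bl(1) show ?thesis by (simp add: flatten_def)
  qed
  have "?js \<in> ?S" if "flatten \<mu> = I"
  proof -
    have I: "map (block \<mu>) ?js = I" using that by (simp add: flatten_def)
    then have len: "length ?js = length I" by (metis length_map)
    have d: "distinct ?js" by simp
    have "sum_list (map2 block_monomial ?js I) = \<mu>"
    proof (rule block_eqI)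
      fix j
      show "block (sum_list (map2 block_monomial ?js I)) j = block \<mu> j"
      proof (cases "j \<in> set ?js")
        case True
        have "map (block (sum_list (map2 block_monomial ?js I))) ?js = map (block \<mu>) ?js"
          using block_sum_list_block_monomial[OF len d] I by simp
        with True show ?thesis by (simp only: map_eq_conv)
      next
        case False
        then show ?thesis
          using block_sum_list_block_monomial[OF len d] finite_block_support[of \<mu>] by auto
      qed
    qed
    then show ?thesis using len by simp
  qed
  with unique have "?S = (if flatten \<mu> = I then {?js} else {})" by auto
  then show ?thesis
    by (simp add: monomial_qsym_def Power_series_inverse)
qed

definition word_coeff :: "(nat ^ 'l::finite) list \<Rightarrow> (nat \<times> 'l) power_series \<Rightarrow> rat" where
  "word_coeff w f = coefficient f (word_monomial w)"

lemma power_series_eqI: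
  assumes "\<And>w. word_coeff w f = word_coeff w g"
  shows "f = g"
proof -
  have "coefficient f \<mu> = coefficient g \<mu>" for \<mu>
    using word_monomial_surj[of \<mu>] assms by (auto simp: word_coeff_def)
  then show ?thesis by (auto simp: coefficient_inject[symmetric])
qed

lemma word_coeff_add: "word_coeff w (f + g) = word_coeff w f + word_coeff w g"
  and word_coeff_scale: "word_coeff w (c *\<^sub>Q f) = c * word_coeff w f"
  and word_coeff_0: "word_coeff w 0 = 0"
  by (simp_all add: word_coeff_def plus_power_series.rep_eq scaleQ_power_series.rep_eq zero_power_series.rep_eq)

lemma linear_map_word_coeff: "linear_map (word_coeff w)"
  by (rule linear_mapI) (simp_all add: word_coeff_add word_coeff_scale scaleQ_rat_def)

lemma word_coeff_sum: "word_coeff w (\<Sum>i\<in>A. f i) = (\<Sum>i\<in>A. word_coeff w (f i))"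
  by (rule linear_map_sum[OF linear_map_word_coeff])

lemma word_coeff_monomial:
  "0 \<notin> set I \<Longrightarrow> word_coeff w (monomial_qsym I) = (if nonzeros w = I then 1 else 0)"
  by (simp add: word_coeff_def coefficient_monomial_qsym flatten_word_monomial)

lemma finite_vec_le: "finite {v :: nat ^ 'l::finite. \<forall>i. v $ i \<le> n $ i}"
proof -
  have "{v :: nat ^ 'l. \<forall>i. v $ i \<le> n $ i} \<subseteq> (\<lambda>f. \<chi> i. f i) ` (PiE UNIV (\<lambda>i. {..n $ i}))"
  proof
    fix v :: "nat ^ 'l" assume "v \<in> {v. \<forall>i. v $ i \<le> n $ i}"
    then have "(\<lambda>i. v $ i) \<in> PiE UNIV (\<lambda>i. {..n $ i})" "v = (\<chi> i. v $ i)" by (auto simp: vec_eq_iff)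
    then show "v \<in> (\<lambda>f. \<chi> i. f i) ` (PiE UNIV (\<lambda>i. {..n $ i}))" by blast
  qed
  then show ?thesis by (rule finite_subset) (intro finite_imageI finite_PiE; simp)
qed

definition vec_splits :: "nat ^ 'l::finite \<Rightarrow> ((nat ^ 'l) \<times> (nat ^ 'l)) set" where
  "vec_splits n = {(a, b). a + b = n}"

definition splits :: "(nat ^ 'l::finite) list \<Rightarrow> ((nat ^ 'l) list \<times> (nat ^ 'l) list) set" where
  "splits w = {(A, B). length A = length w \<and> length B = length w \<and> map2 (+) A B = w}"

lemma finite_vec_splits: "finite (vec_splits n)"
proof -
  have "vec_splits n \<subseteq> {v. \<forall>i. v $ i \<le> n $ i} \<times> {v. \<forall>i. v $ i \<le> n $ i}"
    by (auto simp: vec_splits_def)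
  then show ?thesis by (rule finite_subset) (simp add: finite_vec_le)
qed

lemma splits_Nil: "splits [] = {([], [])}"
  by (auto simp: splits_def)

lemma splits_Cons: "splits (n # w) = (\<lambda>((a, b), (A, B)). (a # A, b # B)) ` (vec_splits n \<times> splits w)"
proof -
  have iff: "(A, B) \<in> splits (n # w) \<longleftrightarrow> (\<exists>a A' b B'. A = a # A' \<and> B = b # B' \<and> (a, b) \<in> vec_splits n \<and> (A', B') \<in> splits w)"
    for A B by (cases A; cases B) (auto simp: splits_def vec_splits_def)
  show ?thesis
  proof (intro equalityI subsetI)
    fix p assume "p \<in> splits (n # w)"
    then obtain a A b B where "p = (a # A, b # B)" "(a, b) \<in> vec_splits n" "(A, B) \<in> splits w"
      using iff by (metis surj_pair)
    then show "p \<in> (\<lambda>((a, b), (A, B)). (a # A, b # B)) ` (vec_splits n \<times> splits w)"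
      by (intro image_eqI[of _ _ "((a, b), (A, B))"]) auto
  next
    fix p assume "p \<in> (\<lambda>((a, b), (A, B)). (a # A, b # B)) ` (vec_splits n \<times> splits w)"
    then show "p \<in> splits (n # w)" by (auto simp: iff)
  qed
qed

lemma finite_splits: "finite (splits w)"
  by (induction w) (auto simp: splits_Nil splits_Cons finite_vec_splits)

lemma sum_splits_Cons:
  "(\<Sum>(A, B)\<in>splits (n # w). F A B) = (\<Sum>(a, b)\<in>vec_splits n. \<Sum>(A, B)\<in>splits w. F (a # A) (b # B))"
proof -
  have "inj_on (\<lambda>((a, b), (A, B)). (a # A, b # B)) (vec_splits n \<times> splits w)"
    by (auto simp: inj_on_def)
  then show ?thesis
    unfolding splits_Cons by (simp add: sum.reindex sum.cartesian_product split_def comp_def)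
qed

text \<open>Entrywise splitting commutes with concatenation. Dually, this is the compatibility of
  the product with the deconcatenation coproduct.\<close>

lemma sum_splits_append:
  "(\<Sum>(A, B)\<in>splits (v @ w). F A B) = (\<Sum>(A, B)\<in>splits v. \<Sum>(A', B')\<in>splits w. F (A @ A') (B @ B'))"
  by (induction v arbitrary: F) (simp_all add: splits_Nil sum_splits_Cons)

text \<open>A zero letter splits only as 0 + 0, and both halves are dropped again by
  \<open>nonzeros\<close>. Splitting a nonzero letter may create zeros, so \<open>nonzeros\<close>
  remains in the summand on the right.\<close>

lemma sum_splits_nonzeros:
  "(\<Sum>(A, B)\<in>splits w. F (nonzeros A) (nonzeros B)) = (\<Sum>(A, B)\<in>splits (nonzeros w). F (nonzeros A) (nonzeros B))"
proof (induction w arbitrary: F)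
  case (Cons n w)
  show ?case
  proof (cases "n = 0")
    case True
    then have "vec_splits n = {(0, 0)}" by (auto simp: vec_splits_def vec_eq_iff)
    then show ?thesis using True Cons[of F] by (simp add: sum_splits_Cons)
  next
    case False
    have "(\<Sum>(A, B)\<in>splits w. F (nonzeros (a # A)) (nonzeros (b # B))) =
      (\<Sum>(A, B)\<in>splits (nonzeros w). F (nonzeros (a # A)) (nonzeros (b # B)))" for a b
      \<comment> \<open>The summand is generalised in the induction so that it can absorb the two
        halves of the first letter, prepending each of them only if it is not 0.\<close>
      using Cons[of "\<lambda>A B. F ((if a = 0 then [] else [a]) @ A) ((if b = 0 then [] else [b]) @ B)"]
      by (cases "a = 0"; cases "b = 0") auto
    then show ?thesis using False by (simp only: sum_splits_Cons filter.simps if_True if_False simp_thms)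
  qed
qed simp

text \<open>Exponents are nonnegative, so both factors of the monomial of \<open>w\<close> are
  supported on the first \<open>length w\<close> blocks and are themselves monomials of words of
  that length, added letter by letter.\<close>

lemma splits_word_monomial:
  "bij_betw (\<lambda>(A, B). (word_monomial A, word_monomial B)) (splits w) {(\<alpha>, \<beta>). \<alpha> + \<beta> = word_monomial w}"
proof (rule bij_betw_imageI)
  have nth: "A ! j + B ! j = w ! j" if "(A, B) \<in> splits w" "j < length w" for A B j
  proof -
    have AB: "map2 (+) A B = w" "length A = length w" "length B = length w"
      using that(1) by (simp_all add: splits_def)
    have "map2 (+) A B ! j = A ! j + B ! j" using AB(2,3) that(2) by simp
    then show ?thesis by (simp add: AB(1))
  qed
  have inj: "A = B" if "word_monomial A = word_monomial B" "length A = length B" for A B :: "(nat ^ 'a) list"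
  proof (rule nth_equalityI[OF that(2)])
    fix j assume "j < length A"
    then show "A ! j = B ! j"
      using block_word_monomial[of A j] block_word_monomial[of B j] that by simp
  qed
  show "inj_on (\<lambda>(A, B). (word_monomial A, word_monomial B)) (splits w)"
  proof (rule inj_onI, clarify)
    fix A B A' B' assume "(A, B) \<in> splits w" "(A', B') \<in> splits w"
      "word_monomial A = word_monomial A'" "word_monomial B = word_monomial B'"
    moreover from this have "length A = length A'" "length B = length B'" by (simp_all add: splits_def)
    ultimately show "A = A' \<and> B = B'" using inj[of A A'] inj[of B B'] by blast
  qed
  show "(\<lambda>(A, B). (word_monomial A, word_monomial B)) ` splits w = {(\<alpha>, \<beta>). \<alpha> + \<beta> = word_monomial w}"
  proof (intro equalityI subsetI)
    fix p assume "p \<in> (\<lambda>(A, B). (word_monomial A, word_monomial B)) ` splits w"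
    then obtain A B where AB: "(A, B) \<in> splits w" "p = (word_monomial A, word_monomial B)" by auto
    have "length A = length w" "length B = length w" using AB(1) by (auto simp: splits_def)
    then have "word_monomial A + word_monomial B = word_monomial w"
      by (intro block_eqI) (auto simp: block_add block_word_monomial nth[OF AB(1)])
    then show "p \<in> {(\<alpha>, \<beta>). \<alpha> + \<beta> = word_monomial w}" using AB by simp
  next
    fix p assume "p \<in> {(\<alpha>, \<beta>). \<alpha> + \<beta> = word_monomial w}"
    then obtain \<alpha> \<beta> where p: "p = (\<alpha>, \<beta>)" "\<alpha> + \<beta> = word_monomial w" by auto
    have bl: "block \<alpha> j + block \<beta> j = (if j < length w then w ! j else 0)" for j
      using block_add[of \<alpha> \<beta> j] by (simp add: p(2) block_word_monomial)
    \<comment> \<open>Beyond the word the two blocks add up to 0, and natural numbers with sum 0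
      vanish.\<close>
    have zero: "block \<alpha> j = 0 \<and> block \<beta> j = 0" if "\<not> j < length w" for j
      using bl[of j] that by (auto simp: vec_eq_iff)
    let ?A = "map (block \<alpha>) [0..<length w]" and ?B = "map (block \<beta>) [0..<length w]"
    have "\<alpha> = word_monomial ?A" "\<beta> = word_monomial ?B"
      using zero by (auto intro!: block_eqI simp: block_word_monomial)
    moreover have "(?A, ?B) \<in> splits w"
      using bl by (auto simp: splits_def intro!: nth_equalityI)
    ultimately show "p \<in> (\<lambda>(A, B). (word_monomial A, word_monomial B)) ` splits w"
      unfolding p(1) by (metis (mono_tags, lifting) image_iff case_prod_conv)
  qed
qed

text \<open>Makes the coefficients of a product genuine finite sums; over an infinite index set the
  sum would be 0 by convention.\<close>

lemma finite_monomial_splits: "finite {(\<alpha>, \<beta>). \<alpha> + \<beta> = (\<mu> :: nat \<times> 'l::finite \<Rightarrow>\<^sub>0 nat)}"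
proof -
  obtain w where "\<mu> = word_monomial w" using word_monomial_surj by blast
  then show ?thesis using bij_betw_finite[OF splits_word_monomial[of w]] by (simp add: finite_splits)
qed

lemma word_coeff_times: "word_coeff w (f * g) = (\<Sum>(A, B)\<in>splits w. word_coeff A f * word_coeff B g)"
  unfolding word_coeff_def times_power_series.rep_eq
  by (subst sum.reindex_bij_betw[OF splits_word_monomial, symmetric]) (simp add: split_def)

lemma times_power_series_assoc: "(f * g) * h = f * (g * h)" for f g h :: "(nat \<times> 'l::finite) power_series"
proof -
  let ?S = "\<lambda>\<mu> :: nat \<times> 'l \<Rightarrow>\<^sub>0 nat. {p. fst p + snd p = \<mu>}"
  have fin: "finite (?S \<mu>)" for \<mu> using finite_monomial_splits[of \<mu>] by (simp add: split_def)
  have times: "coefficient (f * g) \<mu> = (\<Sum>p\<in>?S \<mu>. coefficient f (fst p) * coefficient g (snd p))"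
    for f g :: "(nat \<times> 'l) power_series" and \<mu>
    by (simp add: times_power_series.rep_eq split_def)
  have "coefficient ((f * g) * h) \<mu> = coefficient (f * (g * h)) \<mu>" for \<mu>
  proof -
    have "coefficient ((f * g) * h) \<mu> =
      (\<Sum>(p, q)\<in>(SIGMA p:?S \<mu>. ?S (fst p)). coefficient f (fst q) * coefficient g (snd q) * coefficient h (snd p))"
      by (simp add: times sum.Sigma[OF fin ballI[OF fin]] sum_distrib_right)
    \<comment> \<open>Both index sets describe factorisations of \<mu> into three monomials; the
      bijection only regroups them.\<close>
    also have "\<dots> = (\<Sum>(p, q)\<in>(SIGMA p:?S \<mu>. ?S (snd p)). coefficient f (fst p) * coefficient g (fst q) * coefficient h (snd q))"
      by (rule sum.reindex_bij_witness[where i = "\<lambda>((\<alpha>, \<beta>), (\<gamma>, \<delta>)). ((\<alpha> + \<gamma>, \<delta>), (\<alpha>, \<gamma>))"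
            and j = "\<lambda>((\<alpha>, \<beta>), (\<gamma>, \<delta>)). ((\<gamma>, \<delta> + \<beta>), (\<delta>, \<beta>))"]) (auto simp: add.assoc)
    also have "\<dots> = coefficient (f * (g * h)) \<mu>"
      by (simp add: times sum.Sigma[OF fin ballI[OF fin]] sum_distrib_left mult.assoc)
    finally show ?thesis .
  qed
  then show ?thesis by (auto simp: coefficient_inject[symmetric])
qed

lemma word_coeff_one: "word_coeff w 1 = (if nonzeros w = [] then 1 else 0)"
proof -
  have "word_monomial w = 0 \<longleftrightarrow> nonzeros w = []"
  proof
    assume "word_monomial w = 0"
    then have "flatten (word_monomial w) = []" by (simp add: flatten_def block_0)
    then show "nonzeros w = []" by (simp add: flatten_word_monomial)
  next
    assume "nonzeros w = []"
    then have "\<forall>j<length w. w ! j = 0" by (simp add: filter_empty_conv)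
    then show "word_monomial w = 0" by (intro block_eqI) (auto simp: block_word_monomial block_0)
  qed
  then show ?thesis by (simp add: word_coeff_def one_power_series.rep_eq)
qed

lemma monomial_qsym_Nil: "monomial_qsym [] = 1"
  by (rule power_series_eqI) (simp add: word_coeff_monomial word_coeff_one)

lemma bilinear_on_times_power_series: "bilinear_on V ((*) :: (nat \<times> 'l::finite) power_series \<Rightarrow> _ \<Rightarrow> _)"
  by (auto simp: bilinear_on_def linear_on_def word_coeff_times word_coeff_add word_coeff_scale sum.distrib
      sum_distrib_left split_def algebra_simps intro!: power_series_eqI)

section \<open>Quasisymmetric functions\<close>

lemma component_QSym: "component QSym n = rat_vector.span (monomial_qsym ` vec_compositions n)"
  by (simp add: QSym_def)

lemma hmult_QSym: "hmult QSym = (*)" and hunit_QSym: "hunit QSym = 1"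
  by (simp_all add: QSym_def)

lemma total_space_QSym: "total_space QSym = rat_vector.span (monomial_qsym ` all_compositions)"
proof
  have "component QSym n \<subseteq> rat_vector.span (monomial_qsym ` all_compositions)" for n
    unfolding component_QSym
    by (rule rat_vector.span_mono) (auto simp: vec_compositions_def all_compositions_def)
  then show "total_space QSym \<subseteq> rat_vector.span (monomial_qsym ` all_compositions)"
    unfolding total_space_def by (intro rat_vector.span_minimal) auto
  have "monomial_qsym I \<in> component QSym (sum_list I)" if "I \<in> all_compositions" for I
    using that unfolding component_QSym
    by (auto simp: vec_compositions_def all_compositions_def intro: rat_vector.span_base)
  then have "monomial_qsym ` all_compositions \<subseteq> total_space QSym"
    using component_subset_total_space[of QSym] by blast
  then show "rat_vector.span (monomial_qsym ` all_compositions) \<subseteq> total_space QSym"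
    by (intro rat_vector.span_minimal subspace_total_space)
qed

lemma monomial_in_total_space: "0 \<notin> set I \<Longrightarrow> monomial_qsym I \<in> total_space QSym"
  by (auto simp: total_space_QSym all_compositions_def intro: rat_vector.span_base)

lemma monomial_in_component: "0 \<notin> set I \<Longrightarrow> sum_list I = n \<Longrightarrow> monomial_qsym I \<in> component QSym n"
  by (auto simp: component_QSym vec_compositions_def intro: rat_vector.span_base)

lemma nonzeros_composition: "0 \<notin> set I \<Longrightarrow> nonzeros I = I"
  by (auto simp: filter_id_conv)

lemma sum_list_nonzeros: "sum_list (nonzeros w) = sum_list w"
  by (induction w) auto

text \<open>A finite index set that depends only on a weight bound. The two factors of a coproduct
  term have varying degrees, and a common index set lets all their expansions in the M_I be added
  coefficient by coefficient.\<close>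

definition compositions_upto :: "nat \<Rightarrow> (nat ^ 'l::finite) list set" where
  "compositions_upto N = {I. 0 \<notin> set I \<and> weight (sum_list I) \<le> N}"

lemma weight_sum_list: "weight (sum_list I) = sum_list (map weight I)"
  by (induction I) (simp_all add: weight_add, simp add: weight_def)

lemma finite_compositions_upto: "finite (compositions_upto N :: (nat ^ 'l::finite) list set)"
proof -
  let ?A = "{v :: nat ^ 'l. \<forall>i. v $ i \<le> (\<chi> i. N) $ i}"
  have "set I \<subseteq> ?A \<and> length I \<le> N" if I: "I \<in> compositions_upto N" for I :: "(nat ^ 'l) list"
  proof
    have le: "sum_list (map weight I) \<le> N" using I by (simp add: compositions_upto_def weight_sum_list)
    show "set I \<subseteq> ?A"
    proof
      fix v assume "v \<in> set I"
      then have "weight v \<le> N" using le member_le_sum_list[of "weight v" "map weight I"] by simp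
      then show "v \<in> ?A"
        using member_le_sum[of _ UNIV "\<lambda>i. v $ i"] by (auto simp: weight_def intro: order_trans)
    qed
    \<comment> \<open>The absence of zero letters bounds the length of a composition by its
      weight.\<close>
    have "\<forall>n\<in>set I. 1 \<le> weight n"
      using I weight_eq_0_iff by (metis (mono_tags, lifting) compositions_upto_def mem_Collect_eq less_one not_less)
    then have "sum_list (map (\<lambda>_. 1) I) \<le> sum_list (map weight I)"
      by (intro sum_list_mono) auto
    then show "length I \<le> N" using le by (simp add: sum_list_triv)
  qed
  then have "compositions_upto N \<subseteq> {I. set I \<subseteq> ?A \<and> length I \<le> N}" by blast
  then show ?thesis by (rule finite_subset) (rule finite_lists_length_le[OF finite_vec_le])
qed

lemma vec_compositions_subset: "weight n \<le> N \<Longrightarrow> vec_compositions n \<subseteq> compositions_upto N"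
  by (auto simp: vec_compositions_def compositions_upto_def)

lemma finite_vec_compositions: "finite (vec_compositions n)"
  by (rule finite_subset[OF vec_compositions_subset[OF order_refl] finite_compositions_upto])

text \<open>The coefficient at \<open>I\<close> is 1 on M_I and 0 on every other M_J, so the family
  is independent and injectively indexed. This gives meaning to the coproduct, the counit and
  \<open>zeta_Q\<close>, all defined by \<open>linear_extension\<close>.\<close>

lemma monomial_extension_exists: "\<exists>L. linear_map L \<and> (\<forall>I\<in>all_compositions. L (monomial_qsym I) = g I)"
proof -
  have indep: "rat_vector.independent (monomial_qsym ` all_compositions :: (nat \<times> 'a) power_series set)"
    unfolding rat_vector.dependent_def
  proof (intro notI, elim bexE)
    fix f :: "(nat \<times> 'a) power_series"
    assume "f \<in> monomial_qsym ` all_compositions"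
      and f: "f \<in> rat_vector.span (monomial_qsym ` all_compositions - {f})"
    then obtain I where I: "0 \<notin> set I" "f = monomial_qsym I" by (auto simp: all_compositions_def)
    have "word_coeff I f = 0"
      using f by (rule rat_vector_pair.linear_eq_0_on_span[OF linear_map_word_coeff, rotated])
        (use I in \<open>auto simp: word_coeff_monomial all_compositions_def nonzeros_composition\<close>)
    then show False using I by (simp add: word_coeff_monomial nonzeros_composition)
  qed
  have inj: "inj_on monomial_qsym (all_compositions :: (nat ^ 'a) list set)"
  proof (rule inj_onI)
    fix I J :: "(nat ^ 'a) list"
    assume "I \<in> all_compositions" "J \<in> all_compositions" "monomial_qsym I = monomial_qsym J"
    then show "I = J"
      using word_coeff_monomial[of I I] word_coeff_monomial[of J I]
      by (simp add: all_compositions_def nonzeros_composition split: if_splits)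
  qed
  obtain L where "linear_map L"
    "\<forall>x\<in>monomial_qsym ` all_compositions. L x = g (inv_into all_compositions monomial_qsym x)"
    using rat_vector_pair.linear_independent_extend[OF indep, of "\<lambda>x. g (inv_into all_compositions monomial_qsym x)"]
    by auto
  then show ?thesis using inj by (auto simp: inv_into_f_f)
qed

lemmas linear_map_monomial_extension = linear_extension_works(1)[OF monomial_extension_exists]
  and monomial_extension = linear_extension_works(2)[OF monomial_extension_exists]

lemma linear_map_comult_QSym: "linear_map (comult QSym)"
  and linear_map_counit_QSym: "linear_map (counit QSym)"
  and linear_map_zeta_Q: "linear_map zeta_Q"
  by (simp_all add: QSym_def zeta_Q_def linear_map_monomial_extension)

lemma composition_iff: "0 \<notin> set I \<longleftrightarrow> I \<in> all_compositions"
  by (simp add: all_compositions_def)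

lemma comult_monomial: "0 \<notin> set I \<Longrightarrow>
    comult QSym (monomial_qsym I) = (\<Sum>r\<le>length I. tensor [monomial_qsym (take r I), monomial_qsym (drop r I)])"
  and counit_monomial: "0 \<notin> set I \<Longrightarrow> counit QSym (monomial_qsym I) = (if I = [] then 1 else 0)"
  and zeta_monomial: "0 \<notin> set I \<Longrightarrow> zeta_Q (monomial_qsym I) = (if length I \<le> 1 then 1 else 0)"
  unfolding composition_iff by (simp_all add: QSym_def zeta_Q_def monomial_extension)

lemma QSym_eqI:
  assumes "linear_on (total_space QSym) f" "linear_on (total_space QSym) g"
    and "\<And>I. 0 \<notin> set I \<Longrightarrow> f (monomial_qsym I) = g (monomial_qsym I)" "x \<in> total_space QSym"
  shows "f x = g x"
  by (rule linear_on_eq_span[OF assms(1,2)[unfolded total_space_QSym] _ assms(4)[unfolded total_space_QSym]])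
    (use assms(3) in \<open>auto simp: all_compositions_def\<close>)

lemma QSym_component_eqI:
  assumes "linear_on (component QSym n) f" "linear_on (component QSym n) g"
    and "\<And>I. I \<in> vec_compositions n \<Longrightarrow> f (monomial_qsym I) = g (monomial_qsym I)" "x \<in> component QSym n"
  shows "f x = g x"
  by (rule linear_on_eq_span[OF assms(1,2)[unfolded component_QSym] _ assms(4)[unfolded component_QSym]])
    (use assms(3) in auto)

lemma linear_on_word_coeff: "linear_on V (word_coeff w)"
  by (rule linear_map_imp_linear_on[OF linear_map_word_coeff])

text \<open>Quasisymmetry in terms of words: on M_I only the nonzero letters of \<open>w\<close>
  matter, and the rest is linearity.\<close>

lemma word_coeff_nonzeros: "f \<in> total_space QSym \<Longrightarrow> word_coeff (nonzeros w) f = word_coeff w f"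
  by (rule QSym_eqI[OF linear_on_word_coeff linear_on_word_coeff]) (simp_all add: word_coeff_monomial)

lemma word_coeff_component:
  assumes "f \<in> component QSym n" "sum_list w \<noteq> n"
  shows "word_coeff w f = 0"
proof (rule QSym_component_eqI[OF linear_on_word_coeff _ _ assms(1)])
  show "linear_on (component QSym n) (\<lambda>f. 0 :: rat)" by (simp add: linear_on_def)
  show "word_coeff w (monomial_qsym I) = 0" if "I \<in> vec_compositions n" for I
    using that assms(2) sum_list_nonzeros[of w] by (auto simp: vec_compositions_def word_coeff_monomial)
qed

lemma qsym_expansion:
  assumes "f \<in> component QSym n" "finite F" "vec_compositions n \<subseteq> F" "F \<subseteq> all_compositions"
  shows "f = (\<Sum>I\<in>F. word_coeff I f *\<^sub>Q monomial_qsym I)"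
proof (rule QSym_component_eqI[OF _ _ _ assms(1)])
  show "linear_on (component QSym n) (\<lambda>f. f)" by (simp add: linear_on_def)
  show "linear_on (component QSym n) (\<lambda>f. \<Sum>I\<in>F. word_coeff I f *\<^sub>Q monomial_qsym I)"
    by (rule linear_on_sum_fun)
      (simp add: linear_on_def word_coeff_add word_coeff_scale scaleQ_add_left scaleQ_scaleQ)
  fix J assume J: "J \<in> vec_compositions n"
  have "(\<Sum>I\<in>F. word_coeff I (monomial_qsym J) *\<^sub>Q monomial_qsym I) = (\<Sum>I\<in>F. if I = J then monomial_qsym J else 0)"
    using J assms(4)
    by (intro sum.cong)
      (auto simp: vec_compositions_def all_compositions_def word_coeff_monomial nonzeros_composition scaleQ_one)
  then show "monomial_qsym J = (\<Sum>I\<in>F. word_coeff I (monomial_qsym J) *\<^sub>Q monomial_qsym I)"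
    using J assms(2,3) by (auto simp: sum.delta)
qed

lemma qsym_expansion_upto:
  assumes "f \<in> component QSym n" "weight n \<le> N"
  shows "f = (\<Sum>I\<in>compositions_upto N. word_coeff I f *\<^sub>Q monomial_qsym I)"
  by (rule qsym_expansion[OF assms(1) finite_compositions_upto vec_compositions_subset[OF assms(2)]])
    (auto simp: compositions_upto_def all_compositions_def)

section \<open>The graded coalgebra of quasisymmetric functions\<close>

lemma graded_space_QSym: "graded_space QSym"
  unfolding graded_space_def
proof (intro conjI allI impI ballI)
  show "rat_vector.subspace (component QSym n)" for n by (simp add: component_QSym)
  fix N and x :: "nat ^ 'a \<Rightarrow> (nat \<times> 'a) power_series" and n
  assume *: "finite N \<and> (\<forall>n\<in>N. x n \<in> component QSym n) \<and> (\<Sum>n\<in>N. x n) = 0" and n: "n \<in> N"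
  \<comment> \<open>The coefficient at a composition of \<open>n\<close> sees only the summand of
    degree \<open>n\<close>.\<close>
  have "word_coeff I (x n) = 0" if I: "I \<in> vec_compositions n" for I
  proof -
    have "word_coeff I (\<Sum>n\<in>N. x n) = (\<Sum>m\<in>N. if m = n then word_coeff I (x n) else 0)"
      unfolding word_coeff_sum
      by (rule sum.cong) (use * I in \<open>auto simp: vec_compositions_def intro: word_coeff_component\<close>)
    then show ?thesis using * n by (simp add: word_coeff_0 sum.delta)
  qed
  moreover have "vec_compositions n \<subseteq> all_compositions"
    by (auto simp: vec_compositions_def all_compositions_def)
  ultimately show "x n = 0"
    using qsym_expansion[of "x n" n "vec_compositions n"] * n by (simp add: finite_vec_compositions)
qed

text \<open>Proved directly from the linearity of the coproduct, because the version in
  \<open>gcoalg\<close> presupposes the coalgebra axioms that are being established here.\<close>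

lemma linear_on_sweedler_QSym:
  assumes "bilinear_on (total_space QSym) B"
  shows "linear_on (total_space QSym) (sweedler QSym B)"
  unfolding sweedler_def
  by (rule linear_on_compose[OF linear_map_imp_linear_on[OF linear_map_comult_QSym] linear_map_imp_linear_on])
    (use linear_map_tensor_lift[OF subspace_total_space multilinear_on_2[OF assms]] in auto)

lemma composition_take_drop: "0 \<notin> set I \<Longrightarrow> 0 \<notin> set (take r I)" "0 \<notin> set I \<Longrightarrow> 0 \<notin> set (drop r I)"
  by (auto dest: in_set_takeD in_set_dropD)

lemma sweedler_monomial:
  assumes B: "bilinear_on (total_space QSym) B" and I: "0 \<notin> set I"
  shows "sweedler QSym B (monomial_qsym I) =
    (\<Sum>r\<le>length I. B (monomial_qsym (take r I)) (monomial_qsym (drop r I)))"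
proof -
  let ?L = "tensor_lift (total_space QSym) 2 (\<lambda>xs. B (xs ! 0) (xs ! 1))"
  have "sweedler QSym B (monomial_qsym I) =
    (\<Sum>r\<le>length I. ?L (tensor [monomial_qsym (take r I), monomial_qsym (drop r I)]))"
    unfolding sweedler_def comult_monomial[OF I]
    by (rule linear_map_sum[OF linear_map_tensor_lift[OF subspace_total_space multilinear_on_2[OF B]]])
  also have "\<dots> = (\<Sum>r\<le>length I. B (monomial_qsym (take r I)) (monomial_qsym (drop r I)))"
    by (intro sum.cong refl, subst tensor_lift_tensor[OF subspace_total_space multilinear_on_2[OF B]])
      (use I in \<open>auto simp: monomial_in_total_space composition_take_drop\<close>)
  finally show ?thesis .
qed

lemma comult_QSym_coassoc:
  assumes "f \<in> total_space QSym"
  shows "sweedler QSym (\<lambda>a b. comult QSym a \<otimes>\<^sub>T tensor [b]) f = sweedler QSym (\<lambda>a b. tensor [a] \<otimes>\<^sub>T comult QSym b) f"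
proof (rule QSym_eqI[OF _ _ _ assms])
  have 1: "bilinear_on (total_space QSym) (\<lambda>a b. comult QSym a \<otimes>\<^sub>T tensor [b])"
    and 2: "bilinear_on (total_space QSym) (\<lambda>a b. tensor [a] \<otimes>\<^sub>T comult QSym b)"
    by (auto simp: bilinear_on_def linear_on_def tensor1_add tensor1_scale
        linear_map_add[OF linear_map_comult_QSym] linear_map_scale[OF linear_map_comult_QSym]
        linear_map_add[OF linear_map_tensor_mult_left] linear_map_add[OF linear_map_tensor_mult_right]
        linear_map_scale[OF linear_map_tensor_mult_left] linear_map_scale[OF linear_map_tensor_mult_right])
  show "linear_on (total_space QSym) (sweedler QSym (\<lambda>a b. comult QSym a \<otimes>\<^sub>T tensor [b]))"
    "linear_on (total_space QSym) (sweedler QSym (\<lambda>a b. tensor [a] \<otimes>\<^sub>T comult QSym b))"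
    by (rule linear_on_sweedler_QSym[OF 1], rule linear_on_sweedler_QSym[OF 2])
  fix I :: "(nat ^ 'a) list" assume I: "0 \<notin> set I"
  let ?M = "monomial_qsym :: (nat ^ 'a) list \<Rightarrow> _" and ?n = "length I"
  \<comment> \<open>Both sides sum over two cuts of \<open>I\<close>. In \<open>?T r s\<close> the
    first argument is the position of the first cut and the second is the length of the middle
    piece.\<close>
  let ?T = "\<lambda>r s. tensor [?M (take r I), ?M (take s (drop r I)), ?M (drop s (drop r I))]"
  have "sweedler QSym (\<lambda>a b. comult QSym a \<otimes>\<^sub>T tensor [b]) (?M I) =
    (\<Sum>r\<le>?n. \<Sum>s\<le>r. ?T s (r - s))"
    unfolding sweedler_monomial[OF 1 I]
    by (intro sum.cong refl)
      (auto simp: comult_monomial composition_take_drop I linear_map_sum[OF linear_map_tensor_mult_left]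
        tensor_mult_tensor min_def drop_take intro!: sum.cong)
  also have "\<dots> = (\<Sum>(r, s)\<in>(SIGMA r:{..?n}. {..r}). ?T s (r - s))"
    by (rule sum.Sigma) auto
  also have "\<dots> = (\<Sum>(r, s)\<in>(SIGMA r:{..?n}. {..?n - r}). ?T r s)"
    by (rule sum.reindex_bij_witness[where i = "\<lambda>(r, s). (r + s, r)" and j = "\<lambda>(r, s). (s, r - s)"]) auto
  also have "\<dots> = (\<Sum>r\<le>?n. \<Sum>s\<le>?n - r. ?T r s)"
    by (rule sum.Sigma[symmetric]) auto
  also have "\<dots> = sweedler QSym (\<lambda>a b. tensor [a] \<otimes>\<^sub>T comult QSym b) (?M I)"
    unfolding sweedler_monomial[OF 2 I]
    by (intro sum.cong refl)
      (auto simp: comult_monomial composition_take_drop I linear_map_sum[OF linear_map_tensor_mult_right]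
        tensor_mult_tensor simp del: drop_drop)
  finally show "sweedler QSym (\<lambda>a b. comult QSym a \<otimes>\<^sub>T tensor [b]) (?M I) =
    sweedler QSym (\<lambda>a b. tensor [a] \<otimes>\<^sub>T comult QSym b) (?M I)" .
qed

lemma counit_QSym: "f \<in> total_space QSym \<Longrightarrow> counit QSym f = word_coeff [] f"
  by (rule QSym_eqI[OF linear_map_imp_linear_on[OF linear_map_counit_QSym] linear_on_word_coeff])
    (auto simp: counit_monomial word_coeff_monomial)

lemma graded_coalgebra_QSym: "graded_coalgebra QSym"
  unfolding graded_coalgebra_def
proof (intro conjI allI ballI impI graded_space_QSym)
  let ?V = "total_space QSym :: (nat \<times> 'a) power_series set"
  show "linear_on ?V (comult QSym)" "linear_on ?V (counit QSym)"
    by (rule linear_map_imp_linear_on, rule linear_map_comult_QSym linear_map_counit_QSym)+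
  fix n and f :: "(nat \<times> 'a) power_series" assume f: "f \<in> component QSym n"
  let ?R = "{tensor [a, b] | a b p q. a \<in> component QSym p \<and> b \<in> component QSym q \<and> p + q = n}"
  show "comult QSym f \<in> rat_vector.span ?R"
    using f unfolding component_QSym
  proof (rule linear_on_span_image[OF linear_map_imp_linear_on[OF linear_map_comult_QSym] rat_vector.subspace_span, rotated])
    fix x :: "(nat \<times> 'a) power_series" assume "x \<in> monomial_qsym ` vec_compositions n"
    then obtain I where I: "0 \<notin> set I" "sum_list I = n" "x = monomial_qsym I" by (auto simp: vec_compositions_def)
    have "sum_list (take r I) + sum_list (drop r I) = n" for r
      using I(2) by (metis append_take_drop_id sum_list_append)
    then have "tensor [monomial_qsym (take r I), monomial_qsym (drop r I)] \<in> ?R" for r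
      using monomial_in_component[OF composition_take_drop(1)[OF I(1), of r] refl]
        monomial_in_component[OF composition_take_drop(2)[OF I(1), of r] refl] by blast
    then show "comult QSym x \<in> rat_vector.span {tensor [a, b] | a b p q. a \<in> rat_vector.span (monomial_qsym ` vec_compositions p) \<and>
        b \<in> rat_vector.span (monomial_qsym ` vec_compositions q) \<and> p + q = n}"
      unfolding I(3) comult_monomial[OF I(1)] component_QSym[symmetric]
      by (intro rat_vector.span_sum rat_vector.span_base)
  qed
next
  fix n :: "nat ^ 'a" and f :: "(nat \<times> 'a) power_series" assume "n \<noteq> 0" and f: "f \<in> component QSym n"
  then have "word_coeff [] f = 0" by (intro word_coeff_component[OF f]) auto
  then show "counit QSym f = 0"
    using counit_QSym[of f] f component_subset_total_space[of QSym n] by auto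
next
  fix f :: "(nat \<times> 'a) power_series" assume f: "f \<in> total_space QSym"
  show "tensor_lift (total_space QSym) 2 (\<lambda>xs. comult QSym (xs ! 0) \<otimes>\<^sub>T tensor [xs ! 1]) (comult QSym f) =
    tensor_lift (total_space QSym) 2 (\<lambda>xs. tensor [xs ! 0] \<otimes>\<^sub>T comult QSym (xs ! 1)) (comult QSym f)"
    using comult_QSym_coassoc[OF f] unfolding sweedler_def .
  have id: "linear_on (total_space QSym) (\<lambda>f. f :: (nat \<times> 'a) power_series)" by (simp add: linear_on_def)
  note c = linear_map_imp_linear_on[OF linear_map_counit_QSym, of "total_space QSym"]
  have "sweedler QSym (\<lambda>a b. counit QSym a *\<^sub>Q b) f = f"
  proof (rule QSym_eqI[OF linear_on_sweedler_QSym[OF bilinear_on_scaleQ_left[OF c id]] id _ f])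
    fix I :: "(nat ^ 'a) list" assume I: "0 \<notin> set I"
    have "sweedler QSym (\<lambda>a b. counit QSym a *\<^sub>Q b) (monomial_qsym I) =
      (\<Sum>r\<le>length I. if r = 0 then monomial_qsym I else 0)"
      unfolding sweedler_monomial[OF bilinear_on_scaleQ_left[OF c id] I]
      by (intro sum.cong) (auto simp: counit_monomial composition_take_drop I scaleQ_one)
    then show "sweedler QSym (\<lambda>a b. counit QSym a *\<^sub>Q b) (monomial_qsym I) = monomial_qsym I" by (simp add: sum.delta)
  qed
  then show "tensor_lift (total_space QSym) 2 (\<lambda>xs. counit QSym (xs ! 0) *\<^sub>Q xs ! 1) (comult QSym f) = f"
    unfolding sweedler_def .
  have "sweedler QSym (\<lambda>a b. counit QSym b *\<^sub>Q a) f = f"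
  proof (rule QSym_eqI[OF linear_on_sweedler_QSym[OF bilinear_on_scaleQ_right[OF c id]] id _ f])
    fix I :: "(nat ^ 'a) list" assume I: "0 \<notin> set I"
    have "sweedler QSym (\<lambda>a b. counit QSym b *\<^sub>Q a) (monomial_qsym I) =
      (\<Sum>r\<le>length I. if r = length I then monomial_qsym I else 0)"
      unfolding sweedler_monomial[OF bilinear_on_scaleQ_right[OF c id] I]
      by (intro sum.cong) (auto simp: counit_monomial composition_take_drop I scaleQ_one)
    then show "sweedler QSym (\<lambda>a b. counit QSym b *\<^sub>Q a) (monomial_qsym I) = monomial_qsym I" by (simp add: sum.delta)
  qed
  then show "tensor_lift (total_space QSym) 2 (\<lambda>xs. counit QSym (xs ! 1) *\<^sub>Q xs ! 0) (comult QSym f) = f"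
    unfolding sweedler_def .
qed

interpretation QSym: gcoalg QSym
  by standard (rule graded_coalgebra_QSym)

lemma mult_indicator:
  assumes "P \<and> Q \<longleftrightarrow> R \<and> S"
  shows "(if P then 1 else 0) * (if Q then 1 else 0) = (if R then if S then 1 else 0 else 0 :: rat)"
  using assms by (cases P; cases Q) auto

lemma word_coeff_append:
  assumes "f \<in> total_space QSym"
  shows "word_coeff (v @ w) f = sweedler QSym (\<lambda>a b. word_coeff v a * word_coeff w b) f"
proof (rule QSym_eqI[OF linear_on_word_coeff _ _ assms])
  have bil: "bilinear_on (total_space QSym) (\<lambda>a b. word_coeff v a * word_coeff w b)"
    by (rule bilinear_on_mult[OF linear_on_word_coeff linear_on_word_coeff])
  then show "linear_on (total_space QSym) (sweedler QSym (\<lambda>a b. word_coeff v a * word_coeff w b))"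
    by (rule linear_on_sweedler_QSym)
  fix I :: "(nat ^ 'a) list" assume I: "0 \<notin> set I"
  \<comment> \<open>Of all cuts of \<open>I\<close>, only the one after as many letters as
    \<open>v\<close> has nonzero letters can contribute.\<close>
  have "sweedler QSym (\<lambda>a b. word_coeff v a * word_coeff w b) (monomial_qsym I) =
    (\<Sum>r\<le>length I. if r = length (nonzeros v) then if nonzeros v @ nonzeros w = I then 1 else 0 else 0)"
    unfolding sweedler_monomial[OF bil I]
  proof (rule sum.cong[OF refl])
    fix r assume "r \<in> {..length I}"
    then have "nonzeros v = take r I \<and> nonzeros w = drop r I \<longleftrightarrow> r = length (nonzeros v) \<and> nonzeros v @ nonzeros w = I"
      by (auto simp: append_eq_conv_conj)
    then show "word_coeff v (monomial_qsym (take r I)) * word_coeff w (monomial_qsym (drop r I)) =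
      (if r = length (nonzeros v) then if nonzeros v @ nonzeros w = I then 1 else 0 else 0)"
      unfolding word_coeff_monomial[OF composition_take_drop(1)[OF I]]
        word_coeff_monomial[OF composition_take_drop(2)[OF I]] by (rule mult_indicator)
  qed
  also have "\<dots> = word_coeff (v @ w) (monomial_qsym I)"
    by (auto simp: word_coeff_monomial I sum.delta)
  finally show "word_coeff (v @ w) (monomial_qsym I) =
    sweedler QSym (\<lambda>a b. word_coeff v a * word_coeff w b) (monomial_qsym I)" ..
qed

lemma zeta_Q_component:
  assumes "f \<in> component QSym n"
  shows "zeta_Q f = word_coeff [n] f"
proof (rule QSym_component_eqI[OF linear_map_imp_linear_on[OF linear_map_zeta_Q] linear_on_word_coeff _ assms])
  fix I assume I: "I \<in> vec_compositions n"
  \<comment> \<open>Degree 0 is included: there \<open>nonzeros [0]\<close> and \<open>I\<close> are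
    both empty.\<close>
  then have "length I \<le> 1 \<longleftrightarrow> nonzeros [n] = I"
    by (cases I) (auto simp: vec_compositions_def)
  then show "zeta_Q (monomial_qsym I) = word_coeff [n] (monomial_qsym I)"
    using I by (simp add: vec_compositions_def zeta_monomial word_coeff_monomial)
qed

lemma zeta_Q_homogeneous_part:
  assumes "f \<in> total_space QSym"
  shows "zeta_Q (homogeneous_part QSym n f) = word_coeff [n] f"
proof (rule total_space_eqI[OF _ linear_on_word_coeff _ assms])
  show "linear_on (total_space QSym) (\<lambda>f. zeta_Q (homogeneous_part QSym n f))"
    by (rule QSym.linear_on_functional_part[OF linear_map_imp_linear_on[OF linear_map_zeta_Q]])
  fix m and g :: "(nat \<times> 'a) power_series" assume "g \<in> component QSym m"
  then show "zeta_Q (homogeneous_part QSym n g) = word_coeff [n] g"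
    by (cases "m = n")
      (auto simp: QSym.homogeneous_part_component zeta_Q_component linear_map_0[OF linear_map_zeta_Q]
        word_coeff_component)
qed

text \<open>Valid for words with zero letters too, which matters when coefficients of products are
  computed from splittings.\<close>

lemma word_functional_zeta_Q:
  "f \<in> total_space QSym \<Longrightarrow> word_functional QSym zeta_Q I f = word_coeff I f"
proof (induction I arbitrary: f)
  case Nil
  then show ?case by (simp add: word_functional_simps counit_QSym)
next
  case (Cons n I)
  have "word_functional QSym zeta_Q (n # I) f = sweedler QSym (\<lambda>a b. word_coeff [n] a * word_coeff I b) f"
    unfolding word_functional_simps convolve_def
    by (rule QSym.sweedler_cong) (simp add: zeta_Q_homogeneous_part Cons.IH)
  also have "\<dots> = word_coeff (n # I) f" using word_coeff_append[OF Cons.prems, of "[n]" I] by simp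
  finally show ?case .
qed

text \<open>Products of quasisymmetric functions are quasisymmetric: both factors ignore zero
  letters, so \<open>sum_splits_nonzeros\<close> applies to the product rule.\<close>

lemma word_coeff_times_nonzeros:
  assumes "f \<in> total_space QSym" "g \<in> total_space QSym"
  shows "word_coeff w (f * g) = word_coeff (nonzeros w) (f * g)"
  using sum_splits_nonzeros[of "\<lambda>A B. word_coeff A f * word_coeff B g" w]
  by (simp add: word_coeff_times word_coeff_nonzeros assms split_def)

lemma sum_list_splits: "(A, B) \<in> splits w \<Longrightarrow> sum_list A + sum_list B = sum_list w"
proof (induction w arbitrary: A B)
  case (Cons n w)
  then show ?case by (auto simp: splits_Cons vec_splits_def algebra_simps)
qed (simp add: splits_Nil)

text \<open>The coefficients of the product vanish at words whose sum is not \<open>p + q\<close>,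
  and by quasisymmetry the others are determined at compositions. So the product equals its finite
  expansion over the compositions of \<open>p + q\<close>.\<close>

lemma times_component:
  assumes f: "f \<in> component QSym p" and g: "g \<in> component QSym q"
  shows "f * g \<in> component QSym (p + q)"
proof -
  have V: "f \<in> total_space QSym" "g \<in> total_space QSym"
    using f g component_subset_total_space[of QSym] by blast+
  have vanish: "word_coeff w (f * g) = 0" if "sum_list w \<noteq> p + q" for w
    unfolding word_coeff_times
  proof (rule sum.neutral, clarify)
    fix A B assume "(A, B) \<in> splits w"
    from sum_list_splits[OF this] have "sum_list A \<noteq> p \<or> sum_list B \<noteq> q" using that by auto
    then show "word_coeff A f * word_coeff B g = 0" using word_coeff_component[OF f] word_coeff_component[OF g] by auto
  qed
  have "f * g = (\<Sum>I\<in>vec_compositions (p + q). word_coeff I (f * g) *\<^sub>Q monomial_qsym I)" (is "_ = ?S")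
  proof (rule power_series_eqI)
    fix w
    have "word_coeff w ?S = (\<Sum>I\<in>vec_compositions (p + q). if I = nonzeros w then word_coeff (nonzeros w) (f * g) else 0)"
      unfolding word_coeff_sum
      by (intro sum.cong) (auto simp: word_coeff_scale word_coeff_monomial vec_compositions_def)
    also have "\<dots> = (if nonzeros w \<in> vec_compositions (p + q) then word_coeff w (f * g) else 0)"
      using word_coeff_times_nonzeros[OF V, of w] by (simp add: sum.delta finite_vec_compositions)
    also have "\<dots> = word_coeff w (f * g)"
      using vanish[of w] by (auto simp: vec_compositions_def sum_list_nonzeros)
    finally show "word_coeff w (f * g) = word_coeff w ?S" ..
  qed
  moreover have "?S \<in> component QSym (p + q)"
    unfolding component_QSym by (intro rat_vector.span_sum rat_vector.span_scale rat_vector.span_base imageI)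
  ultimately show ?thesis by (rule ssubst)
qed

lemma one_times_power_series: "1 * f = f" "f * 1 = f" for f :: "(nat \<times> 'l::finite) power_series"
proof -
  have "coefficient (1 * f) \<mu> = coefficient f \<mu> \<and> coefficient (f * 1) \<mu> = coefficient f \<mu>" for \<mu>
  proof -
    have "coefficient (1 * f) \<mu> = (\<Sum>p\<in>{(\<alpha>, \<beta>). \<alpha> + \<beta> = \<mu>}. if p = (0, \<mu>) then coefficient f \<mu> else 0)"
      "coefficient (f * 1) \<mu> = (\<Sum>p\<in>{(\<alpha>, \<beta>). \<alpha> + \<beta> = \<mu>}. if p = (\<mu>, 0) then coefficient f \<mu> else 0)"
      unfolding times_power_series.rep_eq one_power_series.rep_eq by (rule sum.cong, auto split: if_splits)+
    then show ?thesis by (simp add: sum.delta[OF finite_monomial_splits])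
  qed
  then show "1 * f = f" "f * 1 = f" by (auto simp: coefficient_inject[symmetric])
qed

lemma graded_algebra_QSym: "graded_algebra QSym"
proof -
  have "linear_on V ((*) a)" "linear_on V (\<lambda>b. b * a)" for V and a :: "(nat \<times> 'a) power_series"
    using bilinear_on_times_power_series[of UNIV] linear_on_subset[OF _ subset_UNIV]
    by (auto simp: bilinear_on_def)
  then show ?thesis
    unfolding graded_algebra_def hmult_QSym hunit_QSym
    using monomial_in_component[of "[]" 0]
    by (intro conjI allI ballI graded_space_QSym times_component)
      (simp_all add: times_power_series_assoc monomial_qsym_Nil one_times_power_series)
qed

section \<open>Compatibility of product and coproduct\<close>

lemma (in gcoalg) comult_eq_sweedler:
  assumes "h \<in> total_space H"
  shows "comult H h = sweedler H (\<lambda>a b. tensor [a, b]) h"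
proof -
  obtain ps where ps: "comult H h = (\<Sum>(a, b)\<leftarrow>ps. tensor [a, b])" "set ps \<subseteq> total_space H \<times> total_space H"
    by (rule comult_repr[OF assms]) blast
  show ?thesis using sweedler_repr[OF bilinear_on_tensor2 ps] ps(1) by simp
qed

lemma tensor2_sum:
  fixes x :: "'i \<Rightarrow> 'v::rat_vector" and y :: "'j \<Rightarrow> 'v"
  shows "tensor [\<Sum>i\<in>A. c i *\<^sub>Q x i, \<Sum>j\<in>B. d j *\<^sub>Q y j] = (\<Sum>i\<in>A. \<Sum>j\<in>B. (c i * d j) *\<^sub>Q tensor [x i, y j])"
proof -
  have l: "linear_map (\<lambda>a. tensor [a, b])" "linear_map (\<lambda>b. tensor [a, b])" for a b :: 'v
    by (auto intro!: linear_mapI simp: tensor2_simps)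
  show ?thesis
    by (simp add: linear_map_sum[OF l(1)] linear_map_sum[OF l(2)] tensor2_simps scaleQ_scaleQ
        rat_vector.scale_sum_right) (subst sum.swap, simp add: mult.commute)
qed

lemma tensor2_expansion:
  assumes "a \<in> component QSym p" "b \<in> component QSym q" "weight p \<le> N" "weight q \<le> N"
  shows "tensor [a, b] = (\<Sum>J\<in>compositions_upto N. \<Sum>K\<in>compositions_upto N.
    (word_coeff J a * word_coeff K b) *\<^sub>Q tensor [monomial_qsym J, monomial_qsym K])"
proof -
  note ab = qsym_expansion_upto[OF assms(1,3)] qsym_expansion_upto[OF assms(2,4)]
  have "tensor [a, b] = tensor [\<Sum>J\<in>compositions_upto N. word_coeff J a *\<^sub>Q monomial_qsym J,
      \<Sum>K\<in>compositions_upto N. word_coeff K b *\<^sub>Q monomial_qsym K]"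
    using ab by simp
  then show ?thesis unfolding tensor2_sum .
qed

lemma sum_list_sum_swap: "(\<Sum>p\<leftarrow>ps. \<Sum>i\<in>A. F p i) = (\<Sum>i\<in>A. \<Sum>p\<leftarrow>ps. F p i)"
  for F :: "'a \<Rightarrow> 'b \<Rightarrow> 'c::comm_monoid_add"
  by (induction ps) (simp_all add: sum.distrib)

lemma sum_list_scaleQ_left: "(\<Sum>p\<leftarrow>ps. c p *\<^sub>Q x) = (\<Sum>p\<leftarrow>ps. c p) *\<^sub>Q x"
  by (induction ps) (simp_all add: scaleQ_add_left)

lemma sum_list_mult_sum_list: "(\<Sum>p\<leftarrow>ps. \<Sum>q\<leftarrow>qs. u p * v q) = (\<Sum>p\<leftarrow>ps. u p) * (\<Sum>q\<leftarrow>qs. v q :: rat)"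
  by (induction ps) (simp_all add: sum_list_const_mult algebra_simps)

text \<open>Identities between coproducts become identities between coefficients at concatenated
  words. Both the multiplicativity of the coproduct and the coalgebra property of the universal
  morphism are checked in this form.\<close>

lemma comult_QSym_expansion:
  assumes f: "f \<in> component QSym n" and N: "weight n \<le> N"
  shows "comult QSym f = (\<Sum>J\<in>compositions_upto N. \<Sum>K\<in>compositions_upto N.
    word_coeff (J @ K) f *\<^sub>Q tensor [monomial_qsym J, monomial_qsym K])"
proof -
  obtain ps where ps: "comult QSym f = (\<Sum>(a, b)\<leftarrow>ps. tensor [a, b])"
    "\<And>a b. (a, b) \<in> set ps \<Longrightarrow> \<exists>p q. a \<in> component QSym p \<and> b \<in> component QSym q \<and> p + q = n"
    by (rule QSym.comult_repr_graded[OF f]) blast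
  then have sub: "set ps \<subseteq> total_space QSym \<times> total_space QSym"
    using component_subset_total_space[of QSym] by fast
  have fV: "f \<in> total_space QSym" using f component_subset_total_space by blast
  let ?F = "compositions_upto N :: (nat ^ 'a) list set"
  let ?t = "\<lambda>J K. tensor [monomial_qsym J, monomial_qsym K :: (nat \<times> 'a) power_series]"
  have "comult QSym f = (\<Sum>p\<leftarrow>ps. \<Sum>J\<in>?F. \<Sum>K\<in>?F. (word_coeff J (fst p) * word_coeff K (snd p)) *\<^sub>Q ?t J K)"
    unfolding ps(1)
  proof (rule arg_cong[where f = sum_list], rule map_cong[OF refl])
    fix x assume "x \<in> set ps"
    then obtain p q where pq: "fst x \<in> component QSym p" "snd x \<in> component QSym q" "p + q = n"
      using ps(2)[of "fst x" "snd x"] by auto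
    then have "weight p \<le> N" "weight q \<le> N" using N weight_add[of p q] by auto
    from tensor2_expansion[OF pq(1,2) this]
    show "(case x of (a, b) \<Rightarrow> tensor [a, b]) =
      (\<Sum>J\<in>?F. \<Sum>K\<in>?F. (word_coeff J (fst x) * word_coeff K (snd x)) *\<^sub>Q ?t J K)" by (simp add: split_def)
  qed
  also have "\<dots> = (\<Sum>J\<in>?F. \<Sum>K\<in>?F. (\<Sum>p\<leftarrow>ps. word_coeff J (fst p) * word_coeff K (snd p)) *\<^sub>Q ?t J K)"
    by (simp add: sum_list_sum_swap sum_list_scaleQ_left)
  also have "\<dots> = (\<Sum>J\<in>?F. \<Sum>K\<in>?F. word_coeff (J @ K) f *\<^sub>Q ?t J K)"
    unfolding word_coeff_append[OF fV]
      QSym.sweedler_repr[OF bilinear_on_mult[OF linear_on_word_coeff linear_on_word_coeff] ps(1) sub]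
    by (simp add: split_def)
  finally show ?thesis .
qed

text \<open>Expand both sides with the product rule and with the duality of concatenation. A
  splitting of \<open>J @ K\<close> is a splitting of \<open>J\<close> together with one of
  \<open>K\<close>, and the sums over the two coproducts factor.\<close>

lemma word_coeff_append_times:
  assumes f: "f \<in> total_space QSym" "comult QSym f = (\<Sum>(a, b)\<leftarrow>ps. tensor [a, b])" "set ps \<subseteq> total_space QSym \<times> total_space QSym"
    and g: "g \<in> total_space QSym" "comult QSym g = (\<Sum>(a, b)\<leftarrow>qs. tensor [a, b])" "set qs \<subseteq> total_space QSym \<times> total_space QSym"
  shows "(\<Sum>p\<leftarrow>ps. \<Sum>q\<leftarrow>qs. word_coeff J (fst p * fst q) * word_coeff K (snd p * snd q)) = word_coeff (J @ K) (f * g)"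
proof -
  have append: "word_coeff (v @ w) f = (\<Sum>p\<leftarrow>ps. word_coeff v (fst p) * word_coeff w (snd p))"
    "word_coeff (v @ w) g = (\<Sum>q\<leftarrow>qs. word_coeff v (fst q) * word_coeff w (snd q))" for v w
    unfolding word_coeff_append[OF f(1)] word_coeff_append[OF g(1)]
      QSym.sweedler_repr[OF bilinear_on_mult[OF linear_on_word_coeff linear_on_word_coeff] f(2,3)]
      QSym.sweedler_repr[OF bilinear_on_mult[OF linear_on_word_coeff linear_on_word_coeff] g(2,3)]
    by (simp_all add: split_def)
  have "(\<Sum>p\<leftarrow>ps. \<Sum>q\<leftarrow>qs. word_coeff J (fst p * fst q) * word_coeff K (snd p * snd q)) =
    (\<Sum>p\<leftarrow>ps. \<Sum>q\<leftarrow>qs. \<Sum>x\<in>splits J. \<Sum>y\<in>splits K.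
      (word_coeff (fst x) (fst p) * word_coeff (fst y) (snd p)) *
      (word_coeff (snd x) (fst q) * word_coeff (snd y) (snd q)))"
    by (simp add: word_coeff_times sum_product split_def algebra_simps)
  also have "\<dots> = (\<Sum>x\<in>splits J. \<Sum>y\<in>splits K. \<Sum>p\<leftarrow>ps. \<Sum>q\<leftarrow>qs.
      (word_coeff (fst x) (fst p) * word_coeff (fst y) (snd p)) *
      (word_coeff (snd x) (fst q) * word_coeff (snd y) (snd q)))"
    by (simp only: sum_list_sum_swap)
  also have "\<dots> = (\<Sum>x\<in>splits J. \<Sum>y\<in>splits K. word_coeff (fst x @ fst y) f * word_coeff (snd x @ snd y) g)"
    by (simp only: sum_list_mult_sum_list append)
  also have "\<dots> = word_coeff (J @ K) (f * g)"
    unfolding word_coeff_times sum_splits_append by (simp add: split_def)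
  finally show ?thesis .
qed

lemma comult_QSym_times:
  assumes "f \<in> total_space QSym" "g \<in> total_space QSym"
  shows "comult QSym (f * g) =
    tensor_lift (total_space QSym) 4 (\<lambda>xs. tensor [(xs ! 0) * (xs ! 2), (xs ! 1) * (xs ! 3)])
      (comult QSym f \<otimes>\<^sub>T comult QSym g)"
proof -
  let ?L = "tensor_lift (total_space QSym) 4 (\<lambda>xs :: (nat \<times> 'a) power_series list.
    tensor [(xs ! 0) * (xs ! 2), (xs ! 1) * (xs ! 3)])"
  let ?V = "total_space QSym :: (nat \<times> 'a) power_series set"
  have L: "linear_map ?L"
    by (rule linear_map_tensor_lift[OF subspace_total_space multilinear_on_4[OF bilinear_on_times_power_series]])
  have bil: "bilinear_on ?V (\<lambda>f g. comult QSym (f * g))"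
    by (rule bilinear_on_linear[OF bilinear_on_times_power_series linear_map_imp_linear_on[OF linear_map_comult_QSym, of UNIV]]) simp
  have bil': "bilinear_on ?V (\<lambda>f g. ?L (comult QSym f \<otimes>\<^sub>T comult QSym g))"
    by (rule bilinear_on_linear[OF _ linear_map_imp_linear_on[OF L, of UNIV]])
      (auto simp: bilinear_on_def linear_on_def
        linear_map_add[OF linear_map_comult_QSym] linear_map_scale[OF linear_map_comult_QSym]
        linear_map_add[OF linear_map_tensor_mult_left] linear_map_add[OF linear_map_tensor_mult_right]
        linear_map_scale[OF linear_map_tensor_mult_left] linear_map_scale[OF linear_map_tensor_mult_right])
  have homog: "comult QSym (f * g) = ?L (comult QSym f \<otimes>\<^sub>T comult QSym g)"
    if f: "f \<in> component QSym m" and g: "g \<in> component QSym n" for f g :: "(nat \<times> 'a) power_series" and m n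
  proof -
    have V: "f \<in> ?V" "g \<in> ?V" using f g component_subset_total_space[of QSym] by blast+
    \<comment> \<open>Bounds the weight of both tensor factors in every term, so all terms expand
      over the same compositions.\<close>
    let ?N = "weight (m + n)"
    let ?F = "compositions_upto ?N :: (nat ^ 'a) list set"
    let ?t = "\<lambda>J K. tensor [monomial_qsym J, monomial_qsym K :: (nat \<times> 'a) power_series]"
    obtain ps where ps: "comult QSym f = (\<Sum>(a, b)\<leftarrow>ps. tensor [a, b])"
      "\<And>a b. (a, b) \<in> set ps \<Longrightarrow> \<exists>p q. a \<in> component QSym p \<and> b \<in> component QSym q \<and> p + q = m"
      by (rule QSym.comult_repr_graded[OF f]) blast
    obtain qs where qs: "comult QSym g = (\<Sum>(a, b)\<leftarrow>qs. tensor [a, b])"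
      "\<And>a b. (a, b) \<in> set qs \<Longrightarrow> \<exists>p q. a \<in> component QSym p \<and> b \<in> component QSym q \<and> p + q = n"
      by (rule QSym.comult_repr_graded[OF g]) blast
    have sub: "set ps \<subseteq> ?V \<times> ?V" "set qs \<subseteq> ?V \<times> ?V"
      using ps(2) qs(2) component_subset_total_space[of QSym] by fast+
    have "?L (comult QSym f \<otimes>\<^sub>T comult QSym g) =
      (\<Sum>(a, b)\<leftarrow>concat (map (\<lambda>(a1, a2). map (\<lambda>(b1, b2). (a1 * b1, a2 * b2)) qs) ps). tensor [a, b])"
      unfolding ps(1) qs(1)
      by (rule tensor_lift_4_sum_list[OF subspace_total_space bilinear_on_times_power_series sub])
    also have "\<dots> = (\<Sum>p\<leftarrow>ps. \<Sum>q\<leftarrow>qs. tensor [fst p * fst q, snd p * snd q])"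
      by (simp add: sum_list_concat_map split_def comp_def)
    also have "\<dots> = (\<Sum>p\<leftarrow>ps. \<Sum>q\<leftarrow>qs. \<Sum>J\<in>?F. \<Sum>K\<in>?F.
        (word_coeff J (fst p * fst q) * word_coeff K (snd p * snd q)) *\<^sub>Q ?t J K)"
    proof (intro arg_cong[where f = sum_list] map_cong refl)
      fix x y assume "x \<in> set ps" "y \<in> set qs"
      then obtain p q r s where *: "fst x \<in> component QSym p" "snd x \<in> component QSym q" "p + q = m"
        "fst y \<in> component QSym r" "snd y \<in> component QSym s" "r + s = n"
        using ps(2)[of "fst x" "snd x"] qs(2)[of "fst y" "snd y"] by auto
      then have "weight (p + r) \<le> ?N" "weight (q + s) \<le> ?N" by (auto simp: weight_add)
      from tensor2_expansion[OF times_component[OF *(1,4)] times_component[OF *(2,5)] this]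
      show "tensor [fst x * fst y, snd x * snd y] = (\<Sum>J\<in>?F. \<Sum>K\<in>?F.
        (word_coeff J (fst x * fst y) * word_coeff K (snd x * snd y)) *\<^sub>Q ?t J K)" .
    qed
    also have "\<dots> = (\<Sum>J\<in>?F. \<Sum>K\<in>?F. (\<Sum>p\<leftarrow>ps. \<Sum>q\<leftarrow>qs. word_coeff J (fst p * fst q) * word_coeff K (snd p * snd q)) *\<^sub>Q ?t J K)"
      by (simp add: sum_list_sum_swap sum_list_scaleQ_left)
    also have "\<dots> = (\<Sum>J\<in>?F. \<Sum>K\<in>?F. word_coeff (J @ K) (f * g) *\<^sub>Q ?t J K)"
      by (simp only: word_coeff_append_times[OF V(1) ps(1) sub(1) V(2) qs(1) sub(2)])
    also have "\<dots> = comult QSym (f * g)"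
      by (rule comult_QSym_expansion[OF times_component[OF f g] order_refl, symmetric])
    finally show ?thesis ..
  qed
  \<comment> \<open>Bilinearity extends the homogeneous case one variable at a time: first to all
    \<open>g\<close> with \<open>f\<close> homogeneous, then to all \<open>f\<close>.\<close>
  have "comult QSym (f * g) = ?L (comult QSym f \<otimes>\<^sub>T comult QSym g)" if f: "f \<in> component QSym m" for m and f :: "(nat \<times> 'a) power_series"
    by (rule total_space_eqI[OF _ _ homog[OF f] assms(2)])
      (use bil bil' f component_subset_total_space[of QSym m] in \<open>auto simp: bilinear_on_def\<close>)
  then show ?thesis
    by (intro total_space_eqI[where f = "\<lambda>f. comult QSym (f * g)" and g = "\<lambda>f. ?L (comult QSym f \<otimes>\<^sub>T comult QSym g)",
          OF _ _ _ assms(1)])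
      (use bil bil' assms(2) in \<open>auto simp: bilinear_on_def\<close>)
qed

lemma graded_bialgebra_QSym: "graded_bialgebra QSym"
  unfolding graded_bialgebra_def hmult_QSym hunit_QSym
proof (intro conjI ballI graded_coalgebra_QSym graded_algebra_QSym)
  have "f * g \<in> total_space QSym" if fg: "f \<in> total_space QSym" "g \<in> total_space QSym"
    for f g :: "(nat \<times> 'a) power_series"
  proof -
    have lin: "linear_on (total_space QSym) (\<lambda>f. f * h)" "linear_on (total_space QSym) (\<lambda>f. h * f)"
      for h :: "(nat \<times> 'a) power_series"
      using bilinear_on_times_power_series[of UNIV] linear_on_subset[OF _ subset_UNIV]
      by (auto simp: bilinear_on_def)
    have "f * g \<in> total_space QSym" if f: "f \<in> component QSym m" for f :: "(nat \<times> 'a) power_series" and m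
      by (rule total_space_imageI[OF lin(2) subspace_total_space _ fg(2)])
        (use times_component[OF f] component_subset_total_space[of QSym] in blast)
    then show ?thesis
      by (intro total_space_imageI[OF lin(1) subspace_total_space _ fg(1)])
  qed
  then show "counit QSym (f * g) = counit QSym f * counit QSym g"
    if "f \<in> total_space QSym" "g \<in> total_space QSym" for f g :: "(nat \<times> 'a) power_series"
    using that by (simp add: counit_QSym word_coeff_times splits_Nil)
  show "comult QSym 1 = tensor [1, 1 :: (nat \<times> 'a) power_series]"
    using comult_monomial[of "[]"] by (simp add: monomial_qsym_Nil)
  show "counit QSym (1 :: (nat \<times> 'a) power_series) = 1"
    using counit_monomial[of "[]"] by (simp add: monomial_qsym_Nil)
qed (rule comult_QSym_times)

interpretation QSym: gbialg QSym
  by standard (rule graded_bialgebra_QSym)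

text \<open>In degree \<open>n\<close> the functional is the coefficient at the one-letter word
  \<open>[n]\<close>. Splittings of \<open>[p + q]\<close> are pairs of one-letter words, and for
  factors of degrees \<open>p\<close> and \<open>q\<close> only the pair \<open>[p]\<close>,
  \<open>[q]\<close> survives.\<close>

lemma hopf_character_zeta_Q: "hopf_character QSym zeta_Q"
  unfolding hopf_character_def hmult_QSym hunit_QSym
proof (intro conjI ballI)
  let ?V = "total_space QSym :: (nat \<times> 'a) power_series set"
  show lin: "linear_on ?V zeta_Q" by (rule linear_map_imp_linear_on[OF linear_map_zeta_Q])
  show "zeta_Q (1 :: (nat \<times> 'a) power_series) = 1"
    using zeta_monomial[of "[]"] by (simp add: monomial_qsym_Nil)
  have homog: "zeta_Q (f * g) = zeta_Q f * zeta_Q g" if f: "f \<in> component QSym p" and g: "g \<in> component QSym q"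
    for f g :: "(nat \<times> 'a) power_series" and p q
  proof -
    have "zeta_Q (f * g) = (\<Sum>(a, b)\<in>vec_splits (p + q). word_coeff [a] f * word_coeff [b] g)"
      unfolding zeta_Q_component[OF times_component[OF f g]] word_coeff_times sum_splits_Cons
      by (simp add: splits_Nil)
    also have "\<dots> = (\<Sum>x\<in>vec_splits (p + q). if x = (p, q) then word_coeff [p] f * word_coeff [q] g else 0)"
    proof (intro sum.cong refl, clarify)
      fix a b assume "(a, b) \<in> vec_splits (p + q)"
      then show "word_coeff [a] f * word_coeff [b] g =
        (if (a, b) = (p, q) then word_coeff [p] f * word_coeff [q] g else 0)"
        using word_coeff_component[OF f, of "[a]"] word_coeff_component[OF g, of "[b]"] by auto
    qed
    also have "\<dots> = zeta_Q f * zeta_Q g"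
      by (simp add: sum.delta finite_vec_splits zeta_Q_component[OF f] zeta_Q_component[OF g]) (simp add: vec_splits_def)
    finally show ?thesis .
  qed
  fix f g :: "(nat \<times> 'a) power_series" assume fg: "f \<in> ?V" "g \<in> ?V"
  have bil: "bilinear_on ?V (\<lambda>f g. zeta_Q (f * g))"
    by (rule bilinear_on_linear[OF bilinear_on_times_power_series linear_map_imp_linear_on[OF linear_map_zeta_Q, of UNIV]]) simp
  have bil': "bilinear_on ?V (\<lambda>f g. zeta_Q f * zeta_Q g)" by (rule bilinear_on_mult[OF lin lin])
  have "zeta_Q (f * g) = zeta_Q f * zeta_Q g" if f: "f \<in> component QSym m" for m and f :: "(nat \<times> 'a) power_series"
    by (rule total_space_eqI[OF _ _ homog[OF f] fg(2)])
      (use bil bil' f component_subset_total_space[of QSym m] in \<open>auto simp: bilinear_on_def\<close>)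
  then show "zeta_Q (f * g) = zeta_Q f * zeta_Q g"
    by (intro total_space_eqI[where f = "\<lambda>f. zeta_Q (f * g)" and g = "\<lambda>f. zeta_Q f * zeta_Q g", OF _ _ _ fg(1)])
      (use bil bil' fg(2) in \<open>auto simp: bilinear_on_def\<close>)
qed

section \<open>The largest subcoalgebra on which two functionals agree\<close>

lemma tensor_power_2_mono: "C \<subseteq> D \<Longrightarrow> tensor_power C 2 \<subseteq> tensor_power D 2"
  unfolding tensor_power_2 by (rule rat_vector.span_mono) auto

lemma tensor2_in_tensor_power: "a \<in> C \<Longrightarrow> b \<in> C \<Longrightarrow> tensor [a, b] \<in> tensor_power C 2"
  unfolding tensor_power_2 by (rule rat_vector.span_base) auto

lemma tensor_power_2_repr:
  assumes "t \<in> tensor_power C 2" "rat_vector.subspace C"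
  obtains ps where "t = (\<Sum>(a, b)\<leftarrow>ps. tensor [a, b])" "set ps \<subseteq> C \<times> C"
  using span_tensor2_repr[OF assms(1)[unfolded tensor_power_2]] rat_vector.subspace_scale[OF assms(2)] that by blast

lemma tensor2_0: "tensor [0, b] = 0" "tensor [a, 0] = 0"
  using tensor2_scale_left[of 0 0 b] tensor2_scale_right[of a 0 0] by simp_all

lemma graded_subcoalgebraD:
  assumes "graded_subcoalgebra H C"
  shows "rat_vector.subspace C" "C \<subseteq> total_space H" "C = rat_vector.span (\<Union>n. C \<inter> component H n)"
    "\<And>h. h \<in> C \<Longrightarrow> comult H h \<in> tensor_power C 2"
  using assms by (auto simp: graded_subcoalgebra_def)

lemma graded_subcoalgebra_imageI:
  assumes C: "graded_subcoalgebra H C" and "linear_on C f" "rat_vector.subspace W"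
    and "\<And>n x. x \<in> C \<Longrightarrow> x \<in> component H n \<Longrightarrow> f x \<in> W" "x \<in> C"
  shows "f x \<in> W"
  by (rule linear_on_span_image[of "\<Union>n. C \<inter> component H n"]; (fold graded_subcoalgebraD(3)[OF C])?)
    (use assms in auto)

context gcoalg
begin

lemma graded_subcoalgebra_homogeneous_part:
  assumes "graded_subcoalgebra H C" "h \<in> C"
  shows "homogeneous_part H n h \<in> C"
  by (rule graded_subcoalgebra_imageI[OF assms(1) _ graded_subcoalgebraD(1)[OF assms(1)] _ assms(2)])
    (auto simp: homogeneous_part_component rat_vector.subspace_0[OF graded_subcoalgebraD(1)[OF assms(1)]]
      intro: linear_on_subset[OF linear_on_homogeneous_part graded_subcoalgebraD(2)[OF assms(1)]])

text \<open>The definition of the agreement subcoalgebra tests elements of the sum of all components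
  below \<open>k\<close>. For a graded subcoalgebra, homogeneous parts stay inside \<open>C\<close>,
  so the test can be made one degree at a time.\<close>

lemma below_part_agreement:
  fixes \<phi> \<psi> :: "'h \<Rightarrow> rat"
  assumes \<phi>: "linear_on (total_space H) \<phi>" and \<psi>: "linear_on (total_space H) \<psi>" and C: "graded_subcoalgebra H C"
  shows "(\<forall>h \<in> C \<inter> rat_vector.span (\<Union>n\<in>{n. below n k}. component H n). \<phi> h = \<psi> h) \<longleftrightarrow>
    (\<forall>n. below n k \<longrightarrow> (\<forall>h \<in> C \<inter> component H n. \<phi> h = \<psi> h))" (is "?l \<longleftrightarrow> ?r")
proof
  assume ?l
  then show ?r by (auto intro: rat_vector.span_base)
next
  assume r: ?r
  show ?l
  proof
    fix h assume h: "h \<in> C \<inter> rat_vector.span (\<Union>n\<in>{n. below n k}. component H n)"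
    then have hV: "h \<in> total_space H" using graded_subcoalgebraD(2)[OF C] by auto
    have sub: "rat_vector.span (\<Union>n\<in>{n. below n k}. component H n) \<subseteq> total_space H"
      unfolding total_space_def by (rule rat_vector.span_mono) auto
    have below: "below n k" if n: "homogeneous_part H n h \<noteq> 0" for n
    proof (rule ccontr)
      assume nb: "\<not> below n k"
      have "homogeneous_part H n h = 0"
        by (rule linear_on_eq_span[OF linear_on_subset[OF linear_on_homogeneous_part sub], of "\<lambda>_. 0"])
          (use nb h in \<open>auto simp: homogeneous_part_component linear_on_def\<close>)
      with n show False by simp
    qed
    let ?N = "{n. homogeneous_part H n h \<noteq> 0}"
    have eq: "\<phi>' h = (\<Sum>n\<in>?N. \<phi>' (homogeneous_part H n h))" if "linear_on (total_space H) \<phi>'" for \<phi>' :: "'h \<Rightarrow> rat"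
      using linear_on_sum[OF that subspace_total_space, of ?N "\<lambda>n. homogeneous_part H n h"]
        sum_homogeneous_part[OF hV finite_homogeneous_support] homogeneous_part_in_total_space[OF hV] by simp
    have "homogeneous_part H n h \<in> C \<inter> component H n" for n
      using h graded_subcoalgebra_homogeneous_part[OF C] homogeneous_part_in_component[OF hV] by auto
    then have "\<phi> (homogeneous_part H n h) = \<psi> (homogeneous_part H n h)" if "n \<in> ?N" for n
      using r below[of n] that by blast
    then show "\<phi> h = \<psi> h" using eq[OF \<phi>] eq[OF \<psi>] by simp
  qed
qed

text \<open>The span \<open>E\<close> of all admissible subcoalgebras is itself admissible, so the
  \<open>GREATEST\<close> in the definition is attained and equals \<open>E\<close>.\<close>

lemma agreement_subcoalgebra_works:
  assumes \<phi>: "linear_on (total_space H) \<phi>" and \<psi>: "linear_on (total_space H) \<psi>"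
  shows graded_subcoalgebra_agreement: "graded_subcoalgebra H (agreement_subcoalgebra H k \<phi> \<psi>)"
    and agreement_subcoalgebra_eq: "\<And>n h. below n k \<Longrightarrow> h \<in> agreement_subcoalgebra H k \<phi> \<psi> \<Longrightarrow>
      h \<in> component H n \<Longrightarrow> \<phi> h = \<psi> h"
    and agreement_subcoalgebra_greatest: "\<And>C. graded_subcoalgebra H C \<Longrightarrow>
      (\<And>n h. below n k \<Longrightarrow> h \<in> C \<Longrightarrow> h \<in> component H n \<Longrightarrow> \<phi> h = \<psi> h) \<Longrightarrow> C \<subseteq> agreement_subcoalgebra H k \<phi> \<psi>"
proof -
  define P where "P C \<longleftrightarrow> graded_subcoalgebra H C \<and> (\<forall>n. below n k \<longrightarrow> (\<forall>h \<in> C \<inter> component H n. \<phi> h = \<psi> h))" for C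
  define E where "E = rat_vector.span (\<Union>{C. P C})"
  have CE: "C \<subseteq> E" if "P C" for C
    using that unfolding E_def by (auto intro: rat_vector.span_base)
  have E: "rat_vector.subspace E" by (simp add: E_def)
  have EV: "E \<subseteq> total_space H"
    unfolding E_def by (rule rat_vector.span_minimal[OF _ subspace_total_space])
      (auto simp: P_def graded_subcoalgebra_def)
  have "graded_subcoalgebra H E"
    unfolding graded_subcoalgebra_def
  proof (intro conjI E EV)
    show "E = rat_vector.span (\<Union>n. E \<inter> component H n)"
    proof
      have "C \<subseteq> rat_vector.span (\<Union>n. E \<inter> component H n)" if "P C" for C
      proof -
        have "C = rat_vector.span (\<Union>n. C \<inter> component H n)"
          using that by (intro graded_subcoalgebraD(3)) (simp add: P_def)
        also have "\<dots> \<subseteq> rat_vector.span (\<Union>n. E \<inter> component H n)"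
          using CE[OF that] by (intro rat_vector.span_mono) auto
        finally show ?thesis .
      qed
      then show "E \<subseteq> rat_vector.span (\<Union>n. E \<inter> component H n)"
        unfolding E_def[symmetric] by (subst (1) E_def) (rule rat_vector.span_minimal, auto)
      show "rat_vector.span (\<Union>n. E \<inter> component H n) \<subseteq> E"
        by (rule rat_vector.span_minimal[OF _ E]) auto
    qed
    have "comult H x \<in> tensor_power E 2" if "x \<in> E" for x
      using that unfolding E_def
    proof (rule linear_on_span_image[OF linear_on_subset[OF linear_on_comult EV[unfolded E_def]], rotated 2])
      fix x assume "x \<in> \<Union>{C. P C}"
      then obtain C where C: "P C" "x \<in> C" by auto
      then have "comult H x \<in> tensor_power C 2" by (intro graded_subcoalgebraD(4)) (simp_all add: P_def)
      then show "comult H x \<in> tensor_power (rat_vector.span (\<Union>{C. P C})) 2"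
        using tensor_power_2_mono[OF CE[OF C(1)]] by (auto simp: E_def)
    qed (simp add: tensor_power_2)
    then show "comult H ` E \<subseteq> tensor_power E 2" by blast
  qed
  moreover have "\<phi> h = \<psi> h" if n: "below n k" and h: "h \<in> E" "h \<in> component H n" for n h
  proof -
    \<comment> \<open>A homogeneous element of \<open>E\<close> may be a sum of elements that are
      not homogeneous, taken from different subcoalgebras. Composing with the projection to degree
      \<open>n\<close> gives a linear condition that can be checked on each of them.\<close>
    have lin: "linear_on E (\<lambda>h. \<phi>' (homogeneous_part H n h))" if "linear_on (total_space H) \<phi>'" for \<phi>' :: "'h \<Rightarrow> rat"
      by (rule linear_on_subset[OF linear_on_functional_part[OF that] EV])
    have "\<phi> (homogeneous_part H n h) = \<psi> (homogeneous_part H n h)"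
    proof (rule linear_on_eq_span[OF lin[OF \<phi>, unfolded E_def] lin[OF \<psi>, unfolded E_def] _ h(1)[unfolded E_def]])
      fix x assume "x \<in> \<Union>{C. P C}"
      then obtain C where C: "P C" "x \<in> C" by auto
      then have "homogeneous_part H n x \<in> C \<inter> component H n"
        using graded_subcoalgebra_homogeneous_part[of C x n] homogeneous_part_in_component[of x n]
          graded_subcoalgebraD(2)[of H C] by (auto simp: P_def)
      then show "\<phi> (homogeneous_part H n x) = \<psi> (homogeneous_part H n x)" using C(1) n by (auto simp: P_def)
    qed
    then show ?thesis using h(2) by (simp add: homogeneous_part_component)
  qed
  ultimately have PE: "P E" by (auto simp: P_def)
  have "(graded_subcoalgebra H C \<and>
      (\<forall>h \<in> C \<inter> rat_vector.span (\<Union>n\<in>{n. below n k}. component H n). \<phi> h = \<psi> h)) = P C" for C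
    unfolding P_def by (rule conj_cong[OF refl below_part_agreement[OF \<phi> \<psi>]])
  then have "agreement_subcoalgebra H k \<phi> \<psi> = (GREATEST C. P C)"
    by (simp only: agreement_subcoalgebra_def)
  also have "\<dots> = E" by (rule Greatest_equality[of P E, OF PE CE])
  finally have *: "agreement_subcoalgebra H k \<phi> \<psi> = E" .
  show "graded_subcoalgebra H (agreement_subcoalgebra H k \<phi> \<psi>)" using PE by (simp add: * P_def)
  show "\<phi> h = \<psi> h" if "below n k" "h \<in> agreement_subcoalgebra H k \<phi> \<psi>" "h \<in> component H n" for n h
    using PE that by (auto simp: * P_def)
  show "C \<subseteq> agreement_subcoalgebra H k \<phi> \<psi>"
    if "graded_subcoalgebra H C" "\<And>n h. below n k \<Longrightarrow> h \<in> C \<Longrightarrow> h \<in> component H n \<Longrightarrow> \<phi> h = \<psi> h" for C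
    using CE[of C] that by (simp add: * P_def)
qed

text \<open>The coproduct has one representation with factors in \<open>C\<close> and another with
  homogeneous factors; a single one with both properties is needed. The map \<open>?B\<close>
  projects onto total degree \<open>n\<close>: it fixes the coproduct by the graded representation,
  and it makes the factors of the other one homogeneous without leaving \<open>C\<close>.\<close>

lemma graded_subcoalgebra_comult:
  assumes C: "graded_subcoalgebra H C" and h: "h \<in> C" "h \<in> component H n"
  shows "comult H h \<in> rat_vector.span
    {tensor [a, b] | a b p q. a \<in> C \<inter> component H p \<and> b \<in> C \<inter> component H q \<and> p + q = n}"
proof -
  let ?V = "total_space H"
  let ?B = "\<lambda>a b. \<Sum>(p, q)\<in>vec_splits n. tensor [homogeneous_part H p a, homogeneous_part H q b]"
  have hV: "h \<in> ?V" using h graded_subcoalgebraD(2)[OF C] by auto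
  have "bilinear_on ?V (\<lambda>a b. tensor [homogeneous_part H p a, homogeneous_part H q b])" for p q
    by (rule bilinear_on_compose[OF bilinear_on_tensor2[of ?V]])
      (auto simp: linear_into_def linear_on_homogeneous_part homogeneous_part_in_total_space)
  then have bil: "bilinear_on ?V ?B"
    using bilinear_on_sum[of "vec_splits n" ?V "\<lambda>x a b. tensor [homogeneous_part H (fst x) a, homogeneous_part H (snd x) b]"]
    by (simp add: split_def)
  obtain ps where ps: "comult H h = (\<Sum>(a, b)\<leftarrow>ps. tensor [a, b])" "set ps \<subseteq> C \<times> C"
    by (rule tensor_power_2_repr[OF graded_subcoalgebraD(4)[OF C h(1)] graded_subcoalgebraD(1)[OF C]]) blast
  have "comult H h = sweedler H ?B h"
    unfolding comult_eq_sweedler[OF hV]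
  proof (rule sweedler_cong_graded[OF bilinear_on_tensor2 bil h(2)])
    fix a b p q assume ab: "a \<in> component H p" "b \<in> component H q" "p + q = n"
    have "?B a b = (\<Sum>x\<in>vec_splits n. if x = (p, q) then tensor [a, b] else 0)"
      by (intro sum.cong refl, clarify)
        (auto simp: homogeneous_part_component[OF ab(1)] homogeneous_part_component[OF ab(2)] tensor2_0)
    also have "\<dots> = tensor [a, b]"
      using ab(3) by (simp add: sum.delta finite_vec_splits) (simp add: vec_splits_def)
    finally show "tensor [a, b] = ?B a b" ..
  qed
  also have "\<dots> = (\<Sum>(a, b)\<leftarrow>ps. ?B a b)"
    by (rule sweedler_repr[OF bil ps(1)]) (use ps(2) graded_subcoalgebraD(2)[OF C] in auto)
  also have "\<dots> \<in> rat_vector.span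
    {tensor [a, b] | a b p q. a \<in> C \<inter> component H p \<and> b \<in> C \<inter> component H q \<and> p + q = n}"
  proof (rule sum_list_in_subspace[OF rat_vector.subspace_span])
    fix x assume "x \<in> set ps"
    then obtain a b where ab: "x = (a, b)" "a \<in> C" "b \<in> C" using ps(2) by auto
    then have V: "a \<in> ?V" "b \<in> ?V" using graded_subcoalgebraD(2)[OF C] by auto
    show "(case x of (a, b) \<Rightarrow> ?B a b) \<in> rat_vector.span
      {tensor [a, b] | a b p q. a \<in> C \<inter> component H p \<and> b \<in> C \<inter> component H q \<and> p + q = n}"
      unfolding ab(1) prod.case
    proof (rule rat_vector.span_sum, clarify)
      fix p q assume "(p, q) \<in> vec_splits n"
      then have "p + q = n" by (simp add: vec_splits_def)
      then show "tensor [homogeneous_part H p a, homogeneous_part H q b] \<in> rat_vector.span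
        {tensor [a, b] | a b p q. a \<in> C \<inter> component H p \<and> b \<in> C \<inter> component H q \<and> p + q = n}"
        using homogeneous_part_in_component[OF V(1), of p] homogeneous_part_in_component[OF V(2), of q]
          graded_subcoalgebra_homogeneous_part[OF C ab(2), of p] graded_subcoalgebra_homogeneous_part[OF C ab(3), of q]
        by (intro rat_vector.span_base) blast
    qed
  qed
  finally show ?thesis .
qed

lemma graded_subcoalgebra_comult_repr:
  assumes C: "graded_subcoalgebra H C" and h: "h \<in> C" "h \<in> component H n"
  obtains ps where "comult H h = (\<Sum>(a, b)\<leftarrow>ps. tensor [a, b])"
    "\<And>a b. (a, b) \<in> set ps \<Longrightarrow> \<exists>p q. a \<in> C \<inter> component H p \<and> b \<in> C \<inter> component H q \<and> p + q = n"
proof -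
  let ?R = "{(a, b). \<exists>p q. a \<in> C \<inter> component H p \<and> b \<in> C \<inter> component H q \<and> p + q = n}"
  have "{tensor [a, b] | a b p q. a \<in> C \<inter> component H p \<and> b \<in> C \<inter> component H q \<and> p + q = n} =
    (\<lambda>(a, b). tensor [a, b]) ` ?R" by (auto simp: image_iff) blast
  then have "comult H h \<in> rat_vector.span ((\<lambda>(a, b). tensor [a, b]) ` ?R)"
    using graded_subcoalgebra_comult[OF C h] by (simp only:)
  then have "\<exists>ps. set ps \<subseteq> ?R \<and> comult H h = (\<Sum>(a, b)\<leftarrow>ps. tensor [a, b])"
    by (rule span_tensor2_repr)
      (use rat_vector.subspace_scale[OF subspace_component] rat_vector.subspace_scale[OF graded_subcoalgebraD(1)[OF C]] in blast)
  then show ?thesis using that by blast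
qed

end

section \<open>Sub-bialgebras\<close>

text \<open>The axioms for the restriction speak of lifts over \<open>C\<close>, those of
  \<open>H\<close> of lifts over the total space, and these are different choices. They agree on
  coproducts of elements of \<open>C\<close>, because such coproducts have representations over
  \<open>C\<close> on which both can be evaluated.\<close>

lemma (in gbialg) graded_bialgebra_sub:
  assumes C: "graded_subcoalgebra H C" and one: "hunit H \<in> C"
    and mult: "\<And>a b. a \<in> C \<Longrightarrow> b \<in> C \<Longrightarrow> hmult H a b \<in> C"
  shows "graded_bialgebra (H\<lparr>component := \<lambda>n. C \<inter> component H n\<rparr>)" (is "graded_bialgebra ?G")
    and "total_space (H\<lparr>component := \<lambda>n. C \<inter> component H n\<rparr>) = C"
proof -
  note D = graded_subcoalgebraD[OF C]
  show total: "total_space ?G = C" using D(3) by (simp add: total_space_def)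
  have sweedler: "sweedler ?G B h = sweedler H B h" if B: "bilinear_on (total_space H) B" and h: "h \<in> C"
    for B :: "'h \<Rightarrow> 'h \<Rightarrow> 'c::rat_vector" and h
  proof -
    obtain ps where ps: "comult H h = (\<Sum>(a, b)\<leftarrow>ps. tensor [a, b])" "set ps \<subseteq> C \<times> C"
      by (rule tensor_power_2_repr[OF D(4)[OF h] D(1)]) blast
    then have "set ps \<subseteq> total_space H \<times> total_space H" using D(2) by auto
    from sweedler_repr[OF B ps(1) this]
    show ?thesis
      using tensor_lift_2_sum_list[OF D(1) bilinear_on_subset[OF B D(2)] ps(2)]
      unfolding sweedler_def total by (simp add: ps(1))
  qed
  have space: "graded_space ?G"
    unfolding graded_space_def
  proof (intro conjI allI impI ballI)
    show "rat_vector.subspace (component ?G n)" for n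
      by (simp add: rat_vector.subspace_inter D(1) subspace_component)
    fix N x n assume "finite N \<and> (\<forall>n\<in>N. x n \<in> component ?G n) \<and> (\<Sum>n\<in>N. x n) = 0" "n \<in> N"
    then show "x n = 0" by (intro components_independent[of N x n]) auto
  qed
  have lin: "linear_on C f" if "linear_on (total_space H) f" for f :: "'h \<Rightarrow> 'c::rat_vector"
    using that D(2) by (rule linear_on_subset)
  have "graded_coalgebra ?G"
    unfolding graded_coalgebra_def
  proof (intro conjI allI ballI impI space)
    show "linear_on (total_space ?G) (comult ?G)" "linear_on (total_space ?G) (counit ?G)"
      unfolding total by (simp_all add: lin linear_on_comult linear_on_counit)
    show "comult ?G h \<in> rat_vector.span
        {tensor [a, b] | a b p q. a \<in> component ?G p \<and> b \<in> component ?G q \<and> p + q = n}"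
      if "h \<in> component ?G n" for n h
      using graded_subcoalgebra_comult[OF C, of h n] that by simp
    show "counit ?G h = 0" if "n \<noteq> 0" "h \<in> component ?G n" for n h
      using counit_component[of h n] that by simp
    fix h assume "h \<in> total_space ?G"
    then have h: "h \<in> C" "h \<in> total_space H" using total D(2) by auto
    show "tensor_lift (total_space ?G) 2 (\<lambda>xs. comult ?G (xs ! 0) \<otimes>\<^sub>T tensor [xs ! 1]) (comult ?G h) =
      tensor_lift (total_space ?G) 2 (\<lambda>xs. tensor [xs ! 0] \<otimes>\<^sub>T comult ?G (xs ! 1)) (comult ?G h)"
      using graded_coalgebra h(2) sweedler[OF bilinear_on_comult_left h(1)] sweedler[OF bilinear_on_comult_right h(1)]
      unfolding graded_coalgebra_def sweedler_def by simp
    show "tensor_lift (total_space ?G) 2 (\<lambda>xs. counit ?G (xs ! 0) *\<^sub>Q xs ! 1) (comult ?G h) = h"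
      using sweedler_counit_left[OF linear_on_id h(2)]
        sweedler[OF bilinear_on_scaleQ_left[OF linear_on_counit linear_on_id] h(1)]
      by (simp add: sweedler_def)
    show "tensor_lift (total_space ?G) 2 (\<lambda>xs. counit ?G (xs ! 1) *\<^sub>Q xs ! 0) (comult ?G h) = h"
      using sweedler_counit_right[OF linear_on_id h(2)]
        sweedler[OF bilinear_on_scaleQ_right[OF linear_on_counit linear_on_id] h(1)]
      by (simp add: sweedler_def)
  qed
  moreover have "graded_algebra ?G"
    using graded_algebra one mult bilinear_on_subset[OF bilinear_on_hmult D(2)]
    unfolding graded_algebra_def total bilinear_on_def by (simp add: space subsetD[OF D(2)])
  moreover have "comult ?G (hmult ?G a b) =
    tensor_lift (total_space ?G) 4 (\<lambda>xs. tensor [hmult ?G (xs ! 0) (xs ! 2), hmult ?G (xs ! 1) (xs ! 3)])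
      (comult ?G a \<otimes>\<^sub>T comult ?G b)" if ab: "a \<in> C" "b \<in> C" for a b
  proof -
    obtain ps where ps: "comult H a = (\<Sum>(a, b)\<leftarrow>ps. tensor [a, b])" "set ps \<subseteq> C \<times> C"
      by (rule tensor_power_2_repr[OF D(4)[OF ab(1)] D(1)]) blast
    obtain qs where qs: "comult H b = (\<Sum>(a, b)\<leftarrow>qs. tensor [a, b])" "set qs \<subseteq> C \<times> C"
      by (rule tensor_power_2_repr[OF D(4)[OF ab(2)] D(1)]) blast
    have V: "set ps \<subseteq> total_space H \<times> total_space H" "set qs \<subseteq> total_space H \<times> total_space H"
      "a \<in> total_space H" "b \<in> total_space H" using ps(2) qs(2) ab D(2) by auto
    show ?thesis
      using comult_hmult_repr[OF ps(1) V(1,3) qs(1) V(2,4)]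
        tensor_lift_4_sum_list[OF D(1) bilinear_on_subset[OF bilinear_on_hmult D(2)] ps(2) qs(2)]
      unfolding total by (simp add: ps(1) qs(1))
  qed
  ultimately show "graded_bialgebra ?G"
    using comult_hunit counit_hunit counit_hmult D(2)
    unfolding graded_bialgebra_def total by (simp add: subsetD[OF D(2)])
qed

lemma below_add:
  assumes "below (p + q) k"
  shows "below p k" "below q k"
proof -
  have "enat (p $ i) \<le> enat ((p + q) $ i)" "enat (q $ i) \<le> enat ((p + q) $ i)" for i by simp_all
  then show "below p k" "below q k" using assms unfolding below_def by (blast intro: order_trans)+
qed

context gbialg
begin

text \<open>The line spanned by the unit is a graded subcoalgebra concentrated in degree 0, where
  the sign in \<open>bar\<close> is 1.\<close>

lemma hunit_in_even:
  assumes \<phi>: "hopf_character H \<phi>"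
  shows "hunit H \<in> agreement_subcoalgebra H k (bar H \<phi>) \<phi>"
proof -
  have lin: "linear_on (total_space H) \<phi>" using \<phi> by (simp add: hopf_character_def)
  let ?C = "rat_vector.span {hunit H}"
  have "?C \<subseteq> component H 0"
    using hunit_component subspace_component by (simp add: rat_vector.span_minimal)
  then have C0: "h \<in> component H 0" if "h \<in> ?C" for h using that by auto
  have "graded_subcoalgebra H ?C"
    unfolding graded_subcoalgebra_def
  proof (intro conjI)
    show "?C \<subseteq> total_space H" using C0 component_subset_total_space by blast
    show "?C = rat_vector.span (\<Union>n. ?C \<inter> component H n)"
      by (intro equalityI rat_vector.span_minimal)
        (use hunit_component in \<open>auto intro!: rat_vector.span_base\<close>)
    have "comult H (c *\<^sub>Q hunit H) \<in> tensor_power ?C 2" for c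
      unfolding linear_on_scale[OF linear_on_comult hunit_in] comult_hunit tensor_power_2
      by (intro rat_vector.span_scale rat_vector.span_base) (auto intro!: rat_vector.span_base)
    then show "comult H ` ?C \<subseteq> tensor_power ?C 2" by (auto simp: rat_vector.span_singleton)
  qed simp
  moreover have "bar H \<phi> h = \<phi> h" if h: "h \<in> ?C" "h \<in> component H n" for n h
  proof (cases "n = 0")
    case True
    then show ?thesis using bar_component[OF lin h(2)] by (simp add: weight_def)
  next
    case False
    then have "h = 0" using homogeneous_part_component[OF h(2), of n] homogeneous_part_component[OF C0[OF h(1)], of n] by simp
    then show ?thesis using linear_on_0[OF lin subspace_total_space] bar_component[OF lin h(2)] by simp
  qed
  ultimately have "?C \<subseteq> agreement_subcoalgebra H k (bar H \<phi>) \<phi>"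
    by (intro agreement_subcoalgebra_greatest[OF linear_on_bar[OF lin] lin])
  then show ?thesis by (auto intro: rat_vector.span_base)
qed

lemma hmult_in_even:
  assumes \<phi>: "hopf_character H \<phi>"
    and ab: "a \<in> agreement_subcoalgebra H k (bar H \<phi>) \<phi>" "b \<in> agreement_subcoalgebra H k (bar H \<phi>) \<phi>"
  shows "hmult H a b \<in> agreement_subcoalgebra H k (bar H \<phi>) \<phi>"
proof -
  have lin: "linear_on (total_space H) \<phi>" using \<phi> by (simp add: hopf_character_def)
  let ?E = "agreement_subcoalgebra H k (bar H \<phi>) \<phi>"
  note E = graded_subcoalgebra_agreement[OF linear_on_bar[OF lin] lin, of k]
  note ED = graded_subcoalgebraD[OF E]
  have even: "(-1) ^ weight n * \<phi> h = \<phi> h" if "below n k" "h \<in> ?E" "h \<in> component H n" for n h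
    using agreement_subcoalgebra_eq[OF linear_on_bar[OF lin] lin that] bar_component[OF lin that(3)] by simp
  \<comment> \<open>Only homogeneous factors are multiplied, so the span is graded by
    construction.\<close>
  let ?X = "{hmult H a b | a b p q. a \<in> ?E \<inter> component H p \<and> b \<in> ?E \<inter> component H q}"
  let ?D = "rat_vector.span ?X"
  have XV: "?X \<subseteq> total_space H" using hmult_in component_subset_total_space[of H] by blast
  then have DV: "?D \<subseteq> total_space H" by (rule rat_vector.span_minimal[OF _ subspace_total_space])
  have "graded_subcoalgebra H ?D"
    unfolding graded_subcoalgebra_def
  proof (intro conjI DV)
    have "?X \<subseteq> (\<Union>n. ?D \<inter> component H n)"
    proof
      fix x assume x: "x \<in> ?X"
      then obtain n where "x \<in> component H n" using hmult_component by blast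
      with rat_vector.span_base[OF x] show "x \<in> (\<Union>n. ?D \<inter> component H n)" by blast
    qed
    then have "?D \<subseteq> rat_vector.span (\<Union>n. ?D \<inter> component H n)" by (rule rat_vector.span_mono)
    moreover have "rat_vector.span (\<Union>n. ?D \<inter> component H n) \<subseteq> ?D"
      by (rule rat_vector.span_minimal) auto
    ultimately show "?D = rat_vector.span (\<Union>n. ?D \<inter> component H n)" by blast
    have "comult H x \<in> tensor_power ?D 2" if "x \<in> ?D" for x
      using that
    proof (rule linear_on_span_image[OF linear_on_subset[OF linear_on_comult DV], rotated 2])
      fix x assume "x \<in> ?X"
      then obtain a b p q where ab: "x = hmult H a b" "a \<in> ?E" "a \<in> component H p" "b \<in> ?E" "b \<in> component H q" by blast
      obtain ps where ps: "comult H a = (\<Sum>(a, b)\<leftarrow>ps. tensor [a, b])"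
        "\<And>a1 a2. (a1, a2) \<in> set ps \<Longrightarrow> \<exists>r s. a1 \<in> ?E \<inter> component H r \<and> a2 \<in> ?E \<inter> component H s \<and> r + s = p"
        by (rule graded_subcoalgebra_comult_repr[OF E ab(2,3)]) blast
      obtain qs where qs: "comult H b = (\<Sum>(a, b)\<leftarrow>qs. tensor [a, b])"
        "\<And>a1 a2. (a1, a2) \<in> set qs \<Longrightarrow> \<exists>r s. a1 \<in> ?E \<inter> component H r \<and> a2 \<in> ?E \<inter> component H s \<and> r + s = q"
        by (rule graded_subcoalgebra_comult_repr[OF E ab(4,5)]) blast
      have V: "set ps \<subseteq> total_space H \<times> total_space H" "set qs \<subseteq> total_space H \<times> total_space H"
        "a \<in> total_space H" "b \<in> total_space H" using ps(2) qs(2) ab ED(2) by fast+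
      have D: "hmult H a1 b1 \<in> ?D" "hmult H a2 b2 \<in> ?D" if "(a1, a2) \<in> set ps" "(b1, b2) \<in> set qs" for a1 a2 b1 b2
        using ps(2)[OF that(1)] qs(2)[OF that(2)] by (blast intro: rat_vector.span_base)+
      show "comult H x \<in> tensor_power ?D 2"
        unfolding ab(1) comult_hmult_repr[OF ps(1) V(1,3) qs(1) V(2,4)]
      proof (rule sum_list_in_subspace)
        fix y assume "y \<in> set (concat (map (\<lambda>(a1, a2). map (\<lambda>(b1, b2). (hmult H a1 b1, hmult H a2 b2)) qs) ps))"
        then obtain a1 a2 b1 b2 where "(a1, a2) \<in> set ps" "(b1, b2) \<in> set qs" "y = (hmult H a1 b1, hmult H a2 b2)"
          by auto
        then show "(case y of (a, b) \<Rightarrow> tensor [a, b]) \<in> tensor_power ?D 2"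
          by (simp only: prod.case) (rule tensor2_in_tensor_power[OF D])
      qed (simp add: tensor_power_2)
    qed (simp add: tensor_power_2)
    then show "comult H ` ?D \<subseteq> tensor_power ?D 2" by blast
  qed simp
  moreover have "bar H \<phi> h = \<phi> h" if n: "below n k" and h: "h \<in> ?D" "h \<in> component H n" for n h
  proof -
    \<comment> \<open>An element of \<open>?D\<close> of degree \<open>n\<close> may be written with
      products of other degrees. Testing the degree \<open>n\<close> part instead makes the
      condition linear, so that it can be checked on the generators.\<close>
    have l: "linear_on ?D (\<lambda>h. \<phi> (homogeneous_part H n h))"
      by (rule linear_on_subset[OF linear_on_functional_part[OF lin] DV])
    have "(-1) ^ weight n * \<phi> (homogeneous_part H n h) = \<phi> (homogeneous_part H n h)"
    proof (rule linear_on_eq_span[OF linear_on_mult_const[OF l] l _ h(1)])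
      fix x assume "x \<in> ?X"
      then obtain a b p q where ab: "x = hmult H a b" "a \<in> ?E" "a \<in> component H p" "b \<in> ?E" "b \<in> component H q" by blast
      then have x: "x \<in> component H (p + q)" using hmult_component by auto
      have V: "a \<in> total_space H" "b \<in> total_space H" using ab ED(2) by auto
      show "(-1) ^ weight n * \<phi> (homogeneous_part H n x) = \<phi> (homogeneous_part H n x)"
      proof (cases "n = p + q")
        case True
        have "below p k" "below q k"
          using n below_add[of p q k] by (simp_all add: True)
        then have "((-1) ^ weight p * \<phi> a) * ((-1) ^ weight q * \<phi> b) = \<phi> a * \<phi> b"
          by (simp only: even[OF _ ab(2,3)] even[OF _ ab(4,5)])
        moreover have "\<phi> x = \<phi> a * \<phi> b" using \<phi> V by (simp add: hopf_character_def ab(1))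
        ultimately show ?thesis
          using homogeneous_part_component[OF x, of n] True by (simp add: weight_add power_add algebra_simps)
      next
        case False
        then show ?thesis
          using homogeneous_part_component[OF x, of n] linear_on_0[OF lin subspace_total_space] by simp
      qed
    qed
    then show ?thesis using bar_component[OF lin h(2)] homogeneous_part_component[OF h(2)] by simp
  qed
  ultimately have DE: "?D \<subseteq> ?E"
    by (intro agreement_subcoalgebra_greatest[OF linear_on_bar[OF lin] lin])
  \<comment> \<open>\<open>?D\<close> contains only combinations of products of homogeneous
    elements; linearity in each factor passes to arbitrary \<open>a\<close> and
    \<open>b\<close>.\<close>
  have l: "linear_on ?E (\<lambda>x. hmult H x y)" "linear_on ?E (hmult H y)" if "y \<in> ?E" for y
    using bilinear_on_subset[OF bilinear_on_hmult ED(2)] that by (auto simp: bilinear_on_def)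
  have "hmult H x b \<in> ?E" if x: "x \<in> ?E" "x \<in> component H p" for x p
    by (rule graded_subcoalgebra_imageI[OF E l(2)[OF x(1)] ED(1) _ ab(2)])
      (rule subsetD[OF DE rat_vector.span_base], use x in blast)
  then show ?thesis
    by (intro graded_subcoalgebra_imageI[OF E l(1)[OF ab(2)] ED(1) _ ab(1)])
qed

end

text \<open>The restriction is again a connected graded bialgebra, so its antipode comes from the
  general construction rather than from stability under the antipode of \<open>H\<close>.
  Invertibility of \<phi> on the restriction then follows from that antipode.\<close>

lemma (in gbialg_connected) even_sub_hopf_algebra:
  fixes k
  assumes \<phi>: "hopf_character H \<phi>"
  defines "G \<equiv> H\<lparr>component := \<lambda>n. agreement_subcoalgebra H k (bar H \<phi>) \<phi> \<inter> component H n\<rparr>"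
  shows "combinatorial_hopf_algebra G \<phi>" "even_functional G k \<phi>"
    and "total_space G = agreement_subcoalgebra H k (bar H \<phi>) \<phi>"
proof -
  let ?E = "agreement_subcoalgebra H k (bar H \<phi>) \<phi>"
  have lin: "linear_on (total_space H) \<phi>" using \<phi> by (simp add: hopf_character_def)
  note E = graded_subcoalgebra_agreement[OF linear_on_bar[OF lin] lin, of k]
  note ED = graded_subcoalgebraD[OF E]
  note sub = graded_bialgebra_sub[OF E hunit_in_even[OF \<phi>] hmult_in_even[OF \<phi>], folded G_def]
  show total: "total_space G = ?E" by (rule sub(2))
  have sel: "component G n = ?E \<inter> component H n" "hmult G = hmult H" "hunit G = hunit H" for n
    by (simp_all add: G_def)
  interpret G: gbialg_connected G
  proof
    show "graded_bialgebra G" by (rule sub(1))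
    have "rat_vector.span {hunit H} \<subseteq> ?E"
      using hunit_in_even[OF \<phi>] ED(1) by (simp add: rat_vector.span_minimal)
    then show "component G 0 = rat_vector.span {hunit G}" using connected by (auto simp: sel)
  qed
  have char: "hopf_character G \<phi>"
    using \<phi> ED(2) linear_on_subset[OF lin ED(2)] unfolding hopf_character_def total sel by auto
  then show "combinatorial_hopf_algebra G \<phi>"
    by (simp add: combinatorial_hopf_algebra_def G.connected_graded_hopf_algebra)
  have "bar G \<phi> h = \<phi> h" if n: "below n k" and h: "h \<in> component G n" for n h
  proof -
    have "linear_on (total_space G) \<phi>" using char by (simp add: hopf_character_def)
    from G.bar_component[OF this h] show ?thesis
      using agreement_subcoalgebra_eq[OF linear_on_bar[OF lin] lin n] bar_component[OF lin, of h n] h by (simp add: sel)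
  qed
  then show "even_functional G k \<phi>"
    using G.hopf_character_invertible[OF G.is_antipode_antipode char] char
    by (simp add: even_functional_def hopf_character_def)
qed

section \<open>The universal morphism\<close>

lemma morphism_homogeneous_part:
  assumes H: "gcoalg H" and G: "gcoalg G" and f: "graded_coalgebra_morphism H G f" and h: "h \<in> total_space H"
  shows "homogeneous_part G n (f h) = f (homogeneous_part H n h)"
proof -
  interpret H: gcoalg H by (rule H)
  interpret G: gcoalg G by (rule G)
  have lin: "linear_on (total_space H) f" using f by (simp add: graded_coalgebra_morphism_def)
  show ?thesis
  proof (rule total_space_eqI[OF _ _ _ h])
    show "linear_on (total_space H) (\<lambda>h. homogeneous_part G n (f h))"
      by (rule linear_on_compose[OF lin G.linear_on_homogeneous_part morphism_in[OF f]])
    show "linear_on (total_space H) (\<lambda>h. f (homogeneous_part H n h))"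
      by (rule linear_on_compose[OF H.linear_on_homogeneous_part lin H.homogeneous_part_in_total_space])
    fix m x assume x: "x \<in> component H m"
    then have "f x \<in> component G m" using f by (auto simp: graded_coalgebra_morphism_def)
    then show "homogeneous_part G n (f x) = f (homogeneous_part H n x)"
      by (simp add: G.homogeneous_part_component H.homogeneous_part_component[OF x] linear_on_0[OF lin subspace_total_space])
  qed
qed

lemma word_functional_morphism:
  assumes H: "gcoalg H" and G: "gcoalg G" and f: "graded_coalgebra_morphism H G f"
    and \<psi>: "linear_on (total_space G) \<psi>" and eq: "\<And>h. h \<in> total_space H \<Longrightarrow> \<psi> (f h) = \<phi> h"
    and h: "h \<in> total_space H"
  shows "word_functional G \<psi> I (f h) = word_functional H \<phi> I h"
  using h
proof (induction I arbitrary: h)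
  case Nil
  then show ?case using f by (simp add: word_functional_simps graded_coalgebra_morphism_def)
next
  interpret H: gcoalg H by (rule H)
  case (Cons n I)
  have "word_functional G \<psi> (n # I) (f h) =
    sweedler H (\<lambda>a b. \<psi> (homogeneous_part G n (f a)) * word_functional G \<psi> I (f b)) h"
    unfolding word_functional_simps convolve_def
    by (rule gcoalg.sweedler_morphism[OF H G f bilinear_on_mult Cons.prems])
      (use gcoalg.linear_on_functional_part[OF G \<psi>] gcoalg.linear_on_word_functional[OF G \<psi>] in auto)
  also have "\<dots> = word_functional H \<phi> (n # I) h"
    unfolding word_functional_simps convolve_def
    by (rule gcoalg.sweedler_cong[OF H])
      (simp add: Cons.IH morphism_homogeneous_part[OF H G f] eq H.homogeneous_part_in_total_space)
  finally show ?case .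
qed

context gcoalg
begin

lemma word_functional_component:
  assumes \<phi>: "linear_on (total_space H) \<phi>"
  shows "h \<in> component H n \<Longrightarrow> sum_list I \<noteq> n \<Longrightarrow> word_functional H \<phi> I h = 0"
proof (induction I arbitrary: h n)
  case Nil
  then show ?case by (simp add: word_functional_simps counit_component)
next
  case (Cons m I)
  have "word_functional H \<phi> (m # I) h \<in> {0}"
    unfolding word_functional_simps convolve_def
  proof (rule sweedler_in_graded[OF bilinear_on_mult[OF linear_on_functional_part[OF \<phi>] linear_on_word_functional[OF \<phi>]]
        _ Cons.prems(1)])
    fix a b p q assume ab: "a \<in> component H p" "b \<in> component H q" "p + q = n"
    show "\<phi> (homogeneous_part H m a) * word_functional H \<phi> I b \<in> {0}"
    proof (cases "m = p")
      case True
      then have "sum_list I \<noteq> q" using Cons.prems(2) ab(3) by auto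
      then show ?thesis using Cons.IH[OF ab(2)] by simp
    next
      case False
      then show ?thesis
        using homogeneous_part_component[OF ab(1), of m] linear_on_0[OF \<phi> subspace_total_space] by simp
    qed
  qed simp
  then show ?case by simp
qed

lemma word_functional_append:
  assumes \<phi>: "linear_on (total_space H) \<phi>"
  shows "h \<in> total_space H \<Longrightarrow>
    word_functional H \<phi> (I @ J) h = convolve H (*) (word_functional H \<phi> I) (word_functional H \<phi> J) h"
proof (induction I arbitrary: h)
  case Nil
  then show ?case by (simp add: word_functional_simps convolve_counit_left linear_on_word_functional[OF \<phi>])
next
  case (Cons n I)
  have "word_functional H \<phi> ((n # I) @ J) h = convolve H (*) (\<lambda>h. \<phi> (homogeneous_part H n h))
      (convolve H (*) (word_functional H \<phi> I) (word_functional H \<phi> J)) h"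
    unfolding append_Cons word_functional_simps by (rule convolve_cong[OF refl Cons.IH])
  also have "\<dots> = convolve H (*) (word_functional H \<phi> (n # I)) (word_functional H \<phi> J) h"
    unfolding word_functional_simps
    by (rule convolve_assoc[OF algebra_on_rat, symmetric])
      (use Cons.prems linear_on_word_functional[OF \<phi>] linear_on_functional_part[OF \<phi>] in \<open>auto simp: linear_into_UNIV\<close>)
  finally show ?case .
qed

definition qsym_map :: "('h \<Rightarrow> rat) \<Rightarrow> 'h \<Rightarrow> (nat \<times> 'l) power_series" where
  "qsym_map \<phi> h = (\<Sum>n\<in>Poly_Mapping.keys (homogeneous_parts H h).
     \<Sum>I\<in>vec_compositions n. word_functional H \<phi> I (homogeneous_part H n h) *\<^sub>Q monomial_qsym I)"

context
  fixes \<phi> :: "'h \<Rightarrow> rat" assumes \<phi>: "linear_on (total_space H) \<phi>"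
begin

lemma linear_on_qsym_summand:
  "linear_on (total_space H) (\<lambda>h. \<Sum>I\<in>vec_compositions n. word_functional H \<phi> I h *\<^sub>Q monomial_qsym I)"
  by (rule linear_on_sum_fun)
    (simp add: linear_on_def linear_on_add[OF linear_on_word_functional[OF \<phi>]]
      linear_on_scale[OF linear_on_word_functional[OF \<phi>]] scaleQ_add_left scaleQ_scaleQ scaleQ_rat_def)

lemma linear_on_qsym_map: "linear_on (total_space H) (qsym_map \<phi>)"
  unfolding qsym_map_def by (rule linear_on_componentwise[OF linear_on_qsym_summand])

lemma qsym_map_component:
  "h \<in> component H n \<Longrightarrow> qsym_map \<phi> h = (\<Sum>I\<in>vec_compositions n. word_functional H \<phi> I h *\<^sub>Q monomial_qsym I)"
  unfolding qsym_map_def by (rule componentwise_component[OF linear_on_qsym_summand])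

lemma qsym_map_in_component: "h \<in> component H n \<Longrightarrow> qsym_map \<phi> h \<in> component QSym n"
  unfolding qsym_map_component component_QSym
  by (intro rat_vector.span_sum rat_vector.span_scale rat_vector.span_base imageI)

lemma qsym_map_in_total_space: "h \<in> total_space H \<Longrightarrow> qsym_map \<phi> h \<in> total_space QSym"
  by (rule total_space_imageI[OF linear_on_qsym_map subspace_total_space])
    (use qsym_map_in_component component_subset_total_space[of QSym] in blast)

text \<open>At this stage zero letters must be dropped on the right, because the map is assembled
  from compositions. Once \<zeta> \<circ> \<Psi> = \<phi> is known,
  \<open>qsym_morphism_unique\<close> gives the same formula with \<open>w\<close> itself.\<close>

lemma word_coeff_qsym_map:
  assumes "h \<in> total_space H"
  shows "word_coeff w (qsym_map \<phi> h) = word_functional H \<phi> (nonzeros w) h"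
proof (rule total_space_eqI[OF linear_on_compose[OF linear_on_qsym_map linear_on_word_coeff[of UNIV]]
      linear_on_word_functional[OF \<phi>] _ assms])
  fix n h assume h: "h \<in> component H n"
  have "word_coeff w (qsym_map \<phi> h) =
    (\<Sum>I\<in>vec_compositions n. if I = nonzeros w then word_functional H \<phi> (nonzeros w) h else 0)"
    unfolding qsym_map_component[OF h] word_coeff_sum
    by (intro sum.cong) (auto simp: word_coeff_scale word_coeff_monomial vec_compositions_def)
  also have "\<dots> = (if nonzeros w \<in> vec_compositions n then word_functional H \<phi> (nonzeros w) h else 0)"
    by (simp add: sum.delta finite_vec_compositions)
  also have "\<dots> = word_functional H \<phi> (nonzeros w) h"
    using word_functional_component[OF \<phi> h, of "nonzeros w"] by (auto simp: vec_compositions_def)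
  finally show "word_coeff w (qsym_map \<phi> h) = word_functional H \<phi> (nonzeros w) h" .
qed simp

text \<open>In homogeneous degree both sides have the coefficient \<phi>^JK(h) at the tensor of M_J
  and M_K: on the left by deconcatenation, on the right because \<phi>^JK is the convolution of
  \<phi>^J and \<phi>^K.\<close>

lemma comult_qsym_map:
  assumes "h \<in> total_space H"
  shows "comult QSym (qsym_map \<phi> h) = sweedler H (\<lambda>a b. tensor [qsym_map \<phi> a, qsym_map \<phi> b]) h"
proof -
  have bil: "bilinear_on (total_space H) (\<lambda>a b. tensor [qsym_map \<phi> a, qsym_map \<phi> b])"
    by (rule bilinear_on_compose[OF bilinear_on_tensor2[of UNIV]]) (simp_all add: linear_into_UNIV linear_on_qsym_map)
  show ?thesis
  proof (rule total_space_eqI[OF _ linear_on_sweedler[OF bil] _ assms])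
    show "linear_on (total_space H) (\<lambda>h. comult QSym (qsym_map \<phi> h))"
      by (rule linear_on_compose[OF linear_on_qsym_map linear_map_imp_linear_on[OF linear_map_comult_QSym, of UNIV]]) simp
    fix n h assume h: "h \<in> component H n"
    then have hV: "h \<in> total_space H" using component_subset_total_space by blast
    obtain ps where ps: "comult H h = (\<Sum>(a, b)\<leftarrow>ps. tensor [a, b])"
      "\<And>a b. (a, b) \<in> set ps \<Longrightarrow> \<exists>p q. a \<in> component H p \<and> b \<in> component H q \<and> p + q = n"
      by (rule comult_repr_graded[OF h]) blast
    then have sub: "set ps \<subseteq> total_space H \<times> total_space H"
      using component_subset_total_space[of H] by fast
    let ?F = "compositions_upto (weight n) :: (nat ^ 'l) list set"
    let ?t = "\<lambda>J K. tensor [monomial_qsym J, monomial_qsym K :: (nat \<times> 'l) power_series]"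
    have nz: "nonzeros J = J" if "J \<in> ?F" for J
      using that by (simp add: compositions_upto_def nonzeros_composition)
    have "sweedler H (\<lambda>a b. tensor [qsym_map \<phi> a, qsym_map \<phi> b]) h =
      (\<Sum>p\<leftarrow>ps. tensor [qsym_map \<phi> (fst p), qsym_map \<phi> (snd p)])"
      using sweedler_repr[OF bil ps(1) sub] by (simp add: split_def)
    also have "\<dots> = (\<Sum>p\<leftarrow>ps. \<Sum>J\<in>?F. \<Sum>K\<in>?F. (word_functional H \<phi> J (fst p) * word_functional H \<phi> K (snd p)) *\<^sub>Q ?t J K)"
    proof (intro arg_cong[where f = sum_list] map_cong refl)
      fix x assume x: "x \<in> set ps"
      then obtain p q where pq: "fst x \<in> component H p" "snd x \<in> component H q" "p + q = n"
        using ps(2)[of "fst x" "snd x"] by auto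
      have V: "fst x \<in> total_space H" "snd x \<in> total_space H" using x sub by auto
      have "weight p \<le> weight n" "weight q \<le> weight n" using pq(3) weight_add[of p q] by auto
      from tensor2_expansion[OF qsym_map_in_component[OF pq(1)] qsym_map_in_component[OF pq(2)] this]
      show "tensor [qsym_map \<phi> (fst x), qsym_map \<phi> (snd x)] =
        (\<Sum>J\<in>?F. \<Sum>K\<in>?F. (word_functional H \<phi> J (fst x) * word_functional H \<phi> K (snd x)) *\<^sub>Q ?t J K)"
        by (simp add: word_coeff_qsym_map V nz)
    qed
    also have "\<dots> = (\<Sum>J\<in>?F. \<Sum>K\<in>?F. (\<Sum>p\<leftarrow>ps. word_functional H \<phi> J (fst p) * word_functional H \<phi> K (snd p)) *\<^sub>Q ?t J K)"
      by (simp add: sum_list_sum_swap sum_list_scaleQ_left)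
    also have "\<dots> = (\<Sum>J\<in>?F. \<Sum>K\<in>?F. word_functional H \<phi> (J @ K) h *\<^sub>Q ?t J K)"
      unfolding word_functional_append[OF \<phi> hV] convolve_def
        sweedler_repr[OF bilinear_on_mult[OF linear_on_word_functional[OF \<phi>] linear_on_word_functional[OF \<phi>]] ps(1) sub]
      by (simp add: split_def)
    also have "\<dots> = comult QSym (qsym_map \<phi> h)"
      unfolding comult_QSym_expansion[OF qsym_map_in_component[OF h] order_refl]
      by (simp add: word_coeff_qsym_map[OF hV] nz)
    finally show "comult QSym (qsym_map \<phi> h) = sweedler H (\<lambda>a b. tensor [qsym_map \<phi> a, qsym_map \<phi> b]) h" ..
  qed
qed

lemma qsym_map_morphism: "graded_coalgebra_morphism H QSym (qsym_map \<phi>)"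
  unfolding graded_coalgebra_morphism_def
proof (intro conjI ballI allI linear_on_qsym_map)
  show "qsym_map \<phi> ` component H n \<subseteq> component QSym n" for n
    using qsym_map_in_component by blast
  fix h assume h: "h \<in> total_space H"
  show "comult QSym (qsym_map \<phi> h) = tensor_lift (total_space H) 2 (\<lambda>xs. tensor (map (qsym_map \<phi>) xs)) (comult H h)"
  proof -
    have "tensor_lift (total_space H) 2 (\<lambda>xs. tensor (map (qsym_map \<phi>) xs)) =
      tensor_lift (total_space H) 2 (\<lambda>xs. tensor [qsym_map \<phi> (xs ! 0), qsym_map \<phi> (xs ! 1)])"
      by (rule tensor_lift_cong) (auto simp: length_Suc_conv numeral_2_eq_2)
    then show ?thesis using comult_qsym_map[OF h] by (simp add: sweedler_def)
  qed
  show "counit QSym (qsym_map \<phi> h) = counit H h"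
    using word_coeff_qsym_map[OF h, of "[]"] qsym_map_in_total_space[OF h]
    by (simp add: counit_QSym word_functional_simps)
qed

end

text \<open>Determines every coefficient of \<open>f h\<close>. Besides uniqueness it is applied to
  the universal morphism itself, to obtain its coefficients at words with zero letters.\<close>

lemma qsym_morphism_unique:
  assumes f: "graded_coalgebra_morphism H QSym f" "\<And>h. h \<in> total_space H \<Longrightarrow> zeta_Q (f h) = \<phi> h"
    and h: "h \<in> total_space H"
  shows "word_coeff w (f h) = word_functional H \<phi> w h"
  using word_functional_morphism[OF gcoalg_axioms QSym.gcoalg_axioms f(1)
      linear_map_imp_linear_on[OF linear_map_zeta_Q] f(2) h, of w]
    word_functional_zeta_Q[OF morphism_in[OF f(1) h]] by simp

lemma morphism_image_subcoalgebra:
  assumes G: "gcoalg G" and f: "graded_coalgebra_morphism H G f"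
  shows "graded_subcoalgebra G (f ` total_space H)"
proof -
  let ?V = "total_space H" and ?C = "f ` total_space H"
  have lin: "linear_on ?V f" using f by (simp add: graded_coalgebra_morphism_def)
  have C: "rat_vector.subspace ?C"
  proof (rule rat_vector.subspaceI)
    show "0 \<in> ?C" using linear_on_0[OF lin subspace_total_space] rat_vector.subspace_0[OF subspace_total_space]
      by (metis imageI)
    show "x + y \<in> ?C" if "x \<in> ?C" "y \<in> ?C" for x y
      using that by (auto simp: linear_on_add[OF lin, symmetric] intro!: imageI rat_vector.subspace_add[OF subspace_total_space])
    show "c *\<^sub>Q x \<in> ?C" if "x \<in> ?C" for c x
      using that by (auto simp: linear_on_scale[OF lin, symmetric] intro!: imageI rat_vector.subspace_scale[OF subspace_total_space])
  qed
  show ?thesis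
    unfolding graded_subcoalgebra_def
  proof (intro conjI C)
    show "?C \<subseteq> total_space G" using morphism_in[OF f] by blast
    have "f h \<in> rat_vector.span (\<Union>n. ?C \<inter> component G n)" if h: "h \<in> ?V" for h
    proof (rule total_space_imageI[OF lin rat_vector.subspace_span _ h])
      fix n x assume x: "x \<in> component H n"
      then have "f x \<in> component G n" using f by (auto simp: graded_coalgebra_morphism_def)
      then show "f x \<in> rat_vector.span (\<Union>n. ?C \<inter> component G n)"
        using x component_subset_total_space[of H n] by (intro rat_vector.span_base) blast
    qed
    moreover have "rat_vector.span (\<Union>n. ?C \<inter> component G n) \<subseteq> ?C"
      by (rule rat_vector.span_minimal[OF _ C]) auto
    ultimately show "?C = rat_vector.span (\<Union>n. ?C \<inter> component G n)" by blast
    have "comult G (f h) \<in> tensor_power ?C 2" if h: "h \<in> ?V" for h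
    proof -
      obtain ps where ps: "comult H h = (\<Sum>(a, b)\<leftarrow>ps. tensor [a, b])" "set ps \<subseteq> ?V \<times> ?V"
        by (rule comult_repr[OF h]) blast
      show ?thesis
        unfolding comult_morphism_repr[OF f h ps]
        by (rule sum_list_in_subspace) (use ps(2) in \<open>auto simp: tensor_power_def intro!: tensor2_in_tensor_power[unfolded tensor_power_def]\<close>)
    qed
    then show "comult G ` ?C \<subseteq> tensor_power ?C 2" by blast
  qed
qed

lemma morphism_image_even:
  assumes f: "graded_coalgebra_morphism H QSym f" "\<And>h. h \<in> total_space H \<Longrightarrow> zeta_Q (f h) = \<phi> h"
    and \<phi>: "linear_on (total_space H) \<phi>" and even: "\<And>n h. below n k \<Longrightarrow> h \<in> component H n \<Longrightarrow> bar H \<phi> h = \<phi> h"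
  shows "f ` total_space H \<subseteq> even_qsym k"
  unfolding even_qsym_def
proof (rule QSym.agreement_subcoalgebra_greatest)
  have zeta: "linear_on (total_space QSym) zeta_Q" by (rule linear_map_imp_linear_on[OF linear_map_zeta_Q])
  then show "linear_on (total_space QSym) (bar QSym zeta_Q)" by (rule QSym.linear_on_bar)
  show "linear_on (total_space QSym) zeta_Q" by (rule zeta)
  show "graded_subcoalgebra QSym (f ` total_space H)"
    by (rule morphism_image_subcoalgebra[OF QSym.gcoalg_axioms f(1)])
  fix n y assume n: "below n k" and y: "y \<in> f ` total_space H" "y \<in> component QSym n"
  then obtain h where h: "h \<in> total_space H" "y = f h" by blast
  \<comment> \<open>The preimage \<open>h\<close> of a homogeneous \<open>y\<close> need not be
    homogeneous; its part of degree \<open>n\<close> is also mapped to \<open>y\<close>, and there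
    evenness of \<phi> applies.\<close>
  let ?h = "homogeneous_part H n h"
  have "y = homogeneous_part QSym n y" using y(2) by (simp add: QSym.homogeneous_part_component)
  also have "\<dots> = f ?h"
    unfolding h(2) by (rule morphism_homogeneous_part[OF gcoalg_axioms QSym.gcoalg_axioms f(1) h(1)])
  finally have "zeta_Q y = \<phi> ?h" using f(2)[OF homogeneous_part_in_total_space[OF h(1)]] by simp
  moreover have "(-1) ^ weight n * \<phi> ?h = \<phi> ?h"
    using even[OF n homogeneous_part_in_component[OF h(1)]] bar_component[OF \<phi> homogeneous_part_in_component[OF h(1)]]
    by simp
  ultimately show "bar QSym zeta_Q y = zeta_Q y" using QSym.bar_component[OF zeta y(2)] by simp
qed

end

text \<open>The contribution of one letter to the product rule. For homogeneous factors at most one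
  splitting of \<open>n\<close> survives, and bilinearity does the rest.\<close>

lemma (in gbialg) functional_part_hmult:
  assumes \<phi>: "hopf_character H \<phi>" and ab: "a \<in> total_space H" "b \<in> total_space H"
  shows "\<phi> (homogeneous_part H n (hmult H a b)) =
    (\<Sum>(p, q)\<in>vec_splits n. \<phi> (homogeneous_part H p a) * \<phi> (homogeneous_part H q b))"
proof -
  let ?V = "total_space H"
  have lin: "linear_on ?V \<phi>" using \<phi> by (simp add: hopf_character_def)
  let ?L = "\<lambda>a b. \<phi> (homogeneous_part H n (hmult H a b))"
  let ?R = "\<lambda>a b. \<Sum>(p, q)\<in>vec_splits n. \<phi> (homogeneous_part H p a) * \<phi> (homogeneous_part H q b)"
  have L: "bilinear_on ?V ?L"
    by (rule bilinear_on_linear[OF bilinear_on_hmult linear_on_functional_part[OF lin] hmult_in])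
  have R: "bilinear_on ?V ?R"
    using bilinear_on_sum[of "vec_splits n" ?V "\<lambda>x a b. \<phi> (homogeneous_part H (fst x) a) * \<phi> (homogeneous_part H (snd x) b)"]
      bilinear_on_mult[OF linear_on_functional_part[OF lin] linear_on_functional_part[OF lin]]
    by (simp add: split_def)
  have homog: "?L a b = ?R a b" if a: "a \<in> component H p" and b: "b \<in> component H q" for a b p q
  proof -
    have V: "a \<in> ?V" "b \<in> ?V" using a b component_subset_total_space by blast+
    have "?R a b = (\<Sum>x\<in>vec_splits n. if x = (p, q) then \<phi> a * \<phi> b else 0)"
      by (intro sum.cong refl, clarify)
        (auto simp: homogeneous_part_component[OF a] homogeneous_part_component[OF b] linear_on_0[OF lin subspace_total_space])
    also have "\<dots> = (if p + q = n then \<phi> a * \<phi> b else 0)"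
      by (simp add: sum.delta finite_vec_splits) (simp add: vec_splits_def)
    also have "\<dots> = ?L a b"
      using \<phi> V homogeneous_part_component[OF hmult_component[OF a b], of n]
      by (auto simp: hopf_character_def linear_on_0[OF lin subspace_total_space])
    finally show ?thesis ..
  qed
  have "?L x b = ?R x b" if x: "x \<in> component H p" for x p
    by (rule total_space_eqI[OF _ _ homog[OF x] ab(2)])
      (use L R x component_subset_total_space[of H p] in \<open>auto simp: bilinear_on_def\<close>)
  then show ?thesis
    by (intro total_space_eqI[where f = "\<lambda>a. ?L a b" and g = "\<lambda>a. ?R a b", OF _ _ _ ab(1)])
      (use L R ab(2) in \<open>auto simp: bilinear_on_def\<close>)
qed

text \<open>Peel off the first letter and use that the coproduct is multiplicative. The first letter
  splits by \<open>functional_part_hmult\<close> and the remaining word by induction; for a fixed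
  splitting the terms from \<open>a\<close> and those from \<open>b\<close> separate, and each
  resums to a word functional.\<close>

lemma (in gbialg) word_functional_hmult:
  assumes \<phi>: "hopf_character H \<phi>"
  shows "a \<in> total_space H \<Longrightarrow> b \<in> total_space H \<Longrightarrow>
    word_functional H \<phi> w (hmult H a b) = (\<Sum>(A, B)\<in>splits w. word_functional H \<phi> A a * word_functional H \<phi> B b)"
proof (induction w arbitrary: a b)
  case Nil
  then show ?case by (simp add: splits_Nil word_functional_simps counit_hmult)
next
  case (Cons n w)
  let ?V = "total_space H" and ?W = "word_functional H \<phi>" and ?\<phi> = "\<lambda>n h. \<phi> (homogeneous_part H n h)"
  have lin: "linear_on ?V \<phi>" using \<phi> by (simp add: hopf_character_def)
  have bil: "bilinear_on ?V (\<lambda>x y. ?\<phi> m x * ?W v y)" for m v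
    by (rule bilinear_on_mult[OF linear_on_functional_part[OF lin] linear_on_word_functional[OF lin]])
  obtain ps where ps: "comult H a = (\<Sum>(a, b)\<leftarrow>ps. tensor [a, b])" "set ps \<subseteq> ?V \<times> ?V"
    by (rule comult_repr[OF Cons.prems(1)]) blast
  obtain qs where qs: "comult H b = (\<Sum>(a, b)\<leftarrow>qs. tensor [a, b])" "set qs \<subseteq> ?V \<times> ?V"
    by (rule comult_repr[OF Cons.prems(2)]) blast
  have W: "?W (m # v) a = (\<Sum>p\<leftarrow>ps. ?\<phi> m (fst p) * ?W v (snd p))" "?W (m # v) b = (\<Sum>q\<leftarrow>qs. ?\<phi> m (fst q) * ?W v (snd q))" for m v
    unfolding word_functional_simps convolve_def sweedler_repr[OF bil ps] sweedler_repr[OF bil qs]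
    by (simp_all add: split_def)
  let ?rs = "concat (map (\<lambda>(a1, a2). map (\<lambda>(b1, b2). (hmult H a1 b1, hmult H a2 b2)) qs) ps)"
  have "set ?rs \<subseteq> ?V \<times> ?V" using ps(2) qs(2) hmult_in by fastforce
  from sweedler_repr[OF bil comult_hmult_repr[OF ps Cons.prems(1) qs Cons.prems(2)] this]
  have "?W (n # w) (hmult H a b) = (\<Sum>p\<leftarrow>ps. \<Sum>q\<leftarrow>qs. ?\<phi> n (hmult H (fst p) (fst q)) * ?W w (hmult H (snd p) (snd q)))"
    unfolding word_functional_simps convolve_def by (simp add: sum_list_concat_map split_def comp_def)
  also have "\<dots> = (\<Sum>p\<leftarrow>ps. \<Sum>q\<leftarrow>qs. \<Sum>x\<in>vec_splits n. \<Sum>y\<in>splits w.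
      (?\<phi> (fst x) (fst p) * ?W (fst y) (snd p)) * (?\<phi> (snd x) (fst q) * ?W (snd y) (snd q)))"
  proof (intro arg_cong[where f = sum_list] map_cong refl)
    fix p q assume "p \<in> set ps" "q \<in> set qs"
    then have V: "fst p \<in> ?V" "snd p \<in> ?V" "fst q \<in> ?V" "snd q \<in> ?V" using ps(2) qs(2) by auto
    show "?\<phi> n (hmult H (fst p) (fst q)) * ?W w (hmult H (snd p) (snd q)) = (\<Sum>x\<in>vec_splits n. \<Sum>y\<in>splits w.
      (?\<phi> (fst x) (fst p) * ?W (fst y) (snd p)) * (?\<phi> (snd x) (fst q) * ?W (snd y) (snd q)))"
      unfolding functional_part_hmult[OF \<phi> V(1,3)] Cons.IH[OF V(2,4)] sum_product
      by (simp add: split_def algebra_simps)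
  qed
  also have "\<dots> = (\<Sum>x\<in>vec_splits n. \<Sum>y\<in>splits w. \<Sum>p\<leftarrow>ps. \<Sum>q\<leftarrow>qs.
      (?\<phi> (fst x) (fst p) * ?W (fst y) (snd p)) * (?\<phi> (snd x) (fst q) * ?W (snd y) (snd q)))"
    by (simp only: sum_list_sum_swap)
  also have "\<dots> = (\<Sum>x\<in>vec_splits n. \<Sum>y\<in>splits w. ?W (fst x # fst y) a * ?W (snd x # snd y) b)"
    by (simp only: sum_list_mult_sum_list W)
  also have "\<dots> = (\<Sum>(A, B)\<in>splits (n # w). ?W A a * ?W B b)"
    unfolding sum_splits_Cons by (simp add: split_def)
  finally show ?case .
qed

lemma vec_compositions_0: "vec_compositions 0 = {[]}"
proof -
  have "I = []" if "0 \<notin> set I" "sum_list I = 0" for I :: "(nat ^ 'a) list"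
    using that by (cases I) (auto simp: vec_eq_iff)
  then show ?thesis by (auto simp: vec_compositions_def)
qed

text \<open>The empty composition is the only one of degree 0. Connectedness in turn supplies the
  antipode of \<open>QSym\<close>.\<close>

interpretation QSym: gbialg_connected QSym
  by standard (simp add: component_QSym hunit_QSym vec_compositions_0 monomial_qsym_Nil)

lemma EvenQSym_eq:
  "EvenQSym k = QSym\<lparr>component := \<lambda>n. agreement_subcoalgebra QSym k (bar QSym zeta_Q) zeta_Q \<inter> component QSym n\<rparr>"
  by (simp add: EvenQSym_def even_qsym_def)

section \<open>The universal morphism for connected Hopf algebras, and terminality\<close>

context gbialg_connected
begin

text \<open>In degree \<open>n\<close> the left side is the coefficient at \<open>[n]\<close>. For
  nonzero \<open>n\<close> this is \<phi> directly; in degree 0 the word becomes empty and yields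
  the counit, which agrees with \<phi> because degree 0 is spanned by the unit and \<phi>(1) =
  1.\<close>

lemma zeta_qsym_map:
  assumes \<phi>: "linear_on (total_space H) \<phi>" and one: "\<phi> (hunit H) = 1" and h: "h \<in> total_space H"
  shows "zeta_Q (qsym_map \<phi> h) = \<phi> h"
proof (rule total_space_eqI[OF linear_on_compose[OF linear_on_qsym_map[OF \<phi>] linear_map_imp_linear_on[OF linear_map_zeta_Q, of UNIV]] \<phi> _ h])
  fix n x assume x: "x \<in> component H n"
  then have V: "x \<in> total_space H" using component_subset_total_space by blast
  have "zeta_Q (qsym_map \<phi> x) = word_functional H \<phi> (nonzeros [n]) x"
    by (simp only: zeta_Q_component[OF qsym_map_in_component[OF \<phi> x]] word_coeff_qsym_map[OF \<phi> V])
  also have "\<dots> = \<phi> x"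
  proof (cases "n = 0")
    case True
    then obtain c where "x = c *\<^sub>Q hunit H" using x connected by (auto simp: rat_vector.span_singleton)
    then show ?thesis
      using True by (simp add: word_functional_simps linear_on_scale[OF \<phi> hunit_in] one
          linear_on_scale[OF linear_on_counit hunit_in] counit_hunit)
  next
    case False
    then show ?thesis
      using convolve_counit_right[OF linear_on_functional_part[OF \<phi>] V, of n] homogeneous_part_component[OF x, of n]
      by (simp add: word_functional_simps)
  qed
  finally show "zeta_Q (qsym_map \<phi> x) = \<phi> x" .
qed simp

lemma qsym_map_unique:
  assumes \<phi>: "linear_on (total_space H) \<phi>" and one: "\<phi> (hunit H) = 1"
    and f: "graded_coalgebra_morphism H QSym f" "\<And>h. h \<in> total_space H \<Longrightarrow> zeta_Q (f h) = \<phi> h"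
    and h: "h \<in> total_space H"
  shows "f h = qsym_map \<phi> h"
  using qsym_morphism_unique[OF f h] qsym_morphism_unique[OF qsym_map_morphism[OF \<phi>] zeta_qsym_map[OF \<phi> one] h]
  by (intro power_series_eqI) simp

lemma qsym_map_hmult:
  assumes \<phi>: "hopf_character H \<phi>" and ab: "a \<in> total_space H" "b \<in> total_space H"
  shows "qsym_map \<phi> (hmult H a b) = qsym_map \<phi> a * qsym_map \<phi> b"
proof (rule power_series_eqI)
  have lin: "linear_on (total_space H) \<phi>" and one: "\<phi> (hunit H) = 1" using \<phi> by (auto simp: hopf_character_def)
  \<comment> \<open>The version for arbitrary words is required: splitting the letters of a
    composition produces zero letters.\<close>
  note coeff = qsym_morphism_unique[OF qsym_map_morphism[OF lin] zeta_qsym_map[OF lin one]]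
  fix w
  show "word_coeff w (qsym_map \<phi> (hmult H a b)) = word_coeff w (qsym_map \<phi> a * qsym_map \<phi> b)"
    using ab by (simp add: coeff word_coeff_times hmult_in word_functional_hmult[OF \<phi>])
qed

lemma qsym_map_hunit:
  assumes \<phi>: "linear_on (total_space H) \<phi>"
  shows "qsym_map \<phi> (hunit H) = 1"
  using qsym_map_component[OF \<phi> hunit_component]
  by (simp add: vec_compositions_0 word_functional_simps counit_hunit scaleQ_one monomial_qsym_Nil)

lemma qsym_map_hopf_morphism:
  assumes \<phi>: "hopf_character H \<phi>"
  shows "graded_hopf_morphism H QSym (qsym_map \<phi>)"
proof -
  have lin: "linear_on (total_space H) \<phi>" using \<phi> by (simp add: hopf_character_def)
  note mult = qsym_map_hmult[OF \<phi>] and one = qsym_map_hunit[OF lin] and mor = qsym_map_morphism[OF lin]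
  show ?thesis
    unfolding graded_hopf_morphism_def hmult_QSym hunit_QSym
    using mor mult one morphism_antipode[OF QSym.gbialg_axioms mor, unfolded hmult_QSym hunit_QSym, OF mult one]
    by blast
qed

text \<open>Apart from the components, the structure of \<open>EvenQSym k\<close> is that of
  \<open>QSym\<close>, so containment of the image in \<open>even_qsym k\<close> lets the codomain
  shrink.\<close>

lemma even_qsym_map_cha_morphism:
  assumes \<phi>: "hopf_character H \<phi>" and even: "even_functional H k \<phi>"
  shows "cha_morphism H \<phi> (EvenQSym k) zeta_Q (qsym_map \<phi>)"
proof -
  have lin: "linear_on (total_space H) \<phi>" and one: "\<phi> (hunit H) = 1" using \<phi> by (auto simp: hopf_character_def)
  have image: "qsym_map \<phi> ` total_space H \<subseteq> even_qsym k"
    by (rule morphism_image_even[OF qsym_map_morphism[OF lin] zeta_qsym_map[OF lin one] lin])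
      (use even in \<open>auto simp: even_functional_def\<close>)
  have E: "gbialg (EvenQSym k)"
    using QSym.even_sub_hopf_algebra(1)[OF hopf_character_zeta_Q, of k]
    by unfold_locales
      (simp add: EvenQSym_eq combinatorial_hopf_algebra_def connected_graded_hopf_algebra_def graded_hopf_algebra_def)
  have sel: "component (EvenQSym k) n = even_qsym k \<inter> component QSym n" "comult (EvenQSym k) = comult QSym"
    "counit (EvenQSym k) = counit QSym" "hmult (EvenQSym k) = (*)" "hunit (EvenQSym k) = 1" for n
    by (simp_all add: EvenQSym_def QSym_def)
  have mor: "graded_coalgebra_morphism H (EvenQSym k) (qsym_map \<phi>)"
    using qsym_map_morphism[OF lin] image component_subset_total_space[of H]
    unfolding graded_coalgebra_morphism_def sel by blast
  note mult = qsym_map_hmult[OF \<phi>] and unit = qsym_map_hunit[OF lin]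
  have "graded_hopf_morphism H (EvenQSym k) (qsym_map \<phi>)"
    unfolding graded_hopf_morphism_def sel
    using mor mult unit morphism_antipode[OF E mor, unfolded sel, OF mult unit] by blast
  then show ?thesis by (simp add: cha_morphism_def zeta_qsym_map[OF lin one])
qed

end

text \<open>Composition with the inclusion. It reduces uniqueness of morphisms into the terminal
  object to uniqueness of coalgebra morphisms into \<open>QSym\<close>.\<close>

lemma even_cha_morphism_to_QSym:
  assumes "cha_morphism H \<phi> (EvenQSym k) zeta_Q f"
  shows "graded_coalgebra_morphism H QSym f"
proof -
  have sel: "component (EvenQSym k) n = even_qsym k \<inter> component QSym n" "comult (EvenQSym k) = comult QSym"
    "counit (EvenQSym k) = counit QSym" for n
    by (simp_all add: EvenQSym_def)
  have "graded_coalgebra_morphism H (EvenQSym k) f"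
    using assms by (simp add: cha_morphism_def graded_hopf_morphism_def)
  then show ?thesis unfolding graded_coalgebra_morphism_def sel by blast
qed

theorem theorem4p22:
  fixes H :: "('h::rat_vector, 'l::finite) bialg"
    and \<phi> :: "'h \<Rightarrow> rat"
    and k :: "enat ^ 'l"
  shows
    "(connected_graded_hopf_algebra H \<and> even_functional H k \<phi> \<and> \<phi> (hunit H) = 1 \<longrightarrow>
       (\<exists>\<Psi> :: 'h \<Rightarrow> (nat \<times> 'l) power_series.
          graded_coalgebra_morphism H QSym \<Psi> \<and>
          (\<forall>h\<in>total_space H. zeta_Q (\<Psi> h) = \<phi> h) \<and>
          (\<forall>\<Psi>'. graded_coalgebra_morphism H QSym \<Psi>' \<and> (\<forall>h\<in>total_space H. zeta_Q (\<Psi>' h) = \<phi> h) \<longrightarrow>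
             (\<forall>h\<in>total_space H. \<Psi>' h = \<Psi> h)) \<and>
          \<Psi> ` total_space H \<subseteq> even_qsym k \<and>
          (\<forall>n. \<forall>h\<in>component H n.
             \<Psi> h = (\<Sum>I\<in>vec_compositions n. functional_component H \<phi> I h *\<^sub>Q monomial_qsym I)) \<and>
          (hopf_character H \<phi> \<longrightarrow> graded_hopf_morphism H QSym \<Psi>))) \<and>
     (combinatorial_hopf_algebra (EvenQSym k) zeta_Q \<and> even_functional (EvenQSym k) k zeta_Q \<and>
      (\<forall>(G :: ('h, 'l) bialg) \<gamma>.
         combinatorial_hopf_algebra G \<gamma> \<and> even_functional G k \<gamma> \<longrightarrow>
         (\<exists>f. cha_morphism G \<gamma> (EvenQSym k) zeta_Q f \<and>
            (\<forall>f'. cha_morphism G \<gamma> (EvenQSym k) zeta_Q f' \<longrightarrow> (\<forall>h\<in>total_space G. f' h = f h)))))"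
proof (intro conjI impI allI; (elim conjE)?)
  assume H: "connected_graded_hopf_algebra H" and even: "even_functional H k \<phi>" and one: "\<phi> (hunit H) = 1"
  then interpret gbialg_connected H
    by unfold_locales (auto simp: connected_graded_hopf_algebra_def graded_hopf_algebra_def)
  have \<phi>: "linear_on (total_space H) \<phi>" and bar: "\<And>n h. below n k \<Longrightarrow> h \<in> component H n \<Longrightarrow> bar H \<phi> h = \<phi> h"
    using even by (auto simp: even_functional_def)
  note mor = qsym_map_morphism[OF \<phi>] and zeta = zeta_qsym_map[OF \<phi> one]
  show "\<exists>\<Psi> :: 'h \<Rightarrow> (nat \<times> 'l) power_series.
          graded_coalgebra_morphism H QSym \<Psi> \<and>
          (\<forall>h\<in>total_space H. zeta_Q (\<Psi> h) = \<phi> h) \<and>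
          (\<forall>\<Psi>'. graded_coalgebra_morphism H QSym \<Psi>' \<and> (\<forall>h\<in>total_space H. zeta_Q (\<Psi>' h) = \<phi> h) \<longrightarrow>
             (\<forall>h\<in>total_space H. \<Psi>' h = \<Psi> h)) \<and>
          \<Psi> ` total_space H \<subseteq> even_qsym k \<and>
          (\<forall>n. \<forall>h\<in>component H n.
             \<Psi> h = (\<Sum>I\<in>vec_compositions n. functional_component H \<phi> I h *\<^sub>Q monomial_qsym I)) \<and>
          (hopf_character H \<phi> \<longrightarrow> graded_hopf_morphism H QSym \<Psi>)"
  proof (intro exI[of _ "qsym_map \<phi>"] conjI impI allI ballI mor zeta qsym_map_hopf_morphism; (elim conjE)?)
    show "\<Psi>' h = qsym_map \<phi> h" if "graded_coalgebra_morphism H QSym \<Psi>'"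
      "\<forall>h\<in>total_space H. zeta_Q (\<Psi>' h) = \<phi> h" "h \<in> total_space H" for \<Psi>' h
      using qsym_map_unique[OF \<phi> one] that by blast
    show "qsym_map \<phi> ` total_space H \<subseteq> even_qsym k"
      by (rule morphism_image_even[OF mor zeta \<phi> bar])
    show "qsym_map \<phi> h = (\<Sum>I\<in>vec_compositions n. functional_component H \<phi> I h *\<^sub>Q monomial_qsym I)"
      if h: "h \<in> component H n" for n h
    proof -
      have "h \<in> total_space H" using h component_subset_total_space by blast
      then show ?thesis
        by (simp add: qsym_map_component[OF \<phi> h] functional_component_eq_word_functional[OF \<phi>])
    qed
  qed
next
  show "combinatorial_hopf_algebra (EvenQSym k) zeta_Q"
    unfolding EvenQSym_eq by (rule QSym.even_sub_hopf_algebra[OF hopf_character_zeta_Q])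
  show "even_functional (EvenQSym k) k zeta_Q"
    unfolding EvenQSym_eq by (rule QSym.even_sub_hopf_algebra[OF hopf_character_zeta_Q])
next
  fix G :: "('h, 'l) bialg" and \<gamma>
  assume G: "combinatorial_hopf_algebra G \<gamma>" and even: "even_functional G k \<gamma>"
  then interpret gbialg_connected G
    by unfold_locales
      (auto simp: combinatorial_hopf_algebra_def connected_graded_hopf_algebra_def graded_hopf_algebra_def)
  have \<gamma>: "hopf_character G \<gamma>" and lin: "linear_on (total_space G) \<gamma>" and one: "\<gamma> (hunit G) = 1"
    using G by (auto simp: combinatorial_hopf_algebra_def hopf_character_def)
  have "f' h = qsym_map \<gamma> h" if "cha_morphism G \<gamma> (EvenQSym k) zeta_Q f'" "h \<in> total_space G" for f' h
    by (rule qsym_map_unique[OF lin one even_cha_morphism_to_QSym[OF that(1)] _ that(2)])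
      (use that(1) in \<open>simp add: cha_morphism_def\<close>)
  then show "\<exists>f. cha_morphism G \<gamma> (EvenQSym k) zeta_Q f \<and>
      (\<forall>f'. cha_morphism G \<gamma> (EvenQSym k) zeta_Q f' \<longrightarrow> (\<forall>h\<in>total_space G. f' h = f h))"
    using even_qsym_map_cha_morphism[OF \<gamma> even] by blast
qed

end
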